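(* An immersed ($C^1$, with nowhere vanishing velocity) motion of the $n$-trailer system, i.e. a $C^1$ immersed integral curve of the $n$-trailer system defined on a closed interval, is locally rigid if and only if it fixes the positions in the $(\xi_1,\xi_2)$-plane of the centers of the axles of at least two trailers, i.e. at least two of the axle centers $P_0,\dots,P_n$ are constant along the motion.
   Context: The $n$-trailer system ($n\ge0$) is the distribution on $\mathbb{R}^2\times(S^1)^{n+1}$, with coordinates $(\xi_1,\xi_2,\theta_0,\dots,\theta_n)$, spanned by $$\frac{\partial}{\partial\theta_n},\qquad \pi_0\cos(\theta_0)\frac{\partial}{\partial\xi_1}+\pi_0\sin(\theta_0)\frac{\partial}{\partial\xi_2}+\sum_{i=0}^{n-1}\pi_{i+1}\sin(\theta_{i+1}-\theta_i)\frac{\partial}{\partial\theta_i},$$ where $\pi_i=\prod_{j=i+1}^n\cos(\theta_j-\theta_{j-1})$ and $\pi_n=1$. It models a unicycle-like mobile robot towing $n$ trailers, each hooked at the center of the axle of the preceding vehicle, consecutive axle centers being at distance one. The point $(\xi_1,\xi_2)$ is the position of the last trailer and $\theta_0,\dots,\theta_n$ are the orientation angles, starting from the last trailer. The axle centers are $$P_k=\Big(\xi_1+\sum_{j=0}^{k-1}\cos\theta_j,\ \xi_2+\sum_{j=0}^{k-1}\sin\theta_j\Big),\qquad 0\le k\le n,$$ $P_0$ belonging to the last trailer and $P_n$ to the towing robot, which is counted here as the first trailer. Rigidity. Let $\mathcal{D}$ be a distribution on $M$. For points $p,q\in M$ and a closed interval $[a,b]$, let $\mathcal{O}_{p,q}$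 be the space of $C^1$ integral curves $x:[a,b]\to M$ of $\mathcal{D}$ with $x(a)=p$, $x(b)=q$, with the $C^1$-topology. A curve $x(\cdot)\in\mathcal{O}_{p,q}$ is rigid if it has a neighborhood $\mathcal{V}$ in $\mathcal{O}_{p,q}$ such that any curve in $\mathcal{V}$ is a reparametrization of $x(\cdot)$. An integral curve $x:I\to M$, $I$ a closed interval, is locally rigid if for each $t_0\in I$ there is a small enough $\varepsilon>0$ such that the restriction of $x$ to $I\cap[t_0-\varepsilon,t_0+\varepsilon]$ is rigid. *)

theory Defs
  imports "HOL-Analysis.Analysis"
begin

section \<open>Distributions and rigid curves\<close>

text \<open>
  A manifold is a set \<open>M\<close> of points \<open>'c \<Rightarrow> real\<close>, that is, a submanifold of a
  coordinate space whose coordinates are indexed by \<open>'c\<close>.  Only finitely many coordinates are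
  relevant: all points of \<open>M\<close> are meant to vanish outside one fixed finite set of indices.
  Tangent vectors are elements of the same space, and a distribution assigns to each point a set
  of tangent vectors.  Curves are total functions on the reals of which only the values on
  \<open>{a..b}\<close> matter; derivatives are taken within \<open>{a..b}\<close>, hence one-sided at the endpoints.
\<close>

definition velocity :: "real \<Rightarrow> real \<Rightarrow> (real \<Rightarrow> 'c \<Rightarrow> real) \<Rightarrow> real \<Rightarrow> 'c \<Rightarrow> real" where
  "velocity a b x t = (\<lambda>c. vector_derivative (\<lambda>s. x s c) (at t within {a..b}))"

definition C1_curve :: "real \<Rightarrow> real \<Rightarrow> (real \<Rightarrow> 'c \<Rightarrow> real) \<Rightarrow> bool" where
  "C1_curve a b x \<longleftrightarrow>
     (\<forall>c. (\<forall>t\<in>{a..b}. (\<lambda>s. x s c) differentiable (at t within {a..b})) \<and>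
          continuous_on {a..b} (\<lambda>t. velocity a b x t c))"

definition immersed :: "real \<Rightarrow> real \<Rightarrow> (real \<Rightarrow> 'c \<Rightarrow> real) \<Rightarrow> bool" where
  "immersed a b x \<longleftrightarrow> (\<forall>t\<in>{a..b}. velocity a b x t \<noteq> (\<lambda>c. 0))"

definition integral_curve ::
  "('c \<Rightarrow> real) set \<Rightarrow> (('c \<Rightarrow> real) \<Rightarrow> ('c \<Rightarrow> real) set) \<Rightarrow> real \<Rightarrow> real
     \<Rightarrow> (real \<Rightarrow> 'c \<Rightarrow> real) \<Rightarrow> bool" where
  "integral_curve M D a b x \<longleftrightarrow>
     C1_curve a b x \<and> (\<forall>t\<in>{a..b}. x t \<in> M \<and> velocity a b x t \<in> D (x t))"

definition curves_between ::
  "('c \<Rightarrow> real) set \<Rightarrow> (('c \<Rightarrow> real) \<Rightarrow> ('c \<Rightarrow> real) set) \<Rightarrow> real \<Rightarrow> real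
     \<Rightarrow> ('c \<Rightarrow> real) \<Rightarrow> ('c \<Rightarrow> real) \<Rightarrow> (real \<Rightarrow> 'c \<Rightarrow> real) set" where
  "curves_between M D a b p q = {x. integral_curve M D a b x \<and> x a = p \<and> x b = q}"

definition C1_close ::
  "real \<Rightarrow> real \<Rightarrow> real \<Rightarrow> (real \<Rightarrow> 'c \<Rightarrow> real) \<Rightarrow> (real \<Rightarrow> 'c \<Rightarrow> real) \<Rightarrow> bool" where
  "C1_close a b \<epsilon> x y \<longleftrightarrow>
     (\<forall>t\<in>{a..b}. \<forall>c. \<bar>y t c - x t c\<bar> < \<epsilon> \<and> \<bar>velocity a b y t c - velocity a b x t c\<bar> < \<epsilon>)"

text \<open>
  By compactness of \<open>{a..b}\<close> and the finiteness of the set of relevant coordinates, the sets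
  below are the open balls of the uniform \<open>C\<^sup>1\<close>-distance on \<open>\<O>\<close>.
\<close>
definition C1_topology ::
  "real \<Rightarrow> real \<Rightarrow> (real \<Rightarrow> 'c \<Rightarrow> real) set \<Rightarrow> (real \<Rightarrow> 'c \<Rightarrow> real) topology" where
  "C1_topology a b \<O> =
     topology_generated_by {{y \<in> \<O>. C1_close a b \<epsilon> x y} | x \<epsilon>. x \<in> \<O> \<and> \<epsilon> > 0}"

text \<open>
  \<open>\<phi>\<close> is a \<open>C\<^sup>1\<close>-diffeomorphism of \<open>{a..b}\<close> fixing the endpoints.
\<close>
definition reparametrization ::
  "real \<Rightarrow> real \<Rightarrow> (real \<Rightarrow> 'c \<Rightarrow> real) \<Rightarrow> (real \<Rightarrow> 'c \<Rightarrow> real) \<Rightarrow> bool" where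
  "reparametrization a b x y \<longleftrightarrow>
     (\<exists>\<phi> \<phi>'. \<phi> a = a \<and> \<phi> b = b \<and>
        (\<forall>t\<in>{a..b}. (\<phi> has_real_derivative \<phi>' t) (at t within {a..b}) \<and> \<phi>' t > 0) \<and>
        continuous_on {a..b} \<phi>' \<and>
        (\<forall>t\<in>{a..b}. y t = x (\<phi> t)))"

definition rigid ::
  "('c \<Rightarrow> real) set \<Rightarrow> (('c \<Rightarrow> real) \<Rightarrow> ('c \<Rightarrow> real) set) \<Rightarrow> real \<Rightarrow> real
     \<Rightarrow> (real \<Rightarrow> 'c \<Rightarrow> real) \<Rightarrow> bool" where
  "rigid M D a b x \<longleftrightarrow>
     integral_curve M D a b x \<and>
     (\<exists>V. openin (C1_topology a b (curves_between M D a b (x a) (x b))) V \<and> x \<in> V \<and>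
          (\<forall>y\<in>V. reparametrization a b x y))"

text \<open>The interval used here is \<open>{a..b} \<inter> {t\<^sub>0 - \<epsilon>..t\<^sub>0 + \<epsilon>}\<close>.\<close>
definition locally_rigid ::
  "('c \<Rightarrow> real) set \<Rightarrow> (('c \<Rightarrow> real) \<Rightarrow> ('c \<Rightarrow> real) set) \<Rightarrow> real \<Rightarrow> real
     \<Rightarrow> (real \<Rightarrow> 'c \<Rightarrow> real) \<Rightarrow> bool" where
  "locally_rigid M D a b x \<longleftrightarrow>
     (\<forall>t\<^sub>0\<in>{a..b}. \<exists>\<epsilon>>0. rigid M D (max a (t\<^sub>0 - \<epsilon>)) (min b (t\<^sub>0 + \<epsilon>)) x)"


section \<open>The n-trailer system\<close>

text \<open>
  The configuration space \<open>\<real>\<^sup>2 \<times> (S\<^sup>1)\<^bsup>n+1\<^esup>\<close>, with \<open>S\<^sup>1\<close> the unit circle of the plane: the angle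
  \<open>\<theta>\<^sub>i\<close> is recorded by its cosine (coordinate \<open>Cos i\<close>) and its sine (coordinate \<open>Sin i\<close>).
\<close>

datatype coord = Xi1 | Xi2 | Cos nat | Sin nat

definition trailer_space :: "nat \<Rightarrow> (coord \<Rightarrow> real) set" where
  "trailer_space n =
     {p. (\<forall>i\<le>n. (p (Cos i))\<^sup>2 + (p (Sin i))\<^sup>2 = 1) \<and> (\<forall>i>n. p (Cos i) = 0 \<and> p (Sin i) = 0)}"

text \<open>\<open>cos (\<theta>\<^sub>j - \<theta>\<^sub>i)\<close> and \<open>sin (\<theta>\<^sub>j - \<theta>\<^sub>i)\<close>, by the addition formulas.\<close>

definition rel_cos :: "(coord \<Rightarrow> real) \<Rightarrow> nat \<Rightarrow> nat \<Rightarrow> real" where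
  "rel_cos p j i = p (Cos j) * p (Cos i) + p (Sin j) * p (Sin i)"

definition rel_sin :: "(coord \<Rightarrow> real) \<Rightarrow> nat \<Rightarrow> nat \<Rightarrow> real" where
  "rel_sin p j i = p (Sin j) * p (Cos i) - p (Cos j) * p (Sin i)"

definition cos_prod :: "nat \<Rightarrow> (coord \<Rightarrow> real) \<Rightarrow> nat \<Rightarrow> real" where
  "cos_prod n p i = (\<Prod>j=i+1..n. rel_cos p j (j - 1))"

text \<open>The coordinate vector fields \<open>\<partial>/\<partial>\<xi>\<^sub>1\<close>, \<open>\<partial>/\<partial>\<xi>\<^sub>2\<close> and \<open>\<partial>/\<partial>\<theta>\<^sub>i\<close>.\<close>

definition d_xi1 :: "coord \<Rightarrow> real" where
  "d_xi1 c = (if c = Xi1 then 1 else 0)"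

definition d_xi2 :: "coord \<Rightarrow> real" where
  "d_xi2 c = (if c = Xi2 then 1 else 0)"

definition d_theta :: "nat \<Rightarrow> (coord \<Rightarrow> real) \<Rightarrow> coord \<Rightarrow> real" where
  "d_theta i p c =
     (if c = Cos i then - p (Sin i) else if c = Sin i then p (Cos i) else 0)"

definition drive_field :: "nat \<Rightarrow> (coord \<Rightarrow> real) \<Rightarrow> coord \<Rightarrow> real" where
  "drive_field n p c =
     cos_prod n p 0 * p (Cos 0) * d_xi1 c + cos_prod n p 0 * p (Sin 0) * d_xi2 c
     + (\<Sum>i<n. cos_prod n p (i + 1) * rel_sin p (i + 1) i * d_theta i p c)"

definition trailer_distribution :: "nat \<Rightarrow> (coord \<Rightarrow> real) \<Rightarrow> (coord \<Rightarrow> real) set" where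
  "trailer_distribution n p =
     {(\<lambda>c. \<alpha> * d_theta n p c + \<beta> * drive_field n p c) | \<alpha> \<beta>. True}"

definition axle_center :: "nat \<Rightarrow> (coord \<Rightarrow> real) \<Rightarrow> real \<times> real" where
  "axle_center k p = (p Xi1 + (\<Sum>j<k. p (Cos j)), p Xi2 + (\<Sum>j<k. p (Sin j)))"


text \<open>Comparison with the angular coordinates \<open>(\<xi>\<^sub>1, \<xi>\<^sub>2, \<theta>\<^sub>0, \<dots>, \<theta>\<^sub>n)\<close>.\<close>

primrec of_angles :: "nat \<Rightarrow> real \<Rightarrow> real \<Rightarrow> (nat \<Rightarrow> real) \<Rightarrow> coord \<Rightarrow> real" where
  "of_angles n \<xi>\<^sub>1 \<xi>\<^sub>2 \<theta> Xi1 = \<xi>\<^sub>1"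
| "of_angles n \<xi>\<^sub>1 \<xi>\<^sub>2 \<theta> Xi2 = \<xi>\<^sub>2"
| "of_angles n \<xi>\<^sub>1 \<xi>\<^sub>2 \<theta> (Cos i) = (if i \<le> n then cos (\<theta> i) else 0)"
| "of_angles n \<xi>\<^sub>1 \<xi>\<^sub>2 \<theta> (Sin i) = (if i \<le> n then sin (\<theta> i) else 0)"

lemma trailer_space_eq_angles:
  "trailer_space n = {of_angles n \<xi>\<^sub>1 \<xi>\<^sub>2 \<theta> | \<xi>\<^sub>1 \<xi>\<^sub>2 \<theta>. True}"
proof (intro equalityI subsetI)
  fix p assume p: "p \<in> trailer_space n"
  have "\<exists>t. i \<le> n \<longrightarrow> p (Cos i) = cos t \<and> p (Sin i) = sin t" for i
  proof (cases "i \<le> n")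
    case True
    then have "(p (Cos i))\<^sup>2 + (p (Sin i))\<^sup>2 = 1"
      using p by (simp add: trailer_space_def)
    then obtain t where "p (Cos i) = cos t" "p (Sin i) = sin t"
      by (rule sincos_total_2pi)
    then show ?thesis by blast
  qed simp
  then obtain \<theta> where \<theta>: "\<And>i. i \<le> n \<Longrightarrow> p (Cos i) = cos (\<theta> i) \<and> p (Sin i) = sin (\<theta> i)"
    by metis
  have "p c = of_angles n (p Xi1) (p Xi2) \<theta> c" for c
    using p \<theta> by (cases c) (auto simp: trailer_space_def)
  then show "p \<in> {of_angles n \<xi>\<^sub>1 \<xi>\<^sub>2 \<theta> | \<xi>\<^sub>1 \<xi>\<^sub>2 \<theta>. True}"
    by blast
qed (auto simp: trailer_space_def)

lemma diff_of_angles: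
  assumes "i \<le> n" "j \<le> n"
  shows "rel_cos (of_angles n \<xi>\<^sub>1 \<xi>\<^sub>2 \<theta>) j i = cos (\<theta> j - \<theta> i)"
    and "rel_sin (of_angles n \<xi>\<^sub>1 \<xi>\<^sub>2 \<theta>) j i = sin (\<theta> j - \<theta> i)"
  using assms by (simp_all add: rel_cos_def rel_sin_def cos_diff sin_diff)

lemma cos_prod_of_angles:
  "cos_prod n (of_angles n \<xi>\<^sub>1 \<xi>\<^sub>2 \<theta>) i = (\<Prod>j=i+1..n. cos (\<theta> j - \<theta> (j - 1)))"
  unfolding cos_prod_def
proof (intro prod.cong refl)
  fix j assume "j \<in> {i+1..n}"
  then have "j - 1 \<le> n" "j \<le> n" by auto
  then show "rel_cos (of_angles n \<xi>\<^sub>1 \<xi>\<^sub>2 \<theta>) j (j - 1) = cos (\<theta> j - \<theta> (j - 1))"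
    by (rule diff_of_angles)
qed

lemma d_theta_of_angles:
  assumes "i \<le> n"
  shows "((\<lambda>s. of_angles n \<xi>\<^sub>1 \<xi>\<^sub>2 (\<theta>(i := s)) c) has_real_derivative
           d_theta i (of_angles n \<xi>\<^sub>1 \<xi>\<^sub>2 \<theta>) c) (at (\<theta> i))"
proof (cases c)
  case (Cos j)
  then show ?thesis using assms
    by (cases "j = i"; cases "j \<le> n") (auto simp: d_theta_def intro!: derivative_eq_intros)
next
  case (Sin j)
  then show ?thesis using assms
    by (cases "j = i"; cases "j \<le> n") (auto simp: d_theta_def intro!: derivative_eq_intros)
qed (simp_all add: d_theta_def)

end

theory Submission
  imports Defs
begin

text \<open>
  In complex notation the rolling constraints are \<open>P\<^sub>k' = v\<^sub>k E\<^sub>k\<close> and \<open>E\<^sub>k' = \<i> w\<^sub>k E\<^sub>k\<close>, where \<open>P\<^sub>k\<close> is the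
  \<open>k\<close>-th axle center and \<open>E\<^sub>k = e\<^bsup>i\<theta>\<^sub>k\<^esup>\<close>.  As \<open>P\<^bsub>k+1\<^esub> = P\<^sub>k + E\<^sub>k\<close>, the number \<open>v\<^sub>k + \<i> w\<^sub>k\<close> is \<open>v\<^bsub>k+1\<^esub>\<close> times
  the relative heading of the vehicles \<open>k\<close> and \<open>k + 1\<close>.  Thus \<open>\<bar>v\<^sub>k\<bar> \<le> \<bar>v\<^bsub>k+1\<^esub>\<bar>\<close>, the fixed axle centers are
  the first few \<open>P\<^sub>0, P\<^sub>1, \<dots>\<close>, and two of them are fixed if and only if \<open>n \<ge> 1\<close> and \<open>v\<^sub>1\<close> vanishes.

  Suppose that \<open>v\<^sub>1\<close> vanishes, and let \<open>k\<close> be maximal with \<open>v\<^sub>k = 0\<close> at a given time.  The axle \<open>k\<close> then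
  remains at rest for a while (\<open>stays_at_rest\<close>), its heading turns, and the vehicles in front of it turn with it as
  one rigid body (\<open>rigid_body\<close>).  For a nearby motion with the same end points, the contact element
  formed by the axle center and the heading of vehicle \<open>k - 1\<close> describes a closed curve in the
  contact space of the plane whose direction in the contact planes turns strictly.  In Darboux coordinates it
  projects to a closed convex arc that encloses no area, hence to a point
  (\<open>closed_convex_curve_is_point\<close>, \<open>rest_if_returning\<close>).  So the axle \<open>k\<close> is at rest in the nearby
  motion too, which is again a rotation of the same rigid body around the same point: it differs from the given
  motion by the choice of the parameter only (\<open>rigid_if_axle_at_rest\<close>).

  Suppose now that \<open>n = 0\<close> or that \<open>v\<^sub>1\<close> does not vanish at some time.  If the last axle moves at some time, its
  path is deformed by a small bump and the train is rebuilt on it, each heading being the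
  normalized velocity of its axle center (\<open>tower\<close>).  This costs one derivative per vehicle, exactly
  what the path of the last axle offers (\<open>smooth_motion\<close>).  An area integral tells the deformed motion from all
  reparametrizations (\<open>not_rigid_if_last_axle_moves\<close>).  If the last axle is at rest, its heading turns; then the
  angle of that heading serves as the parameter, and a bump in the support function sets the last axle
  in motion (\<open>not_rigid_if_pivoting\<close>).
\<close>

section \<open>One-variable calculus on a closed interval\<close>

lemma increasing_on_interval:
  fixes f :: "real \<Rightarrow> real"
  assumes "\<And>t. t \<in> {c..d} \<Longrightarrow> (f has_real_derivative f' t) (at t within {c..d})"
    and "\<And>t. t \<in> {c..d} \<Longrightarrow> 0 < f' t"
    and "s \<in> {c..d}" "t \<in> {c..d}" "s < t"
  shows "f s < f t"
proof -
  have "\<exists>z\<in>{s<..<t}. f t - f s = (\<lambda>h. f' z * h) (t - s)"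
  proof (rule mvt_simple[OF \<open>s < t\<close>])
    fix z assume "s \<le> z" "z \<le> t"
    then have "(f has_real_derivative f' z) (at z within {s..t})"
      using assms by (intro DERIV_subset[OF assms(1)]) auto
    then show "(f has_derivative (\<lambda>h. f' z * h)) (at z within {s..t})"
      by (simp add: has_field_derivative_def)
  qed
  then obtain z where "z \<in> {s<..<t}" "f t - f s = f' z * (t - s)" by blast
  moreover from this have "0 < f' z" using assms by auto
  moreover from this have "0 < f' z * (t - s)" using \<open>s < t\<close> by simp
  ultimately show ?thesis by linarith
qed

lemmas derivative_within_interval_unique =
  vector_derivative_unique_within_closed_interval[unfolded cbox_interval]

lemma derivative_vanishes_if_nonneg:
  fixes f :: "real \<Rightarrow> real"
  assumes "c < d"
    and der: "\<And>t. t \<in> {c..d} \<Longrightarrow> (f has_real_derivative f' t) (at t within {c..d})"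
    and nonneg: "\<And>t. t \<in> {c..d} \<Longrightarrow> 0 \<le> f' t"
    and "f c = f d" and t: "t \<in> {c..d}"
  shows "f' t = 0"
proof -
  have mono: "f r \<le> f s" if "r \<in> {c..d}" "s \<in> {c..d}" "r \<le> s" for r s
  proof -
    have "\<exists>z\<in>{r..s}. f s - f r = (\<lambda>h. f' z * h) (s - r)"
    proof (rule mvt_very_simple[OF \<open>r \<le> s\<close>])
      fix z assume "r \<le> z" "z \<le> s"
      then have "(f has_real_derivative f' z) (at z within {r..s})"
        using that by (intro DERIV_subset[OF der]) auto
      then show "(f has_derivative (\<lambda>h. f' z * h)) (at z within {r..s})"
        by (simp add: has_field_derivative_def)
    qed
    then obtain z where "z \<in> {r..s}" "f s - f r = f' z * (s - r)" by blast
    moreover from this have "0 \<le> f' z" using that nonneg by auto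
    moreover from this have "0 \<le> f' z * (s - r)" using \<open>r \<le> s\<close> by simp
    ultimately show ?thesis by linarith
  qed
  have const: "f s = f c" if "s \<in> {c..d}" for s
    using mono[of c s] mono[of s d] that \<open>f c = f d\<close> by auto
  have "((\<lambda>_. f c) has_real_derivative f' t) (at t within {c..d})"
    by (rule has_field_derivative_transform_within[OF der[OF t] zero_less_one t]) (rule const)
  then have "((\<lambda>_. f c) has_vector_derivative f' t) (at t within {c..d})"
    by (simp add: has_real_derivative_iff_has_vector_derivative)
  moreover have "((\<lambda>_. f c) has_vector_derivative 0) (at t within {c..d})"
    by (rule has_vector_derivative_const)
  ultimately show ?thesis
    using derivative_within_interval_unique[OF \<open>c < d\<close> t] by blast
qed

lemma constant_if_derivative_zero:
  fixes f :: "real \<Rightarrow> 'a::real_normed_vector"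
  assumes "\<And>t. t \<in> {c..d} \<Longrightarrow> (f has_vector_derivative 0) (at t within {c..d})"
    and "s \<in> {c..d}" "t \<in> {c..d}"
  shows "f s = f t"
proof -
  have "\<exists>k. \<forall>x\<in>{c..d}. f x = k"
  proof (rule has_derivative_zero_constant)
    show "(f has_derivative (\<lambda>h. 0)) (at x within {c..d})" if "x \<in> {c..d}" for x
      using assms(1)[OF that] by (simp add: has_vector_derivative_def)
  qed simp
  then show ?thesis using assms by auto
qed

lemma continuous_on_sgn_constant:
  fixes f :: "real \<Rightarrow> real"
  assumes "continuous_on {c..d} f" "\<And>t. t \<in> {c..d} \<Longrightarrow> f t \<noteq> 0" "s \<in> {c..d}" "t \<in> {c..d}"
  shows "sgn (f s) = sgn (f t)"
proof -
  have "False" if "s \<in> {c..d}" "t \<in> {c..d}" "f s < 0" "0 < f t" for s t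
  proof -
    have c: "connected (f ` {c..d})" by (rule connected_continuous_image[OF assms(1)]) simp
    have "0 \<in> f ` {c..d}"
      by (rule connectedD_interval[OF c, of "f s" "f t"]) (use that in simp_all)
    then show False using assms(2) by auto
  qed
  from this[of s t] this[of t s] show ?thesis
    using assms(2)[of s] assms(2)[of t] assms(3,4)
    by (cases "f s < 0"; cases "f t < 0") (auto simp: sgn_if)
qed

lemma nonzero_on_inner_interval:
  fixes f :: "real \<Rightarrow> real"
  assumes "c < d" "continuous_on {c..d} f" "t \<in> {c..d}" "f t \<noteq> 0"
  obtains p q where "c < p" "p < q" "q < d" "\<And>s. s \<in> {p..q} \<Longrightarrow> f s \<noteq> 0"
proof -
  have "\<exists>\<delta>>0. \<forall>s\<in>{c..d}. \<bar>s - t\<bar> < \<delta> \<longrightarrow> \<bar>f s - f t\<bar> < \<bar>f t\<bar>"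
    using assms(2,3,4) unfolding continuous_on_iff dist_real_def by (metis zero_less_abs_iff)
  then obtain \<delta> where \<delta>: "0 < \<delta>" "\<And>s. s \<in> {c..d} \<Longrightarrow> \<bar>s - t\<bar> < \<delta> \<Longrightarrow> \<bar>f s - f t\<bar> < \<bar>f t\<bar>"
    by blast
  have "max c (t - \<delta>) < min d (t + \<delta>)"
    using assms(1,3) \<delta>(1) by auto
  then obtain p where p: "max c (t - \<delta>) < p" "p < min d (t + \<delta>)"
    using dense by blast
  then obtain q where q: "p < q" "q < min d (t + \<delta>)"
    using dense by blast
  have "f s \<noteq> 0" if "s \<in> {p..q}" for s
    using \<delta>(2)[of s] p q that by force
  then show ?thesis using p q by (intro that[of p q]) auto
qed

text \<open>
  The change of parameter is \<open>w\<close> followed by the inverse of \<open>u\<close>; its derivative at the end points of the interval is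
  one-sided, so the inverse function theorem is proved here from difference quotients.
\<close>

lemma reparametrization_of_increasing:
  fixes u w :: "real \<Rightarrow> real"
  assumes "c < d"
    and du: "\<And>t. t \<in> {c..d} \<Longrightarrow> (u has_real_derivative u' t) (at t within {c..d})"
    and dw: "\<And>t. t \<in> {c..d} \<Longrightarrow> (w has_real_derivative w' t) (at t within {c..d})"
    and pos: "\<And>t. t \<in> {c..d} \<Longrightarrow> 0 < u' t" "\<And>t. t \<in> {c..d} \<Longrightarrow> 0 < w' t"
    and cont: "continuous_on {c..d} u'" "continuous_on {c..d} w'"
    and ends: "u c = w c" "u d = w d"
  shows "\<exists>\<phi> \<phi>'. \<phi> c = c \<and> \<phi> d = d \<and>
    (\<forall>t\<in>{c..d}. (\<phi> has_real_derivative \<phi>' t) (at t within {c..d}) \<and> \<phi>' t > 0) \<and>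
    continuous_on {c..d} \<phi>' \<and> (\<forall>t\<in>{c..d}. \<phi> t \<in> {c..d} \<and> u (\<phi> t) = w t)"
proof -
  let ?J = "{c..d}"
  have cu: "continuous_on ?J u" by (rule DERIV_continuous_on) (rule du)
  have cw: "continuous_on ?J w" by (rule DERIV_continuous_on) (rule dw)
  have incu: "u s < u t" if "s \<in> ?J" "t \<in> ?J" "s < t" for s t
    using increasing_on_interval[OF du pos(1)] that by blast
  have incw: "w s < w t" if "s \<in> ?J" "t \<in> ?J" "s < t" for s t
    using increasing_on_interval[OF dw pos(2)] that by blast
  have inj: "inj_on u ?J"
    by (rule linorder_inj_onI') (metis incu order_less_irrefl)
  define g where "g = the_inv_into ?J u"
  have gu: "g (u t) = t" if "t \<in> ?J" for t
    using the_inv_into_f_f[OF inj that] by (simp add: g_def)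
  have img: "w t \<in> u ` ?J" if "t \<in> ?J" for t
  proof -
    have conn: "connected (u ` ?J)" by (rule connected_continuous_image[OF cu]) simp
    have "w c \<le> w t" "w t \<le> w d"
      using incw[of c t] incw[of t d] that by (auto simp: order_le_less)
    then show ?thesis
      using connectedD_interval[OF conn, of "u c" "u d" "w t"] ends \<open>c < d\<close>
      by (metis atLeastAtMost_iff imageI less_eq_real_def order_refl)
  qed
  have cg: "continuous_on (u ` ?J) g"
    by (rule continuous_on_inv[OF cu]) (auto simp: gu)
  have dg: "(g has_real_derivative inverse (u' s)) (at (u s) within u ` ?J)" if s: "s \<in> ?J" for s
  proof -
    have 1: "((\<lambda>r. (u r - u s) / (r - s)) \<longlongrightarrow> u' s) (at s within ?J)"
      using du[OF s] by (simp add: has_field_derivative_iff)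
    have 2: "filterlim g (at s within ?J) (at (u s) within u ` ?J)"
      unfolding filterlim_at
    proof
      show "\<forall>\<^sub>F z in at (u s) within u ` ?J. g z \<in> ?J \<and> g z \<noteq> s"
        unfolding eventually_at_filter by (rule eventuallyI) (auto simp: gu)
      show "(g \<longlongrightarrow> s) (at (u s) within u ` ?J)"
        using cg s gu[OF s] unfolding continuous_on_def by (metis imageI)
    qed
    have "((\<lambda>z. inverse ((u (g z) - u s) / (g z - s))) \<longlongrightarrow> inverse (u' s)) (at (u s) within u ` ?J)"
      using tendsto_inverse[OF filterlim_compose[OF 1 2]] pos(1)[OF s] by simp
    then have "((\<lambda>z. (g z - g (u s)) / (z - u s)) \<longlongrightarrow> inverse (u' s)) (at (u s) within u ` ?J)"
      by (rule Lim_transform_eventually)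
         (auto simp: eventually_at_filter gu gu[OF s] intro!: eventuallyI)
    then show ?thesis by (simp add: has_field_derivative_iff)
  qed
  define \<phi> where "\<phi> = (\<lambda>t. g (w t))"
  define \<phi>' where "\<phi>' = (\<lambda>t. inverse (u' (\<phi> t)) * w' t)"
  have \<phi>: "\<phi> t \<in> ?J \<and> u (\<phi> t) = w t" if "t \<in> ?J" for t
    using img[OF that] gu unfolding \<phi>_def by auto
  have ends': "\<phi> c = c" "\<phi> d = d"
    using gu[of c] gu[of d] ends \<open>c < d\<close> by (auto simp: \<phi>_def)
  have der: "(\<phi> has_real_derivative \<phi>' t) (at t within ?J)" if t: "t \<in> ?J" for t
  proof -
    have "(g has_real_derivative inverse (u' (\<phi> t))) (at (w t) within u ` ?J)"
      using dg[of "\<phi> t"] \<phi>[OF t] by simp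
    then have "(g has_real_derivative inverse (u' (\<phi> t))) (at (w t) within w ` ?J)"
      by (rule DERIV_subset) (use img in auto)
    then show ?thesis
      unfolding \<phi>'_def \<phi>_def using DERIV_image_chain[OF _ dw[OF t]] by (simp add: o_def)
  qed
  have pos': "0 < \<phi>' t" if "t \<in> ?J" for t
    using pos \<phi>[OF that] that by (simp add: \<phi>'_def)
  have "continuous_on ?J \<phi>"
    by (rule DERIV_continuous_on) (rule der)
  then have "continuous_on ?J (\<lambda>t. u' (\<phi> t))"
    by (rule continuous_on_compose2[OF cont(1)]) (use \<phi> in auto)
  moreover have "u' (\<phi> t) \<noteq> 0" if "t \<in> ?J" for t
    using pos(1)[of "\<phi> t"] \<phi>[OF that] by auto
  ultimately have "continuous_on ?J \<phi>'"
    unfolding \<phi>'_def by (intro continuous_intros cont) auto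
  then show ?thesis using ends' der pos' \<phi> by blast
qed

section \<open>Motions in complex notation\<close>

text \<open>
  The plane is identified with \<open>\<complex>\<close>: \<open>P\<close> is the axle center of the last trailer, \<open>E k\<close> the heading
  \<open>e\<^bsup>i\<theta>\<^sub>k\<^esup>\<close>, \<open>v k\<close> the signed speed of the \<open>k\<close>-th axle center along its heading and \<open>w k\<close> the rate
  at which that heading turns.  The hitch equation expresses that the \<open>k\<close>-th axle center and its
  successor, which is \<open>E k\<close> further on, both move along their own headings.
\<close>

locale trailer_motion =
  fixes n :: nat and c d :: real and P :: "real \<Rightarrow> complex" and E :: "nat \<Rightarrow> real \<Rightarrow> complex"
    and v w :: "nat \<Rightarrow> real \<Rightarrow> real"
  assumes c_less_d: "c < d"
    and P_deriv: "\<And>t. t \<in> {c..d} \<Longrightarrow>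
      (P has_vector_derivative of_real (v 0 t) * E 0 t) (at t within {c..d})"
    and E_deriv: "\<And>k t. k \<le> n \<Longrightarrow> t \<in> {c..d} \<Longrightarrow>
      (E k has_vector_derivative \<i> * of_real (w k t) * E k t) (at t within {c..d})"
    and norm_E: "\<And>k t. k \<le> n \<Longrightarrow> t \<in> {c..d} \<Longrightarrow> norm (E k t) = 1"
    and hitch: "\<And>k t. k < n \<Longrightarrow> t \<in> {c..d} \<Longrightarrow>
      of_real (v k t) + \<i> * of_real (w k t) = of_real (v (Suc k) t) * (cnj (E k t) * E (Suc k) t)"
    and cont_v: "\<And>k. k \<le> n \<Longrightarrow> continuous_on {c..d} (v k)"
    and cont_w: "\<And>k. k \<le> n \<Longrightarrow> continuous_on {c..d} (w k)"
begin

definition axle :: "nat \<Rightarrow> real \<Rightarrow> complex" where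
  "axle k t = P t + (\<Sum>j<k. E j t)"

lemma E_cnj: "k \<le> n \<Longrightarrow> t \<in> {c..d} \<Longrightarrow> E k t * cnj (E k t) = 1"
  using norm_E[of k t] complex_norm_square[of "E k t"] by simp

lemma E_nonzero: "k \<le> n \<Longrightarrow> t \<in> {c..d} \<Longrightarrow> E k t \<noteq> 0"
  using norm_E[of k t] by auto

lemma towing:
  assumes "k < n" "t \<in> {c..d}"
  shows "of_real (v k t) * E k t + \<i> * of_real (w k t) * E k t = of_real (v (Suc k) t) * E (Suc k) t"
proof -
  have "(of_real (v k t) + \<i> * of_real (w k t)) * E k t
        = of_real (v (Suc k) t) * E (Suc k) t * (E k t * cnj (E k t))"
    by (subst hitch[OF assms]) (simp add: algebra_simps)
  then show ?thesis
    using E_cnj[of k t] assms by (simp add: algebra_simps)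
qed

lemma axle_deriv:
  assumes "k \<le> n" "t \<in> {c..d}"
  shows "(axle k has_vector_derivative of_real (v k t) * E k t) (at t within {c..d})"
  using assms(1)
proof (induction k)
  case 0
  then show ?case using P_deriv[OF assms(2)] by (simp add: axle_def[abs_def])
next
  case (Suc k)
  have "axle (Suc k) = (\<lambda>s. axle k s + E k s)"
    by (simp add: axle_def fun_eq_iff)
  moreover have "((\<lambda>s. axle k s + E k s) has_vector_derivative
      of_real (v k t) * E k t + \<i> * of_real (w k t) * E k t) (at t within {c..d})"
    using Suc by (intro has_vector_derivative_add E_deriv assms) auto
  ultimately show ?case using towing[of k t] Suc.prems assms(2) by simp
qed

text \<open>
  Speeds can only decrease from the robot towards the last trailer.  In particular an axle center
  that stands still keeps all the axle centers and headings behind it at rest.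
\<close>

lemma speed_pythagoras:
  assumes "k < n" "t \<in> {c..d}"
  shows "(v k t)\<^sup>2 + (w k t)\<^sup>2 = (v (Suc k) t)\<^sup>2"
proof -
  have "(v k t)\<^sup>2 + (w k t)\<^sup>2 = (norm (of_real (v k t) + \<i> * of_real (w k t)))\<^sup>2"
    by (simp add: cmod_power2)
  also have "\<dots> = (v (Suc k) t)\<^sup>2"
    unfolding hitch[OF assms] using norm_E[of k t] norm_E[of "Suc k" t] assms
    by (simp add: norm_mult)
  finally show ?thesis .
qed

lemma speed_zero_below:
  assumes "v k t = 0" "j < k" "k \<le> n" "t \<in> {c..d}"
  shows "v j t = 0 \<and> w j t = 0"
  using assms
proof (induction k)
  case (Suc k)
  have "v k t = 0 \<and> w k t = 0"
    using speed_pythagoras[of k t] Suc.prems by (simp add: sum_power2_eq_zero_iff)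
  then show ?case using Suc by (cases "j = k") auto
qed simp

lemma speed_nonzero_above:
  assumes "v j t \<noteq> 0" "j \<le> k" "k \<le> n" "t \<in> {c..d}"
  shows "v k t \<noteq> 0"
  using assms speed_zero_below[of k t j] by (cases "j = k") auto

lemma turning_le_speed:
  assumes "k < n" "t \<in> {c..d}"
  shows "\<bar>w k t\<bar> \<le> \<bar>v (Suc k) t\<bar>"
  using speed_pythagoras[OF assms] by (metis abs_le_square_iff le_add_same_cancel2 zero_le_power2)

lemma continuous_E: "k \<le> n \<Longrightarrow> continuous_on {c..d} (E k)"
  by (rule continuous_on_vector_derivative) (rule E_deriv)

lemma restrict:
  assumes "c \<le> p" "p < q" "q \<le> d"
  shows "trailer_motion n p q P E v w"
proof -
  have sub: "{p..q} \<subseteq> {c..d}" using assms by auto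
  show ?thesis
  proof
    show "(P has_vector_derivative of_real (v 0 t) * E 0 t) (at t within {p..q})"
      if "t \<in> {p..q}" for t
      by (rule has_vector_derivative_within_subset[OF P_deriv sub]) (use that sub in auto)
    show "(E k has_vector_derivative \<i> * of_real (w k t) * E k t) (at t within {p..q})"
      if "k \<le> n" "t \<in> {p..q}" for k t
      by (rule has_vector_derivative_within_subset[OF E_deriv sub]) (use that sub in auto)
  qed (use assms sub in \<open>auto intro: hitch norm_E continuous_on_subset[OF cont_v sub]
         continuous_on_subset[OF cont_w sub]\<close>)
qed

lemma at_rest_below:
  assumes "k \<le> n" "\<And>t. t \<in> {c..d} \<Longrightarrow> v k t = 0" "s \<in> {c..d}" "t \<in> {c..d}"
  shows "P s = P t" and "\<And>j. j < k \<Longrightarrow> E j s = E j t" and "axle k s = axle k t"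
proof -
  show "axle k s = axle k t"
    by (rule constant_if_derivative_zero[OF _ assms(3,4)])
       (use axle_deriv[OF assms(1)] assms(2) in force)
  show E: "E j s = E j t" if "j < k" for j
    by (rule constant_if_derivative_zero[OF _ assms(3,4)])
       (use E_deriv[of j] speed_zero_below[OF assms(2) that] that assms(1) in force)
  show "P s = P t"
    using \<open>axle k s = axle k t\<close> E by (simp add: axle_def)
qed

lemma relative_heading_deriv:
  assumes "k < n" "t \<in> {c..d}"
  shows "((\<lambda>s. cnj (E k s) * E (Suc k) s) has_vector_derivative
    \<i> * of_real (w (Suc k) t - w k t) * (cnj (E k t) * E (Suc k) t)) (at t within {c..d})"
proof -
  have "((\<lambda>s. cnj (E k s) * E (Suc k) s) has_vector_derivative
    cnj (E k t) * (\<i> * of_real (w (Suc k) t) * E (Suc k) t)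
     + cnj (\<i> * of_real (w k t) * E k t) * E (Suc k) t) (at t within {c..d})"
    using assms by (intro has_vector_derivative_mult has_vector_derivative_cnj E_deriv) auto
  then show ?thesis by (simp add: algebra_simps)
qed

lemma turn_with_hitch:
  assumes "k < n" "\<And>s. s \<in> {c..d} \<Longrightarrow> cnj (E k s) * E (Suc k) s = K" "t \<in> {c..d}"
  shows "w (Suc k) t = w k t"
proof -
  have "((\<lambda>s. K) has_vector_derivative
     \<i> * of_real (w (Suc k) t - w k t) * (cnj (E k t) * E (Suc k) t)) (at t within {c..d})"
    by (rule has_vector_derivative_transform[OF assms(3) _ relative_heading_deriv[OF assms(1,3)]])
       (simp add: assms(2))
  then have "\<i> * of_real (w (Suc k) t - w k t) * (cnj (E k t) * E (Suc k) t) = (0 :: complex)"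
    using derivative_within_interval_unique[OF c_less_d assms(3)] has_vector_derivative_const by blast
  then show ?thesis
    using E_nonzero[of k t] E_nonzero[of "Suc k" t] assms by (simp flip: of_real_diff)
qed

lemma relative_heading_sgn:
  assumes "k < n" "t \<in> {c..d}" "v (Suc k) t \<noteq> 0"
  shows "cnj (E k t) * E (Suc k) t
    = of_real (sgn (v (Suc k) t)) * sgn (of_real (v k t) + \<i> * of_real (w k t))"
proof -
  define R where "R = cnj (E k t) * E (Suc k) t"
  have "norm R = 1" using norm_E[of k t] norm_E[of "Suc k" t] assms by (simp add: R_def norm_mult)
  then have "sgn (of_real (v k t) + \<i> * of_real (w k t)) = of_real (sgn (v (Suc k) t)) * R"
    unfolding hitch[OF assms(1,2)] R_def[symmetric]
    by (simp add: sgn_mult sgn_div_norm[of R] sgn_of_real)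
  then show ?thesis using assms(3) by (simp add: R_def[symmetric] sgn_if)
qed

text \<open>
  By the hitch equation the relative heading of two consecutive vehicles is, up to a sign that
  cannot change, the direction of \<open>v i + \<i> w i\<close>.  For \<open>i = j\<close> this direction is that of \<open>\<i>\<close>, because
  \<open>v j = 0\<close>.  A constant relative heading makes both vehicles turn at the same rate, which fixes the
  ratio of \<open>w\<close> to \<open>v\<close> for the next vehicle, so the property propagates along the train.
\<close>

lemma locked:
  assumes "j < n" and rest: "\<And>t. t \<in> {c..d} \<Longrightarrow> v j t = 0"
    and move: "\<And>t. t \<in> {c..d} \<Longrightarrow> v (Suc j) t \<noteq> 0"
    and "j \<le> i" "i < n"
  shows "\<exists>K. \<forall>t\<in>{c..d}. cnj (E i t) * E (Suc i) t = K \<and> w (Suc i) t = w i t"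
proof -
  let ?J = "{c..d}"
  have sgn_v: "sgn (v k t) = sgn (v k c)" if "j < k" "k \<le> n" "t \<in> ?J" for k t
    using that c_less_d speed_nonzero_above[OF move, of _ k]
    by (intro continuous_on_sgn_constant[OF cont_v]) auto
  have const: "\<exists>K. \<forall>t\<in>?J. cnj (E i t) * E (Suc i) t = K"
    using \<open>j \<le> i\<close> \<open>i < n\<close>
  proof (induction i rule: dec_induct)
    case base
    have nz: "w j t \<noteq> 0" if "t \<in> ?J" for t
      using speed_pythagoras[of j t] rest[OF that] move[OF that] base that by auto
    have sgn_w: "sgn (w j t) = sgn (w j c)" if "t \<in> ?J" for t
      using that c_less_d nz base by (intro continuous_on_sgn_constant[OF cont_w]) auto
    have "cnj (E j t) * E (Suc j) t = of_real (sgn (v (Suc j) c)) * (\<i> * of_real (sgn (w j c)))"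
      if "t \<in> ?J" for t
      using relative_heading_sgn[OF base that move[OF that]] sgn_v[of "Suc j" t] sgn_w[OF that]
        rest[OF that] base that by (simp add: sgn_mult sgn_of_real sgn_div_norm[of \<i>])
    then show ?case by blast
  next
    case (step i)
    then obtain K where K: "\<And>t. t \<in> ?J \<Longrightarrow> cnj (E i t) * E (Suc i) t = K" by auto
    have w: "w (Suc i) t = Im K * v (Suc i) t" if "t \<in> ?J" for t
    proof -
      have "w i t = Im K * v (Suc i) t"
        using arg_cong[OF hitch[of i t], of Im] K[OF that] step that by simp
      then show ?thesis using turn_with_hitch[OF _ K that] step by simp
    qed
    have "cnj (E (Suc i) t) * E (Suc (Suc i)) t
        = of_real (sgn (v (Suc (Suc i)) c)) * (of_real (sgn (v (Suc i) c)) * sgn (1 + \<i> * of_real (Im K)))"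
      if "t \<in> ?J" for t
    proof -
      have "of_real (v (Suc i) t) + \<i> * of_real (w (Suc i) t)
          = of_real (v (Suc i) t) * (1 + \<i> * of_real (Im K))"
        by (simp add: w[OF that] algebra_simps)
      then have "sgn (of_real (v (Suc i) t) + \<i> * of_real (w (Suc i) t))
          = of_real (sgn (v (Suc i) t)) * sgn (1 + \<i> * of_real (Im K))"
        by (simp add: sgn_mult sgn_of_real)
      moreover have "v (Suc (Suc i)) t \<noteq> 0"
        using speed_nonzero_above[OF move[OF that], of "Suc (Suc i)"] step that by simp
      ultimately show ?thesis
        using relative_heading_sgn[of "Suc i" t] sgn_v[of "Suc i" t] sgn_v[of "Suc (Suc i)" t] step that
        by simp
    qed
    then show ?case by blast
  qed
  then obtain K where K: "\<And>t. t \<in> ?J \<Longrightarrow> cnj (E i t) * E (Suc i) t = K" by auto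
  then show ?thesis using turn_with_hitch[OF \<open>i < n\<close> K] by blast
qed

text \<open>
  All vehicles in front of a fixed axle center turn around it as one body: the motion is determined
  by the single angle of \<open>E j\<close>.
\<close>

lemma rigid_body:
  assumes "j < n" "\<And>t. t \<in> {c..d} \<Longrightarrow> v j t = 0" "\<And>t. t \<in> {c..d} \<Longrightarrow> v (Suc j) t \<noteq> 0"
    and "j \<le> i" "i \<le> n"
  shows "\<exists>K. \<forall>t\<in>{c..d}. E i t = K * E j t"
  using assms(4,5)
proof (induction i rule: dec_induct)
  case base
  then show ?case by (intro exI[of _ 1]) simp
next
  case (step i)
  then have "i \<le> n" by simp
  then obtain K where K: "\<And>t. t \<in> {c..d} \<Longrightarrow> E i t = K * E j t"
    using step.IH by blast
  obtain L where L: "\<And>t. t \<in> {c..d} \<Longrightarrow> cnj (E i t) * E (Suc i) t = L"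
    using locked[OF assms(1-3), of i] step by (meson Suc_le_lessD)
  have "E (Suc i) t = L * K * E j t" if t: "t \<in> {c..d}" for t
  proof -
    have "E (Suc i) t = (E i t * cnj (E i t)) * E (Suc i) t"
      using E_cnj[of i t] step t by simp
    also have "\<dots> = E i t * L" using L[OF t] by (simp add: mult.assoc)
    finally show ?thesis using K[OF t] by (simp add: algebra_simps)
  qed
  then show ?case by blast
qed

text \<open>
  If \<open>v k\<close> did not vanish, some axle \<open>j < k\<close> would be at rest with its successor moving on a whole
  interval; there the train turns as one body, and \<open>w k = w (k - 1)\<close> is at most \<open>v k\<close> in absolute
  value, against \<open>fast\<close>.
\<close>

lemma stays_at_rest:
  assumes "k \<le> n" and rest: "\<And>t. t \<in> {c..d} \<Longrightarrow> v 0 t = 0"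
    and fast: "\<And>t. t \<in> {c..d} \<Longrightarrow> \<bar>v k t\<bar> < \<bar>w k t\<bar>" and t: "t \<in> {c..d}"
  shows "v k t = 0"
proof (rule ccontr)
  assume "v k t \<noteq> 0"
  define j where "j = (LEAST j. \<exists>t\<in>{c..d}. v j t \<noteq> 0)"
  have ex: "\<exists>t\<in>{c..d}. v j t \<noteq> 0"
    unfolding j_def by (rule LeastI[of _ k]) (use t \<open>v k t \<noteq> 0\<close> in blast)
  have "j \<le> k" unfolding j_def by (rule Least_le) (use t \<open>v k t \<noteq> 0\<close> in blast)
  have "j \<noteq> 0" using ex rest by metis
  then obtain i where i: "j = Suc i" by (cases j) auto
  have zero: "v i t = 0" if "t \<in> {c..d}" for t
    using not_less_Least[of i "\<lambda>j. \<exists>t\<in>{c..d}. v j t \<noteq> 0"] i that unfolding j_def[symmetric] by auto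
  obtain p q where pq: "c < p" "p < q" "q < d" "\<And>s. s \<in> {p..q} \<Longrightarrow> v j s \<noteq> 0"
    using nonzero_on_inner_interval[OF c_less_d cont_v, of j] ex \<open>j \<le> k\<close> \<open>k \<le> n\<close>
    by (metis le_trans)
  interpret sub: trailer_motion n p q P E v w using pq by (intro restrict) auto
  obtain m where m: "k = Suc m" "i \<le> m" using \<open>j \<le> k\<close> i by (cases k) auto
  have "p \<in> {p..q}" "p \<in> {c..d}" using pq by auto
  have "w (Suc m) p = w m p"
    using sub.locked[of i m] zero pq i m \<open>k \<le> n\<close> \<open>p \<in> {p..q}\<close> by auto
  then have "\<bar>w k p\<bar> \<le> \<bar>v k p\<bar>"
    using turning_le_speed[of m p] m \<open>k \<le> n\<close> \<open>p \<in> {c..d}\<close> by simp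
  then show False using fast[OF \<open>p \<in> {c..d}\<close>] by linarith
qed

end

section \<open>The area argument\<close>

text \<open>
  \<open>\<zeta>\<close> is a closed curve whose direction \<open>D\<close> turns strictly in one sense but stays within a half-plane,
  and \<open>S\<close> is twice the area that it sweeps out.  With \<open>\<kappa>\<close> the slope of \<open>D\<close>, integration by parts turns
  the vanishing of the area into \<open>\<integral> (Re \<zeta>)\<^sup>2 d\<kappa> = 0\<close>, which forces \<open>Re \<zeta> = 0\<close> because \<open>\<kappa>\<close> is strictly
  monotone.
\<close>

lemma closed_convex_curve_is_point:
  fixes \<zeta> D D' :: "real \<Rightarrow> complex" and v S :: "real \<Rightarrow> real"
  assumes "c < d"
    and d\<zeta>: "\<And>t. t \<in> {c..d} \<Longrightarrow> (\<zeta> has_vector_derivative of_real (v t) * D t) (at t within {c..d})"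
    and dD: "\<And>t. t \<in> {c..d} \<Longrightarrow> (D has_vector_derivative D' t) (at t within {c..d})"
    and dS: "\<And>t. t \<in> {c..d} \<Longrightarrow>
      (S has_real_derivative v t * Im (cnj (\<zeta> t) * D t)) (at t within {c..d})"
    and right: "\<And>t. t \<in> {c..d} \<Longrightarrow> 0 < Re (D t)"
    and turn: "\<And>t. t \<in> {c..d} \<Longrightarrow> 0 < \<sigma> * Im (cnj (D t) * D' t)"
    and ends: "\<zeta> c = 0" "\<zeta> d = 0" "S c = S d"
    and t: "t \<in> {c..d}"
  shows "v t = 0"
proof -
  let ?J = "{c..d}"
  define U W A B A' B' where "U = (\<lambda>t. Re (\<zeta> t))" and "W = (\<lambda>t. Im (\<zeta> t))"
    and "A = (\<lambda>t. Re (D t))" and "B = (\<lambda>t. Im (D t))"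
    and "A' = (\<lambda>t. Re (D' t))" and "B' = (\<lambda>t. Im (D' t))"
  note defs = U_def W_def A_def B_def A'_def B'_def
  have dU: "(U has_real_derivative v t * A t) (at t within ?J)"
    and dW: "(W has_real_derivative v t * B t) (at t within ?J)"
    and dA: "(A has_real_derivative A' t) (at t within ?J)"
    and dB: "(B has_real_derivative B' t) (at t within ?J)" if "t \<in> ?J" for t
    using d\<zeta>[OF that] dD[OF that]
    by (simp_all add: has_vector_derivative_complex_iff defs)
  have A: "A t \<noteq> 0" if "t \<in> ?J" for t using right[OF that] by (simp add: defs)
  \<comment> \<open>The summand \<open>U\<^sup>2 B / A\<close> contains the slope \<open>\<kappa> = B / A\<close>; the other two cancel the part of its
    derivative that has no sign.\<close>
  define \<Psi> where "\<Psi> = (\<lambda>t. \<sigma> * ((U t)\<^sup>2 * (B t / A t) - U t * W t - S t))"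
  define \<Psi>' where "\<Psi>' = (\<lambda>t. (U t)\<^sup>2 * (\<sigma> * Im (cnj (D t) * D' t)) / (A t)\<^sup>2)"
  have d\<Psi>: "(\<Psi> has_real_derivative \<Psi>' t) (at t within ?J)" if "t \<in> ?J" for t
    unfolding \<Psi>_def \<Psi>'_def
    apply (rule derivative_eq_intros refl dU[OF that] dW[OF that] dA[OF that] dB[OF that] dS[OF that] A[OF that])+
    using A[OF that] by (simp add: defs field_simps power2_eq_square)
  have "\<Psi>' t = 0" if "t \<in> ?J" for t
  proof (rule derivative_vanishes_if_nonneg[OF \<open>c < d\<close> d\<Psi> _ _ that])
    show "0 \<le> \<Psi>' t" if "t \<in> ?J" for t
      using turn[OF that] by (simp add: \<Psi>'_def)
    show "\<Psi> c = \<Psi> d" using ends by (simp add: \<Psi>_def defs)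
  qed
  then have "U t = 0" if "t \<in> ?J" for t
    using turn[OF that] A[OF that] that by (force simp: \<Psi>'_def)
  then have "((\<lambda>_. 0) has_real_derivative v t * A t) (at t within ?J)"
    by (intro has_field_derivative_transform_within[OF dU[OF t] zero_less_one t]) auto
  then have "v t * A t = 0"
    using derivative_within_interval_unique[OF \<open>c < d\<close> t] has_vector_derivative_const
    unfolding has_real_derivative_iff_has_vector_derivative by blast
  then show ?thesis using A[OF t] by simp
qed

context trailer_motion
begin

lemma angle_deriv:
  assumes k: "k \<le> n" and t: "t \<in> {c..d}" and F: "norm F = 1" and near: "norm (E k t - F) < 1"
  shows "((\<lambda>s. Im (Ln (E k s * cnj F))) has_real_derivative w k t) (at t within {c..d})"
proof -
  have F1: "F * cnj F = 1" using F complex_norm_square[of F] by simp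
  have "norm (E k t * cnj F - 1) = norm ((E k t - F) * cnj F)"
    using F1 by (simp add: algebra_simps)
  also have "\<dots> < 1" using near F by (simp add: norm_mult)
  finally have "0 < Re (E k t * cnj F)"
    using abs_Re_le_cmod[of "E k t * cnj F - 1"] by simp
  then have nz: "E k t * cnj F \<notin> \<real>\<^sub>\<le>\<^sub>0" by (auto simp: complex_nonpos_Reals_iff)
  have "((\<lambda>s. E k s * cnj F) has_vector_derivative (\<i> * of_real (w k t) * E k t) * cnj F) (at t within {c..d})"
    by (intro has_vector_derivative_mult_left E_deriv k t)
  from field_vector_diff_chain_within[OF this, of Ln "inverse (E k t * cnj F)"]
  have "((\<lambda>s. Ln (E k s * cnj F)) has_vector_derivative
      (\<i> * of_real (w k t) * E k t) * cnj F * inverse (E k t * cnj F)) (at t within {c..d})"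
    using has_field_derivative_at_within[OF has_field_derivative_Ln[OF nz]] by (simp only: o_def)
  moreover have "E k t \<noteq> 0" "F \<noteq> 0" using E_nonzero k t F by auto
  then have "(\<i> * of_real (w k t) * E k t) * cnj F * inverse (E k t * cnj F) = \<i> * of_real (w k t)"
    by (simp add: field_simps)
  ultimately have "((\<lambda>s. Ln (E k s * cnj F)) has_vector_derivative \<i> * of_real (w k t)) (at t within {c..d})"
    by (simp only:)
  then show ?thesis by (simp add: has_vector_derivative_complex_iff)
qed

lemma heading_from_angle:
  assumes "k \<le> n" "t \<in> {c..d}" "norm F = 1"
  shows "E k t = F * cis (Im (Ln (E k t * cnj F)))"
proof -
  let ?z = "E k t * cnj F"
  have z: "norm ?z = 1" using assms norm_E by (simp add: norm_mult)
  then have "?z \<noteq> 0" by auto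
  then have "Ln ?z = \<i> * of_real (Im (Ln ?z))"
    using Re_Ln[of ?z] z by (simp add: complex_eq_iff)
  then have "?z = cis (Im (Ln ?z))"
    using exp_Ln[OF \<open>?z \<noteq> 0\<close>] by (metis cis_conv_exp)
  then have "F * cis (Im (Ln ?z)) = F * ?z" by (simp only:)
  also have "\<dots> = E k t * (F * cnj F)" by (simp add: algebra_simps)
  also have "F * cnj F = 1" using complex_norm_square[of F] assms(3) by simp
  finally show ?thesis by simp
qed

text \<open>
  The pair of the \<open>k\<close>-th axle center and its heading is a contact element of the plane, and rolling
  means that it moves in the contact distribution.  In the frame of \<open>E k\<close> the axle center has
  coordinates \<open>g\<close> and \<open>h\<close>, and with the angle \<open>\<theta>\<close> of \<open>E k\<close> the contact condition reads
  \<open>h' = - g \<theta>'\<close>.  Hence a contact curve that returns to its starting point projects to a closed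
  curve \<open>g + \<i> \<theta>\<close> that encloses the area zero.  Its direction \<open>D\<close> has
  \<open>Im (cnj D * D') = w (k + 1) - w k (1 - g s\<^sup>2)\<close>, where \<open>s\<close> is the sine of the relative heading.  By \<open>fast\<close>
  this has the sign of \<open>w (k + 1)\<close>, so the direction turns strictly in one sense and the curve is a point.
\<close>

lemma rest_if_returning:
  assumes "k < n" and ret: "axle k d = axle k c" "E k d = E k c"
    and F: "norm F = 1"
    and near: "\<And>t. t \<in> {c..d} \<Longrightarrow> norm (axle k t - axle k c) \<le> 1 / 8"
      "\<And>t. t \<in> {c..d} \<Longrightarrow> norm (E k t - E k c) \<le> 1 / 8"
      "\<And>t. t \<in> {c..d} \<Longrightarrow> norm (E (Suc k) t - F) \<le> 1 / 4"
    and fast: "\<And>t. t \<in> {c..d} \<Longrightarrow> 2 * \<bar>w k t\<bar> < \<bar>w (Suc k) t\<bar>"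
    and "t \<in> {c..d}"
  shows "v (Suc k) t = 0"
proof -
  let ?J = "{c..d}"
  have c: "c \<in> ?J" and k: "k \<le> n" "Suc k \<le> n" using c_less_d \<open>k < n\<close> by auto
  define R where "R = (\<lambda>t. cnj (E k t) * E (Suc k) t)"
  define p where "p = (\<lambda>t. (axle k t - axle k c) * cnj (E k t))"
  define g h s where "g = (\<lambda>t. Re (p t))" and "h = (\<lambda>t. Im (p t))" and "s = (\<lambda>t. Im (R t))"
  define \<theta> where "\<theta> = (\<lambda>t. Im (Ln (E k t * cnj (E k c))))"
  \<comment> \<open>Rotating the plane of \<open>g + \<i> \<theta>\<close> by the conjugate of \<open>D0\<close> brings its direction close to the real axis.\<close>
  define D0 where "D0 = cnj (E k c) * F"
  define \<zeta> where "\<zeta> = (\<lambda>t. cnj D0 * (of_real (g t) + \<i> * of_real (\<theta> t)))"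
  define D where "D = (\<lambda>t. cnj D0 * (R t + of_real (h t * s t)))"
  define D' where "D' = (\<lambda>t. cnj D0 * (\<i> * of_real (w (Suc k) t - w k t) * R t
    + of_real (h t * ((w (Suc k) t - w k t) * Re (R t)) + - w k t * g t * s t)))"
  \<comment> \<open>Twice the area swept by \<open>g + \<i> \<theta>\<close>, integrated explicitly through \<open>h' = - g \<theta>'\<close>.\<close>
  define S where "S = (\<lambda>t. - 2 * h t - g t * \<theta> t)"
  have R1: "(Re (R t))\<^sup>2 + (Im (R t))\<^sup>2 = 1" if "t \<in> ?J" for t
    using norm_E[of k t] norm_E[of "Suc k" t] k that cmod_power2[of "R t"]
    by (simp add: R_def norm_mult)
  have vw: "v k t = v (Suc k) t * Re (R t)" "w k t = v (Suc k) t * Im (R t)" if "t \<in> ?J" for t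
    using arg_cong[OF hitch[OF \<open>k < n\<close> that], of Re] arg_cong[OF hitch[OF \<open>k < n\<close> that], of Im]
    by (simp_all add: R_def)
  have D01: "norm D0 = 1" using F norm_E[OF k(1) c] by (simp add: D0_def norm_mult)
  then have D0D0: "D0 * cnj D0 = 1" using complex_norm_square[of D0] by simp
  have small: "norm (p t) \<le> 1 / 8" if "t \<in> ?J" for t
    using near(1)[OF that] norm_E[OF k(1) that] by (simp add: p_def norm_mult)
  have small_g: "\<bar>g t\<bar> \<le> 1 / 8" and small_h: "\<bar>h t\<bar> \<le> 1 / 8" if "t \<in> ?J" for t
    using small[OF that] abs_Re_le_cmod[of "p t"] abs_Im_le_cmod[of "p t"] by (simp_all add: g_def h_def)
  have s1: "\<bar>s t\<bar> \<le> 1" "(s t)\<^sup>2 \<le> 1" if "t \<in> ?J" for t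
    using R1[OF that] zero_le_power2[of "Re (R t)"]
    unfolding s_def abs_square_le_1[symmetric] by linarith+
  have dp: "(p has_vector_derivative of_real (v k t) - \<i> * of_real (w k t) * p t) (at t within ?J)"
    if "t \<in> ?J" for t
  proof -
    have "(p has_vector_derivative (axle k t - axle k c) * cnj (\<i> * of_real (w k t) * E k t)
        + (of_real (v k t) * E k t - 0) * cnj (E k t)) (at t within ?J)"
      unfolding p_def using k that
      by (intro has_vector_derivative_mult has_vector_derivative_diff has_vector_derivative_cnj
          axle_deriv E_deriv has_vector_derivative_const) auto
    moreover have "(axle k t - axle k c) * cnj (\<i> * of_real (w k t) * E k t)
        + (of_real (v k t) * E k t - 0) * cnj (E k t)
        = of_real (v k t) * (E k t * cnj (E k t)) - \<i> * of_real (w k t) * p t"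
      by (simp add: p_def algebra_simps)
    ultimately show ?thesis using E_cnj[OF k(1) that] by simp
  qed
  have dg: "(g has_real_derivative v k t + w k t * h t) (at t within ?J)"
    and dh: "(h has_real_derivative - w k t * g t) (at t within ?J)" if "t \<in> ?J" for t
    using dp[OF that] by (simp_all add: has_vector_derivative_complex_iff g_def h_def)
  have d\<theta>: "(\<theta> has_real_derivative w k t) (at t within ?J)" if t: "t \<in> ?J" for t
    unfolding \<theta>_def using near(2)[OF t] by (intro angle_deriv k t norm_E c) auto
  have dR: "(R has_vector_derivative \<i> * of_real (w (Suc k) t - w k t) * R t) (at t within ?J)"
    if "t \<in> ?J" for t
    using relative_heading_deriv[OF \<open>k < n\<close> that] by (simp add: R_def)
  have ds: "(s has_real_derivative (w (Suc k) t - w k t) * Re (R t)) (at t within ?J)" if "t \<in> ?J" for t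
    using dR[OF that] by (simp add: has_vector_derivative_complex_iff s_def)
  have sgn_w: "sgn (w (Suc k) t) = sgn (w (Suc k) c)" if "t \<in> ?J" for t
    using that c fast k by (intro continuous_on_sgn_constant[OF cont_w]) force+
  show ?thesis
  proof (rule closed_convex_curve_is_point[where \<zeta> = \<zeta> and D = D and D' = D' and S = S
        and \<sigma> = "sgn (w (Suc k) c)" and v = "v (Suc k)", OF c_less_d _ _ _ _ _ _ _ _ \<open>t \<in> ?J\<close>])
    fix t assume t: "t \<in> ?J"
    have "(\<zeta> has_vector_derivative cnj D0 * (of_real (v k t + w k t * h t) + \<i> * of_real (w k t))) (at t within ?J)"
      unfolding \<zeta>_def using dg[OF t] d\<theta>[OF t]
      by (intro has_vector_derivative_mult_right has_vector_derivative_add has_vector_derivative_of_real)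
         (auto simp: has_real_derivative_iff_has_vector_derivative)
    moreover have "of_real (v k t + w k t * h t) + \<i> * of_real (w k t)
        = of_real (v (Suc k) t) * (R t + of_real (h t * s t))"
      by (simp add: complex_eq_iff vw[OF t] s_def algebra_simps)
    ultimately have "(\<zeta> has_vector_derivative cnj D0 * (of_real (v (Suc k) t) * (R t + of_real (h t * s t)))) (at t within ?J)"
      by (simp only:)
    then show "(\<zeta> has_vector_derivative of_real (v (Suc k) t) * D t) (at t within ?J)"
      by (simp only: D_def mult.left_commute[of "cnj D0"])
    show "(D has_vector_derivative D' t) (at t within ?J)"
      unfolding D_def D'_def using DERIV_mult[OF dh[OF t] ds[OF t]]
      by (intro has_vector_derivative_mult_right has_vector_derivative_add has_vector_derivative_of_real dR t)
         (simp add: has_real_derivative_iff_has_vector_derivative algebra_simps)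
    have "(S has_real_derivative - 2 * (- w k t * g t) - ((v k t + w k t * h t) * \<theta> t + w k t * g t)) (at t within ?J)"
      unfolding S_def
      by (intro DERIV_diff DERIV_cmult DERIV_mult dg dh d\<theta> t)
    moreover have area: "cnj (\<zeta> t) * D t
        = (D0 * cnj D0) * (cnj (of_real (g t) + \<i> * of_real (\<theta> t)) * (R t + of_real (h t * s t)))"
      by (simp add: \<zeta>_def D_def algebra_simps)
    have "Im (cnj (\<zeta> t) * D t) = g t * s t - \<theta> t * (Re (R t) + h t * s t)"
      unfolding area D0D0 by (simp add: s_def algebra_simps)
    then have "v (Suc k) t * Im (cnj (\<zeta> t) * D t)
        = - 2 * (- w k t * g t) - ((v k t + w k t * h t) * \<theta> t + w k t * g t)"
      by (simp only: vw[OF t]) (simp add: s_def algebra_simps)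
    ultimately show "(S has_real_derivative v (Suc k) t * Im (cnj (\<zeta> t) * D t)) (at t within ?J)"
      by (simp only:)
    have "norm (R t - D0) \<le> norm (cnj (E k t - E k c) * E (Suc k) t) + norm (cnj (E k c) * (E (Suc k) t - F))"
      unfolding R_def D0_def by (rule order_trans[OF _ norm_triangle_ineq]) (simp add: algebra_simps)
    also have "\<dots> \<le> 3 / 8"
      using near(2,3)[OF t] norm_E k t c by (simp add: norm_mult del: complex_cnj_diff)
    finally have 1: "norm (R t - D0) \<le> 3 / 8" .
    have "\<bar>h t * s t\<bar> \<le> 1 / 8 * 1"
      unfolding abs_mult using small_h[OF t] s1[OF t] by (intro mult_mono) auto
    then have 2: "norm (R t + of_real (h t * s t) - D0) \<le> 1 / 2"
      using 1 norm_triangle_ineq[of "R t - D0" "of_real (h t * s t)"]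
      by (simp add: algebra_simps del: of_real_mult)
    have "D t - 1 = cnj D0 * (R t + of_real (h t * s t) - D0)"
      using D0D0 by (simp add: D_def algebra_simps)
    then have "norm (D t - 1) \<le> 1 / 2" using 2 D01 by (simp add: norm_mult)
    then show "0 < Re (D t)" using abs_Re_le_cmod[of "D t - 1"] by simp
    have turn: "cnj (D t) * D' t = (D0 * cnj D0) * (cnj (R t + of_real (h t * s t))
        * (\<i> * of_real (w (Suc k) t - w k t) * R t
        + of_real (h t * ((w (Suc k) t - w k t) * Re (R t)) + - w k t * g t * s t)))"
      by (simp add: D_def D'_def algebra_simps)
    have im: "Im (cnj (D t) * D' t) = (w (Suc k) t - w k t) * ((Re (R t))\<^sup>2 + (Im (R t))\<^sup>2) + w k t * g t * (s t)\<^sup>2"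
      unfolding turn D0D0 by (simp add: s_def algebra_simps power2_eq_square)
    have 3: "Im (cnj (D t) * D' t) = w (Suc k) t - w k t * (1 - g t * (s t)\<^sup>2)"
      by (simp only: im R1[OF t]) (simp add: algebra_simps)
    have "\<bar>g t * (s t)\<^sup>2\<bar> \<le> 1 / 8 * 1"
      unfolding abs_mult using small_g[OF t] s1[OF t] by (intro mult_mono) auto
    then have "\<bar>1 - g t * (s t)\<^sup>2\<bar> \<le> 2" by linarith
    then have "\<bar>w k t * (1 - g t * (s t)\<^sup>2)\<bar> \<le> \<bar>w k t\<bar> * 2"
      unfolding abs_mult by (intro mult_left_mono) auto
    then have "\<bar>w k t * (1 - g t * (s t)\<^sup>2)\<bar> < \<bar>w (Suc k) t\<bar>"
      using fast[OF t] by linarith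
    then show "0 < sgn (w (Suc k) c) * Im (cnj (D t) * D' t)"
      unfolding 3 sgn_w[OF t, symmetric] by (auto simp: sgn_if)
  next
    have "axle k c - axle k c = 0" "E k c * cnj (E k c) = 1" using E_cnj k c by auto
    then show "\<zeta> c = 0" "\<zeta> d = 0" "S c = S d"
      using ret by (simp_all add: \<zeta>_def S_def g_def h_def p_def \<theta>_def)
  qed
qed

end

section \<open>The \<open>C\<^sup>1\<close>-topology\<close>

lemma C1_curve_has_velocity:
  assumes "C1_curve a b x" "t \<in> {a..b}"
  shows "((\<lambda>s. x s i) has_vector_derivative velocity a b x t i) (at t within {a..b})"
  using assms by (simp add: C1_curve_def velocity_def vector_derivative_works)

lemma velocity_eqI:
  assumes "a < b" "t \<in> {a..b}" "((\<lambda>s. x s i) has_vector_derivative D) (at t within {a..b})"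
  shows "velocity a b x t i = D"
  unfolding velocity_def using vector_derivative_within_cbox[of a b t "\<lambda>s. x s i" D] assms by simp

lemma velocity_vanishing_coordinate:
  assumes "a < b" "t \<in> {a..b}" "\<And>s. s \<in> {a..b} \<Longrightarrow> x s i = 0"
  shows "velocity a b x t i = 0"
proof (rule velocity_eqI[OF assms(1,2)])
  show "((\<lambda>s. x s i) has_vector_derivative 0) (at t within {a..b})"
    by (rule has_vector_derivative_transform[OF assms(2) _ has_vector_derivative_const[of 0]])
       (use assms(3) in simp)
qed

lemma integral_curve_subinterval:
  assumes x: "integral_curve M D a b x" and "a \<le> c" "c < d" "d \<le> b"
  shows "integral_curve M D c d x"
    and "\<And>t. t \<in> {c..d} \<Longrightarrow> velocity c d x t = velocity a b x t"
proof -
  have C1: "C1_curve a b x" using x by (simp add: integral_curve_def)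
  have sub: "{c..d} \<subseteq> {a..b}" using assms by auto
  have der: "((\<lambda>s. x s i) has_vector_derivative velocity a b x t i) (at t within {c..d})"
    if "t \<in> {c..d}" for t i
    by (rule has_vector_derivative_within_subset[OF C1_curve_has_velocity[OF C1] sub])
       (use that sub in auto)
  show vel: "velocity c d x t = velocity a b x t" if "t \<in> {c..d}" for t
    by (rule ext) (rule velocity_eqI[OF \<open>c < d\<close> that der[OF that]])
  have "C1_curve c d x"
    unfolding C1_curve_def
  proof (intro allI conjI ballI)
    fix i
    show "(\<lambda>s. x s i) differentiable at t within {c..d}" if "t \<in> {c..d}" for t
      using der[OF that] by (rule differentiableI_vector)
    have "continuous_on {c..d} (\<lambda>t. velocity a b x t i)"
      using C1 sub by (auto simp: C1_curve_def intro: continuous_on_subset)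
    then show "continuous_on {c..d} (\<lambda>t. velocity c d x t i)"
      by (rule continuous_on_eq) (simp add: vel)
  qed
  then show "integral_curve M D c d x"
    using x sub vel by (auto simp: integral_curve_def)
qed

lemma continuous_gap_below:
  fixes f :: "real \<Rightarrow> real"
  assumes "a \<le> b" "continuous_on {a..b} f" "\<And>t. t \<in> {a..b} \<Longrightarrow> \<bar>f t\<bar> < \<epsilon>"
  obtains \<delta> where "0 < \<delta>" "\<And>t. t \<in> {a..b} \<Longrightarrow> \<bar>f t\<bar> + \<delta> \<le> \<epsilon>"
proof -
  have "\<exists>m\<in>{a..b}. \<forall>t\<in>{a..b}. \<bar>f t\<bar> \<le> \<bar>f m\<bar>"
    using assms by (intro continuous_attains_sup continuous_intros) auto
  then obtain m where "m \<in> {a..b}" "\<And>t. t \<in> {a..b} \<Longrightarrow> \<bar>f t\<bar> \<le> \<bar>f m\<bar>" by blast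
  then show ?thesis using assms(3)[of m] by (intro that[of "\<epsilon> - \<bar>f m\<bar>"]) (auto simp: algebra_simps)
qed

text \<open>
  The generating sets of the topology are balls around arbitrary centers.  A strict bound on \<open>{a..b}\<close>
  leaves a positive gap by compactness, and only the finitely many coordinates in \<open>R\<close> have to be
  taken into account; so such a ball contains a ball around each of its points.
\<close>

lemma open_contains_C1_ball:
  assumes "a < b" "finite R"
    and C1: "\<And>y. y \<in> \<O> \<Longrightarrow> C1_curve a b y"
    and R: "\<And>y t i. y \<in> \<O> \<Longrightarrow> t \<in> {a..b} \<Longrightarrow> i \<notin> R \<Longrightarrow> y t i = 0"
    and V: "openin (C1_topology a b \<O>) V" and "x \<in> V"
  obtains \<epsilon> where "0 < \<epsilon>" "\<And>y. y \<in> \<O> \<Longrightarrow> C1_close a b \<epsilon> x y \<Longrightarrow> y \<in> V"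
proof -
  have "generate_topology_on {{y \<in> \<O>. C1_close a b \<epsilon> x y} |x \<epsilon>. x \<in> \<O> \<and> 0 < \<epsilon>} V"
    using V unfolding C1_topology_def by (rule openin_topology_generated_by)
  then have "\<forall>x\<in>V. \<exists>\<epsilon>>0. \<forall>y\<in>\<O>. C1_close a b \<epsilon> x y \<longrightarrow> y \<in> V"
  proof induction
    case (Int A B)
    show ?case
    proof
      fix x assume "x \<in> A \<inter> B"
      with Int obtain \<epsilon>1 \<epsilon>2 where "0 < \<epsilon>1" "0 < \<epsilon>2" and
        "\<forall>y\<in>\<O>. C1_close a b \<epsilon>1 x y \<longrightarrow> y \<in> A" "\<forall>y\<in>\<O>. C1_close a b \<epsilon>2 x y \<longrightarrow> y \<in> B"
        by blast
      moreover have "C1_close a b \<epsilon>1 x y \<and> C1_close a b \<epsilon>2 x y" if "C1_close a b (min \<epsilon>1 \<epsilon>2) x y" for y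
        using that by (simp add: C1_close_def)
      ultimately show "\<exists>\<epsilon>>0. \<forall>y\<in>\<O>. C1_close a b \<epsilon> x y \<longrightarrow> y \<in> A \<inter> B"
        by (intro exI[of _ "min \<epsilon>1 \<epsilon>2"]) auto
    qed
  next
    case (UN K)
    then show ?case by (meson UnionE UnionI)
  next
    case (Basis B)
    then obtain z \<epsilon> where z: "z \<in> \<O>" "0 < \<epsilon>" and B: "B = {y \<in> \<O>. C1_close a b \<epsilon> z y}" by blast
    show ?case
    proof
      fix x assume "x \<in> B"
      then have x: "x \<in> \<O>" "C1_close a b \<epsilon> z x" by (auto simp: B)
      have cont: "continuous_on {a..b} (\<lambda>t. y t i)" "continuous_on {a..b} (\<lambda>t. velocity a b y t i)"
        if "y \<in> \<O>" for y i
        using C1[OF that] continuous_on_vector_derivative[OF C1_curve_has_velocity[OF C1[OF that]]]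
        by (simp_all add: C1_curve_def)
      have "\<exists>\<delta>>0. \<forall>t\<in>{a..b}. \<bar>x t i - z t i\<bar> + \<delta> \<le> \<epsilon> \<and> \<bar>velocity a b x t i - velocity a b z t i\<bar> + \<delta> \<le> \<epsilon>" for i
      proof -
        obtain \<delta>1 where \<delta>1: "0 < \<delta>1" "\<And>t. t \<in> {a..b} \<Longrightarrow> \<bar>x t i - z t i\<bar> + \<delta>1 \<le> \<epsilon>"
        proof (rule continuous_gap_below)
          show "continuous_on {a..b} (\<lambda>t. x t i - z t i)"
            by (intro continuous_on_diff cont x z)
        qed (use x \<open>a < b\<close> in \<open>auto simp: C1_close_def\<close>)
        obtain \<delta>2 where \<delta>2: "0 < \<delta>2"
          "\<And>t. t \<in> {a..b} \<Longrightarrow> \<bar>velocity a b x t i - velocity a b z t i\<bar> + \<delta>2 \<le> \<epsilon>"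
        proof (rule continuous_gap_below)
          show "continuous_on {a..b} (\<lambda>t. velocity a b x t i - velocity a b z t i)"
            by (intro continuous_on_diff cont x z)
        qed (use x \<open>a < b\<close> in \<open>auto simp: C1_close_def\<close>)
        show ?thesis
          using \<delta>1 \<delta>2 by (intro exI[of _ "min \<delta>1 \<delta>2"]) force
      qed
      then obtain \<delta> where \<delta>: "\<And>i. 0 < \<delta> i"
        "\<And>i t. t \<in> {a..b} \<Longrightarrow> \<bar>x t i - z t i\<bar> + \<delta> i \<le> \<epsilon>"
        "\<And>i t. t \<in> {a..b} \<Longrightarrow> \<bar>velocity a b x t i - velocity a b z t i\<bar> + \<delta> i \<le> \<epsilon>"
        by metis
      define \<delta>0 where "\<delta>0 = Min (insert \<epsilon> (\<delta> ` R))"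
      have "0 < \<delta>0" using \<open>finite R\<close> \<delta>(1) z(2) by (simp add: \<delta>0_def)
      have le: "\<delta>0 \<le> \<delta> i" if "i \<in> R" for i using \<open>finite R\<close> that by (simp add: \<delta>0_def)
      have "y \<in> B" if y: "y \<in> \<O>" "C1_close a b \<delta>0 x y" for y
      proof -
        have "\<bar>y t i - z t i\<bar> < \<epsilon> \<and> \<bar>velocity a b y t i - velocity a b z t i\<bar> < \<epsilon>" if t: "t \<in> {a..b}" for t i
        proof (cases "i \<in> R")
          case True
          have "\<bar>y t i - x t i\<bar> < \<delta>0 \<and> \<bar>velocity a b y t i - velocity a b x t i\<bar> < \<delta>0"
            using y(2) t by (simp add: C1_close_def)
          then show ?thesis using le[OF True] \<delta>(2,3)[OF t, of i] by linarith
        next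
          case False
          then have "u t i = 0 \<and> velocity a b u t i = 0" if "u \<in> \<O>" for u
            using velocity_vanishing_coordinate[OF \<open>a < b\<close> t, of u i] R[of u _ i] that t False by simp
          from this[OF y(1)] this[OF z(1)] show ?thesis using z(2) by simp
        qed
        then show ?thesis using y(1) by (simp add: B C1_close_def)
      qed
      then show "\<exists>\<epsilon>>0. \<forall>y\<in>\<O>. C1_close a b \<epsilon> x y \<longrightarrow> y \<in> B"
        using \<open>0 < \<delta>0\<close> by blast
    qed
  qed simp
  then show ?thesis using \<open>x \<in> V\<close> that by blast
qed

lemma trailer_rigid_iff:
  assumes "c < d" and x: "integral_curve (trailer_space n) D c d x"
  shows "rigid (trailer_space n) D c d x \<longleftrightarrow>
    (\<exists>\<epsilon>>0. \<forall>y. integral_curve (trailer_space n) D c d y \<and> y c = x c \<and> y d = x d \<and>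
      C1_close c d \<epsilon> x y \<longrightarrow> reparametrization c d x y)"
    (is "_ \<longleftrightarrow> ?ball")
proof
  let ?O = "curves_between (trailer_space n) D c d (x c) (x d)"
  let ?R = "{Xi1, Xi2} \<union> Cos ` {..n} \<union> Sin ` {..n}"
  have "y t i = 0" if "y \<in> ?O" "t \<in> {c..d}" "i \<notin> ?R" for y t i
  proof -
    have "y t \<in> trailer_space n" using that by (auto simp: curves_between_def integral_curve_def)
    then show ?thesis using that(3) by (cases i) (auto simp: trailer_space_def image_iff not_le)
  qed
  note R = this
  assume "rigid (trailer_space n) D c d x"
  then obtain V where V: "openin (C1_topology c d ?O) V" "x \<in> V" "\<forall>y\<in>V. reparametrization c d x y"
    by (auto simp: rigid_def)
  obtain \<epsilon> where "0 < \<epsilon>" "\<And>y. y \<in> ?O \<Longrightarrow> C1_close c d \<epsilon> x y \<Longrightarrow> y \<in> V"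
  proof (rule open_contains_C1_ball[where a = c and b = d and R = ?R and \<O> = ?O, OF \<open>c < d\<close> _ _ _ V(1,2)])
    show "finite ?R" by simp
    show "y t i = 0" if "y \<in> ?O" "t \<in> {c..d}" "i \<notin> ?R" for y t i
      using that by (rule R)
    show "C1_curve c d y" if "y \<in> ?O" for y
      using that by (simp add: curves_between_def integral_curve_def)
  qed blast
  then show ?ball using V(3) by (auto simp: curves_between_def)
next
  let ?O = "curves_between (trailer_space n) D c d (x c) (x d)"
  assume ?ball
  then obtain \<epsilon> where \<epsilon>: "0 < \<epsilon>" "\<And>y. y \<in> ?O \<Longrightarrow> C1_close c d \<epsilon> x y \<Longrightarrow> reparametrization c d x y"
    by (auto simp: curves_between_def)
  have xO: "x \<in> ?O" using x by (simp add: curves_between_def)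
  have "openin (C1_topology c d ?O) {y \<in> ?O. C1_close c d \<epsilon> x y}"
    unfolding C1_topology_def using xO \<epsilon>(1) by (intro topology_generated_by_Basis) blast
  moreover have "C1_close c d \<epsilon> x x" using \<epsilon>(1) by (simp add: C1_close_def)
  ultimately show "rigid (trailer_space n) D c d x"
    unfolding rigid_def using x xO \<epsilon>(2) by blast
qed

section \<open>Integral curves of the trailer distribution\<close>

definition position :: "(coord \<Rightarrow> real) \<Rightarrow> complex" where
  "position p = Complex (p Xi1) (p Xi2)"

definition heading :: "nat \<Rightarrow> (coord \<Rightarrow> real) \<Rightarrow> complex" where
  "heading k p = Complex (p (Cos k)) (p (Sin k))"

lemma config_eqI:
  assumes "position p = position q" "\<And>k. heading k p = heading k q"
  shows "p = q"
proof
  fix i show "p i = q i"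
    using assms(1) assms(2)[of "case i of Cos k \<Rightarrow> k | Sin k \<Rightarrow> k | _ \<Rightarrow> 0"]
    by (cases i) (auto simp: position_def heading_def)
qed

lemma axle_center_complex:
  "axle_center k p = (Re (position p + (\<Sum>j<k. heading j p)), Im (position p + (\<Sum>j<k. heading j p)))"
  by (simp add: axle_center_def position_def heading_def)

lemma rel_heading:
  "cnj (heading k p) * heading (Suc k) p = of_real (rel_cos p (Suc k) k) + \<i> * of_real (rel_sin p (Suc k) k)"
  by (simp add: heading_def rel_cos_def rel_sin_def complex_eq_iff algebra_simps)

lemma cos_prod_step:
  assumes "k < n"
  shows "cos_prod n p k = rel_cos p (Suc k) k * cos_prod n p (Suc k)"
  using assms by (simp add: cos_prod_def prod.atLeast_Suc_atMost[of "Suc k"])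

lemma heading_drive_field:
  "heading k (drive_field n p)
     = (if k < n then \<i> * of_real (cos_prod n p (Suc k) * rel_sin p (Suc k) k) * heading k p else 0)"
proof -
  have [simp]: "d_xi1 (Cos k) = 0" "d_xi2 (Cos k) = 0" "d_xi1 (Sin k) = 0" "d_xi2 (Sin k) = 0"
    by (simp_all add: d_xi1_def d_xi2_def)
  have field: "drive_field n p i = (\<Sum>j<n. cos_prod n p (j + 1) * rel_sin p (j + 1) j * d_theta j p i)"
    if "d_xi1 i = 0" "d_xi2 i = 0" for i
    using that by (simp add: drive_field_def)
  have "drive_field n p (Cos k) = (\<Sum>i<n. if i = k then - (cos_prod n p (i + 1) * rel_sin p (i + 1) i * p (Sin i)) else 0)"
    by (subst field) (auto simp only: d_theta_def intro!: sum.cong, auto)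
  moreover have "drive_field n p (Sin k) = (\<Sum>i<n. if i = k then cos_prod n p (i + 1) * rel_sin p (i + 1) i * p (Cos i) else 0)"
    by (subst field) (auto simp only: d_theta_def intro!: sum.cong, auto)
  ultimately show ?thesis
    by (auto simp: heading_def complex_eq_iff sum.delta')
qed

lemma position_drive_field: "position (drive_field n p) = of_real (cos_prod n p 0) * heading 0 p"
  by (simp add: position_def heading_def complex_eq_iff drive_field_def d_xi1_def d_xi2_def d_theta_def)

text \<open>
  The products of cosines in the definition of the distribution solve the recursion
  \<open>v k = v (k + 1) cos (\<theta>\<^bsub>k+1\<^esub> - \<theta>\<^sub>k)\<close>; the two coefficients of the spanning fields are \<open>w n\<close> and \<open>v n\<close>.
\<close>

lemma trailer_distribution_iff:
  "V \<in> trailer_distribution n p \<longleftrightarrow>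
     (\<exists>v w. position V = of_real (v 0) * heading 0 p \<and>
       (\<forall>k\<le>n. heading k V = \<i> * of_real (w k) * heading k p) \<and>
       (\<forall>k<n. of_real (v k) + \<i> * of_real (w k)
          = of_real (v (Suc k)) * (cnj (heading k p) * heading (Suc k) p)) \<and>
       (\<forall>k>n. heading k V = 0))"
    (is "_ \<longleftrightarrow> (\<exists>v w. ?kin v w)")
proof
  have lin: "position (\<lambda>c. \<alpha> * d_theta n p c + \<beta> * drive_field n p c) = of_real (\<beta> * cos_prod n p 0) * heading 0 p"
    "heading k (\<lambda>c. \<alpha> * d_theta n p c + \<beta> * drive_field n p c) =
      (if k < n then \<i> * of_real (\<beta> * (cos_prod n p (Suc k) * rel_sin p (Suc k) k)) * heading k p
       else if k = n then \<i> * of_real \<alpha> * heading n p else 0)" for \<alpha> \<beta> k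
  proof -
    have "position (\<lambda>c. \<alpha> * d_theta n p c + \<beta> * drive_field n p c)
        = of_real \<alpha> * position (d_theta n p) + of_real \<beta> * position (drive_field n p)"
      by (simp add: position_def complex_eq_iff)
    then show "position (\<lambda>c. \<alpha> * d_theta n p c + \<beta> * drive_field n p c) = of_real (\<beta> * cos_prod n p 0) * heading 0 p"
      by (simp add: position_drive_field) (simp add: position_def d_theta_def complex_eq_iff)
    have "heading k (\<lambda>c. \<alpha> * d_theta n p c + \<beta> * drive_field n p c)
        = of_real \<alpha> * heading k (d_theta n p) + of_real \<beta> * heading k (drive_field n p)"
      by (simp add: heading_def complex_eq_iff)
    moreover have "heading k (d_theta n p) = (if k = n then \<i> * heading n p else 0)"
      by (simp add: heading_def d_theta_def complex_eq_iff)
    ultimately show "heading k (\<lambda>c. \<alpha> * d_theta n p c + \<beta> * drive_field n p c) =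
      (if k < n then \<i> * of_real (\<beta> * (cos_prod n p (Suc k) * rel_sin p (Suc k) k)) * heading k p
       else if k = n then \<i> * of_real \<alpha> * heading n p else 0)"
      by (simp add: heading_drive_field algebra_simps)
  qed
  {
    assume "V \<in> trailer_distribution n p"
    then obtain \<alpha> \<beta> where V: "V = (\<lambda>c. \<alpha> * d_theta n p c + \<beta> * drive_field n p c)"
      by (auto simp: trailer_distribution_def)
    define v w where "v = (\<lambda>k. \<beta> * cos_prod n p k)"
      and "w = (\<lambda>k. if k < n then \<beta> * (cos_prod n p (Suc k) * rel_sin p (Suc k) k) else \<alpha>)"
    have "?kin v w"
      by (auto simp: V lin v_def w_def rel_heading cos_prod_step algebra_simps)
    then show "\<exists>v w. ?kin v w" by blast
  }
  assume "\<exists>v w. ?kin v w"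
  then obtain v w where kin: "?kin v w" by blast
  have v: "v k = v n * cos_prod n p k" if "k \<le> n" for k
    using that
  proof (induction k rule: inc_induct)
    case base
    then show ?case by (simp add: cos_prod_def)
  next
    case (step k)
    have "v k = v (Suc k) * rel_cos p (Suc k) k"
      using kin step(2) unfolding rel_heading by (auto simp: complex_eq_iff)
    then show ?case using step by (simp add: cos_prod_step)
  qed
  have w: "w k = v n * (cos_prod n p (Suc k) * rel_sin p (Suc k) k)" if "k < n" for k
    using kin that v[of "Suc k"] unfolding rel_heading by (auto simp: complex_eq_iff)
  have "V = (\<lambda>c. w n * d_theta n p c + v n * drive_field n p c)"
  proof (rule config_eqI)
    show "position V = position (\<lambda>c. w n * d_theta n p c + v n * drive_field n p c)"
      unfolding lin using kin v[of 0] by simp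
    show "heading k V = heading k (\<lambda>c. w n * d_theta n p c + v n * drive_field n p c)" for k
      unfolding lin using kin w[of k] by (cases k n rule: linorder_cases) auto
  qed
  then show "V \<in> trailer_distribution n p" by (auto simp: trailer_distribution_def)
qed

text \<open>
  Both quantities are read off from the velocity by projecting onto the heading and its normal,
  which makes their continuity evident.
\<close>

definition axle_speed :: "real \<Rightarrow> real \<Rightarrow> (real \<Rightarrow> coord \<Rightarrow> real) \<Rightarrow> nat \<Rightarrow> real \<Rightarrow> real" where
  "axle_speed c d x k t = Re (cnj (heading k (x t)) *
     (position (velocity c d x t) + (\<Sum>j<k. heading j (velocity c d x t))))"

definition turning_rate :: "real \<Rightarrow> real \<Rightarrow> (real \<Rightarrow> coord \<Rightarrow> real) \<Rightarrow> nat \<Rightarrow> real \<Rightarrow> real" where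
  "turning_rate c d x k t = Im (cnj (heading k (x t)) * heading k (velocity c d x t))"

lemma norm_heading: "p \<in> trailer_space n \<Longrightarrow> k \<le> n \<Longrightarrow> norm (heading k p) = 1"
  by (simp add: heading_def trailer_space_def cmod_def)

lemma heading_beyond: "p \<in> trailer_space n \<Longrightarrow> n < k \<Longrightarrow> heading k p = 0"
  by (simp add: heading_def trailer_space_def complex_eq_iff)

lemma C1_curve_complex_derivatives:
  assumes "C1_curve c d x" "t \<in> {c..d}"
  shows "((\<lambda>s. position (x s)) has_vector_derivative position (velocity c d x t)) (at t within {c..d})"
    and "((\<lambda>s. heading k (x s)) has_vector_derivative heading k (velocity c d x t)) (at t within {c..d})"
  using C1_curve_has_velocity[OF assms]
  by (simp_all add: has_vector_derivative_complex_iff position_def heading_def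
      has_real_derivative_iff_has_vector_derivative)

lemma C1_curve_complex_continuous:
  assumes "C1_curve c d x"
  shows "continuous_on {c..d} (\<lambda>t. position (x t))" "continuous_on {c..d} (\<lambda>t. heading k (x t))"
    "continuous_on {c..d} (\<lambda>t. position (velocity c d x t))"
    "continuous_on {c..d} (\<lambda>t. heading k (velocity c d x t))"
proof -
  show "continuous_on {c..d} (\<lambda>t. position (x t))" "continuous_on {c..d} (\<lambda>t. heading k (x t))"
    by (rule continuous_on_vector_derivative, rule C1_curve_complex_derivatives[OF assms], assumption)+
  show "continuous_on {c..d} (\<lambda>t. position (velocity c d x t))"
    "continuous_on {c..d} (\<lambda>t. heading k (velocity c d x t))"
    using assms unfolding position_def heading_def Complex_eq
    by (auto simp: C1_curve_def intro!: continuous_intros)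
qed

abbreviation (input) trailer_curve :: "nat \<Rightarrow> real \<Rightarrow> real \<Rightarrow> (real \<Rightarrow> coord \<Rightarrow> real) \<Rightarrow> bool" where
  "trailer_curve n \<equiv> integral_curve (trailer_space n) (trailer_distribution n)"

abbreviation (input) rigid_motion :: "nat \<Rightarrow> real \<Rightarrow> real \<Rightarrow> (real \<Rightarrow> coord \<Rightarrow> real) \<Rightarrow> bool" where
  "rigid_motion n \<equiv> rigid (trailer_space n) (trailer_distribution n)"

lemma integral_curve_motion:
  assumes "c < d" and x: "trailer_curve n c d x"
  shows "trailer_motion n c d (\<lambda>t. position (x t)) (\<lambda>k t. heading k (x t))
    (axle_speed c d x) (turning_rate c d x)"
proof -
  let ?J = "{c..d}"
  have C1: "C1_curve c d x" and space: "\<And>t. t \<in> ?J \<Longrightarrow> x t \<in> trailer_space n"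
    and dist: "\<And>t. t \<in> ?J \<Longrightarrow> velocity c d x t \<in> trailer_distribution n (x t)"
    using x by (auto simp: integral_curve_def)
  have kin: "position (velocity c d x t) = of_real (axle_speed c d x 0 t) * heading 0 (x t) \<and>
      (\<forall>k\<le>n. heading k (velocity c d x t) = \<i> * of_real (turning_rate c d x k t) * heading k (x t)) \<and>
      (\<forall>k<n. of_real (axle_speed c d x k t) + \<i> * of_real (turning_rate c d x k t)
         = of_real (axle_speed c d x (Suc k) t) * (cnj (heading k (x t)) * heading (Suc k) (x t)))"
    if t: "t \<in> ?J" for t
  proof -
    define V where "V = velocity c d x t"
    define h where "h = (\<lambda>k. heading k (x t))"
    obtain v w where pos: "position V = of_real (v 0) * h 0"
      and turn: "\<And>k. k \<le> n \<Longrightarrow> heading k V = \<i> * of_real (w k) * h k"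
      and hitch: "\<And>k. k < n \<Longrightarrow> of_real (v k) + \<i> * of_real (w k) = of_real (v (Suc k)) * (cnj (h k) * h (Suc k))"
      using dist[OF t] unfolding trailer_distribution_iff V_def h_def by blast
    have h1: "cnj (h k) * h k = 1" if "k \<le> n" for k
      using norm_heading[OF space[OF t] that] complex_norm_square[of "h k"] by (simp add: h_def mult.commute)
    have w: "turning_rate c d x k t = w k" if "k \<le> n" for k
    proof -
      have "cnj (h k) * heading k V = \<i> * of_real (w k) * (cnj (h k) * h k)"
        using turn[OF that] by simp
      then have "cnj (h k) * heading k V = \<i> * of_real (w k)" using h1[OF that] by simp
      then have "Im (cnj (h k) * heading k V) = w k" by (simp only:) simp
      then show ?thesis by (simp only: turning_rate_def h_def V_def)
    qed
    have ax: "position V + (\<Sum>j<k. heading j V) = of_real (v k) * h k" if "k \<le> n" for k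
      using that
    proof (induction k)
      case (Suc k)
      then have "position V + (\<Sum>j<Suc k. heading j V) = (of_real (v k) + \<i> * of_real (w k)) * h k"
        using turn[of k] by (simp add: algebra_simps)
      also have "\<dots> = of_real (v (Suc k)) * h (Suc k) * (cnj (h k) * h k)"
        using hitch[of k] Suc.prems by (simp add: algebra_simps)
      finally show ?case using h1[of k] Suc.prems by simp
    qed (use pos in simp)
    have v: "axle_speed c d x k t = v k" if "k \<le> n" for k
    proof -
      have "cnj (h k) * (position V + (\<Sum>j<k. heading j V)) = of_real (v k) * (cnj (h k) * h k)"
        unfolding ax[OF that] by simp
      then have "Re (cnj (h k) * (position V + (\<Sum>j<k. heading j V))) = v k"
        unfolding h1[OF that] by (simp only:) simp
      then show ?thesis by (simp only: axle_speed_def h_def V_def)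
    qed
    show ?thesis
    proof -
      have "heading k (x t) = h k" for k by (simp add: h_def)
      then show ?thesis using pos turn hitch by (simp add: v w flip: V_def)
    qed
  qed
  note cont = C1_curve_complex_continuous[OF C1]
  show ?thesis
  proof
    show "((\<lambda>t. position (x t)) has_vector_derivative
       of_real (axle_speed c d x 0 t) * heading 0 (x t)) (at t within ?J)" if "t \<in> ?J" for t
      using C1_curve_complex_derivatives(1)[OF C1 that] kin[OF that] by simp
    show "((\<lambda>t. heading k (x t)) has_vector_derivative
       \<i> * of_real (turning_rate c d x k t) * heading k (x t)) (at t within ?J)" if "k \<le> n" "t \<in> ?J" for k t
      using C1_curve_complex_derivatives(2)[OF C1 that(2), of k] kin[OF that(2)] that(1) by simp
    show "continuous_on ?J (axle_speed c d x k)" "continuous_on ?J (turning_rate c d x k)" for k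
      unfolding axle_speed_def[abs_def] turning_rate_def[abs_def]
      by (intro continuous_intros cont)+
  qed (use kin \<open>c < d\<close> norm_heading[OF space] in auto)
qed

text \<open>
  To recognize an integral curve it suffices that every axle center moves along its heading: the
  turning rates then come from the unit length of the headings.
\<close>

lemma integral_curveI:
  assumes "c < d" and space: "\<And>t. t \<in> {c..d} \<Longrightarrow> y t \<in> trailer_space n"
    and dQ: "\<And>t. t \<in> {c..d} \<Longrightarrow> ((\<lambda>s. position (y s)) has_vector_derivative Q' t) (at t within {c..d})"
    and dH: "\<And>k t. k \<le> n \<Longrightarrow> t \<in> {c..d} \<Longrightarrow>
      ((\<lambda>s. heading k (y s)) has_vector_derivative H' k t) (at t within {c..d})"
    and cont: "continuous_on {c..d} Q'" "\<And>k. k \<le> n \<Longrightarrow> continuous_on {c..d} (H' k)"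
    and roll: "\<And>k t. k \<le> n \<Longrightarrow> t \<in> {c..d} \<Longrightarrow>
      \<exists>s. Q' t + (\<Sum>j<k. H' j t) = of_real s * heading k (y t)"
  shows "trailer_curve n c d y"
    and "\<And>t. t \<in> {c..d} \<Longrightarrow> position (velocity c d y t) = Q' t"
    and "\<And>k t. t \<in> {c..d} \<Longrightarrow> heading k (velocity c d y t) = (if k \<le> n then H' k t else 0)"
proof -
  let ?J = "{c..d}"
  define H where "H = (\<lambda>k t. if k \<le> n then H' k t else 0)"
  have dH0: "((\<lambda>s. heading k (y s)) has_vector_derivative H k t) (at t within ?J)" if "t \<in> ?J" for k t
  proof (cases "k \<le> n")
    case False
    have "((\<lambda>s. heading k (y s)) has_vector_derivative 0) (at t within ?J)"
      by (rule has_vector_derivative_transform[OF that _ has_vector_derivative_const[of 0]])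
         (use False heading_beyond[OF space] in simp)
    then show ?thesis using False by (simp add: H_def)
  qed (use dH that in \<open>simp add: H_def\<close>)
  have contH: "continuous_on ?J (H k)" for k
    by (cases "k \<le> n") (use cont in \<open>auto simp: H_def[abs_def]\<close>)
  define V where "V = (\<lambda>t i. case i of Xi1 \<Rightarrow> Re (Q' t) | Xi2 \<Rightarrow> Im (Q' t)
    | Cos k \<Rightarrow> Re (H k t) | Sin k \<Rightarrow> Im (H k t))"
  have der: "((\<lambda>s. y s i) has_vector_derivative V t i) (at t within ?J)" if "t \<in> ?J" for t i
    using dQ[OF that] dH0[OF that, of "case i of Cos k \<Rightarrow> k | Sin k \<Rightarrow> k | _ \<Rightarrow> 0"]
    by (cases i) (auto simp: V_def position_def heading_def has_vector_derivative_complex_iff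
         has_real_derivative_iff_has_vector_derivative)
  have vel: "velocity c d y t = V t" if "t \<in> ?J" for t
    by (rule ext) (rule velocity_eqI[OF \<open>c < d\<close> that der[OF that]])
  have Q: "position (velocity c d y t) = Q' t" and H: "heading k (velocity c d y t) = H k t" if "t \<in> ?J" for k t
    by (simp_all add: vel[OF that] V_def position_def heading_def)
  show "position (velocity c d y t) = Q' t"
    and "heading k (velocity c d y t) = (if k \<le> n then H' k t else 0)" if "t \<in> ?J" for k t
    using Q[OF that] H[OF that] by (simp_all add: H_def)
  have "C1_curve c d y"
    unfolding C1_curve_def
  proof (intro allI conjI ballI)
    fix i
    show "(\<lambda>s. y s i) differentiable at t within ?J" if "t \<in> ?J" for t
      using der[OF that] by (rule differentiableI_vector)
    have "continuous_on ?J (\<lambda>t. V t i)"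
      by (cases i) (auto simp: V_def intro!: continuous_intros cont contH)
    then show "continuous_on ?J (\<lambda>t. velocity c d y t i)"
      by (rule continuous_on_eq) (simp add: vel)
  qed
  moreover have "velocity c d y t \<in> trailer_distribution n (y t)" if t: "t \<in> ?J" for t
  proof -
    define h where "h = (\<lambda>k. heading k (y t))"
    have h1: "cnj (h k) * h k = 1" if "k \<le> n" for k
      using norm_heading[OF space[OF t] that] complex_norm_square[of "h k"] by (simp add: h_def mult.commute)
    obtain v where v: "\<And>k. k \<le> n \<Longrightarrow> Q' t + (\<Sum>j<k. H' j t) = of_real (v k) * h k"
      using roll[OF _ t] unfolding h_def by metis
    define w where "w = (\<lambda>k. Im (cnj (h k) * H' k t))"
    have w: "H' k t = \<i> * of_real (w k) * h k" if k: "k \<le> n" for k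
    proof -
      have "((\<lambda>s. cnj (heading k (y s)) * heading k (y s)) has_vector_derivative
          cnj (h k) * H' k t + cnj (H' k t) * h k) (at t within ?J)"
        unfolding h_def by (intro has_vector_derivative_mult has_vector_derivative_cnj dH k t)
      moreover have "((\<lambda>s. cnj (heading k (y s)) * heading k (y s)) has_vector_derivative 0) (at t within ?J)"
      proof (rule has_vector_derivative_transform[OF t _ has_vector_derivative_const[of 1]])
        show "cnj (heading k (y s)) * heading k (y s) = 1" if "s \<in> ?J" for s
          using norm_heading[OF space[OF that] k] complex_norm_square[of "heading k (y s)"]
          by (simp add: mult.commute)
      qed
      ultimately have "cnj (h k) * H' k t + cnj (H' k t) * h k = 0"
        using derivative_within_interval_unique[OF \<open>c < d\<close> t] by blast
      then have "Re (cnj (h k) * H' k t) = 0"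
        by (simp add: complex_eq_iff algebra_simps)
      then have "cnj (h k) * H' k t = \<i> * of_real (w k)"
        by (simp add: complex_eq_iff w_def)
      then have "(cnj (h k) * h k) * H' k t = \<i> * of_real (w k) * h k"
        by (simp add: algebra_simps)
      then show ?thesis using h1[OF k] by simp
    qed
    have "of_real (v k) + \<i> * of_real (w k) = of_real (v (Suc k)) * (cnj (h k) * h (Suc k))" if "k < n" for k
    proof -
      have "of_real (v (Suc k)) * h (Suc k) = (Q' t + (\<Sum>j<k. H' j t)) + H' k t"
        using v[of "Suc k"] that by (simp add: add.assoc)
      also have "\<dots> = of_real (v k) * h k + \<i> * of_real (w k) * h k"
        using v[of k] w[of k] that by simp
      finally have "of_real (v (Suc k)) * h (Suc k) = of_real (v k) * h k + \<i> * of_real (w k) * h k" .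
      then have "cnj (h k) * (of_real (v (Suc k)) * h (Suc k))
          = (of_real (v k) + \<i> * of_real (w k)) * (cnj (h k) * h k)"
        by (simp add: algebra_simps)
      then have "cnj (h k) * (of_real (v (Suc k)) * h (Suc k)) = of_real (v k) + \<i> * of_real (w k)"
        using h1[of k] that by simp
      then show ?thesis by (simp add: mult.left_commute)
    qed
    moreover have "position (velocity c d y t) = of_real (v 0) * h 0"
      using v[of 0] Q[OF t] by simp
    moreover have "heading k (velocity c d y t) = \<i> * of_real (w k) * h k" if "k \<le> n" for k
      using w[OF that] H[OF t, of k] that by (simp add: H_def)
    moreover have "heading k (velocity c d y t) = 0" if "n < k" for k
      using H[OF t, of k] that by (simp add: H_def)
    ultimately show ?thesis
      unfolding trailer_distribution_iff h_def by blast
  qed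
  ultimately show "trailer_curve n c d y"
    using space by (simp add: integral_curve_def)
qed

section \<open>Motions with two fixed axles are locally rigid\<close>

lemma norm_complex_lt:
  assumes "\<bar>Re z\<bar> < \<epsilon>" "\<bar>Im z\<bar> < \<epsilon>"
  shows "norm z < 2 * \<epsilon>"
  using cmod_le[of z] assms by linarith

lemma C1_close_complex:
  assumes "C1_close c d \<epsilon> x y" "t \<in> {c..d}"
  shows "norm (position (y t) - position (x t)) < 2 * \<epsilon>"
    and "norm (heading k (y t) - heading k (x t)) < 2 * \<epsilon>"
    and "norm (heading k (velocity c d y t) - heading k (velocity c d x t)) < 2 * \<epsilon>"
  using assms by (auto simp: C1_close_def position_def heading_def intro!: norm_complex_lt)

lemma velocity_complex:
  assumes "c < d" and x: "trailer_curve n c d x"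
    and t: "t \<in> {c..d}"
  shows "position (velocity c d x t) = of_real (axle_speed c d x 0 t) * heading 0 (x t)"
    and "k \<le> n \<Longrightarrow> heading k (velocity c d x t) = \<i> * of_real (turning_rate c d x k t) * heading k (x t)"
proof -
  interpret X: trailer_motion n c d "\<lambda>t. position (x t)" "\<lambda>k t. heading k (x t)"
    "axle_speed c d x" "turning_rate c d x"
    by (rule integral_curve_motion[OF \<open>c < d\<close> x])
  have C1: "C1_curve c d x" using x by (simp add: integral_curve_def)
  show "position (velocity c d x t) = of_real (axle_speed c d x 0 t) * heading 0 (x t)"
    by (rule derivative_within_interval_unique[OF \<open>c < d\<close> t C1_curve_complex_derivatives(1)[OF C1 t] X.P_deriv[OF t]])
  show "heading k (velocity c d x t) = \<i> * of_real (turning_rate c d x k t) * heading k (x t)" if "k \<le> n"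
    by (rule derivative_within_interval_unique[OF \<open>c < d\<close> t C1_curve_complex_derivatives(2)[OF C1 t] X.E_deriv[OF that t]])
qed

text \<open>
  For a competitor \<open>y\<close> with the same end points, the contact element of the \<open>k\<close>-th vehicle returns to
  its initial position, hence its axle \<open>k + 1\<close> is at rest as well.  Then \<open>x\<close> and \<open>y\<close> rotate rigidly in
  the same way, and equating the angles of their headings \<open>k + 1\<close> gives the reparametrization.
\<close>

lemma rigid_if_axle_at_rest:
  assumes "c < d" "k < n"
    and x: "trailer_curve n c d x"
    and rest: "\<And>t. t \<in> {c..d} \<Longrightarrow> axle_speed c d x (Suc k) t = 0"
    and turning: "\<And>t. t \<in> {c..d} \<Longrightarrow> turning_rate c d x (Suc k) t \<noteq> 0"
    and F: "norm F = 1" and near: "\<And>t. t \<in> {c..d} \<Longrightarrow> norm (heading (Suc k) (x t) - F) \<le> 1 / 8"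
  shows "rigid_motion n c d x"
proof -
  let ?J = "{c..d}" and ?wx = "turning_rate c d x"
  interpret X: trailer_motion n c d "\<lambda>t. position (x t)" "\<lambda>k t. heading k (x t)"
    "axle_speed c d x" "turning_rate c d x"
    by (rule integral_curve_motion[OF \<open>c < d\<close> x])
  have J: "c \<in> ?J" "d \<in> ?J" and k: "k \<le> n" "Suc k \<le> n" using assms by auto
  have space_x: "x t \<in> trailer_space n" if "t \<in> ?J" for t
    using x that by (simp add: integral_curve_def)
  have "\<exists>t0\<in>?J. \<forall>t\<in>?J. \<bar>?wx (Suc k) t0\<bar> \<le> \<bar>?wx (Suc k) t\<bar>"
    using k \<open>c < d\<close> by (intro continuous_attains_inf continuous_intros X.cont_w) auto
  then obtain t0 where t0: "t0 \<in> ?J" "\<And>t. t \<in> ?J \<Longrightarrow> \<bar>?wx (Suc k) t0\<bar> \<le> \<bar>?wx (Suc k) t\<bar>" by blast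
  define m where "m = \<bar>?wx (Suc k) t0\<bar>"
  have m: "0 < m" "\<And>t. t \<in> ?J \<Longrightarrow> m \<le> \<bar>?wx (Suc k) t\<bar>"
    using t0 turning[OF t0(1)] by (simp_all add: m_def)
  have rest_k: "axle_speed c d x k t = 0 \<and> ?wx k t = 0" if "t \<in> ?J" for t
    using X.speed_zero_below[OF rest[OF that], of k] k that by simp
  \<comment> \<open>A complex distance is at most twice a coordinate distance, and a center is the sum of at most
    \<open>n + 1\<close> complex coordinates; this makes all the bounds of \<open>rest_if_returning\<close> hold.\<close>
  define \<delta> where "\<delta> = min 1 m / (16 * (real n + 1))"
  have "0 < \<delta>" using m by (simp add: \<delta>_def)
  have scale: "2 * N * (M / (16 * N)) = M / 8" if "0 < N" for M N :: real
    using that by simp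
  have "2 * (real n + 1) * \<delta> = min 1 m / 8"
    unfolding \<delta>_def by (rule scale) simp
  then have \<delta>n: "2 * (real n + 1) * \<delta> \<le> 1 / 8" by simp
  have "\<delta> \<le> min 1 m / 16" unfolding \<delta>_def using m by (intro divide_left_mono) auto
  then have \<delta>: "\<delta> \<le> 1 / 16" "\<delta> \<le> m / 16" by auto
  have "reparametrization c d x y"
    if y: "trailer_curve n c d y"
      and yc: "y c = x c" and yd: "y d = x d" and close: "C1_close c d \<delta> x y" for y
  proof -
    let ?wy = "turning_rate c d y"
    interpret Y: trailer_motion n c d "\<lambda>t. position (y t)" "\<lambda>k t. heading k (y t)"
      "axle_speed c d y" "turning_rate c d y"
      by (rule integral_curve_motion[OF \<open>c < d\<close> y])
    have space_y: "y t \<in> trailer_space n" if "t \<in> ?J" for t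
      using y that by (simp add: integral_curve_def)
    note cl = C1_close_complex[OF close]
    have w_diff: "\<bar>?wy (Suc k) t - ?wx (Suc k) t\<bar> \<le> 1 / 2 * \<bar>?wx (Suc k) t\<bar>" if t: "t \<in> ?J" for t
    proof -
      let ?Ex = "heading (Suc k) (x t)" and ?Ey = "heading (Suc k) (y t)"
      let ?Vx = "heading (Suc k) (velocity c d x t)" and ?Vy = "heading (Suc k) (velocity c d y t)"
      have Vx: "?Vx = \<i> * of_real (?wx (Suc k) t) * ?Ex"
        by (rule velocity_complex(2)[OF \<open>c < d\<close> x t k(2)])
      have "cnj ?Ey * (?Vy - ?Vx) + cnj (?Ey - ?Ex) * ?Vx = cnj ?Ey * ?Vy - cnj ?Ex * ?Vx"
        by (simp add: algebra_simps)
      then have diff: "?wy (Suc k) t - ?wx (Suc k) t = Im (cnj ?Ey * (?Vy - ?Vx) + cnj (?Ey - ?Ex) * ?Vx)"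
        by (simp only: turning_rate_def minus_complex.sel)
      have "\<bar>?wy (Suc k) t - ?wx (Suc k) t\<bar> \<le> norm (cnj ?Ey * (?Vy - ?Vx)) + norm (cnj (?Ey - ?Ex) * ?Vx)"
        unfolding diff by (rule order_trans[OF abs_Im_le_cmod norm_triangle_ineq])
      also have "\<dots> = norm (?Vy - ?Vx) + norm (?Ey - ?Ex) * \<bar>?wx (Suc k) t\<bar>"
        using norm_heading[OF space_x[OF t] k(2)] norm_heading[OF space_y[OF t] k(2)]
        by (simp add: norm_mult Vx del: complex_cnj_diff)
      also have "\<dots> \<le> 1 / 4 * \<bar>?wx (Suc k) t\<bar> + 1 / 4 * \<bar>?wx (Suc k) t\<bar>"
        using cl(2,3)[OF t, of "Suc k"] \<delta> m(2)[OF t]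
        by (intro add_mono mult_right_mono) auto
      finally show ?thesis by simp
    qed
    have wy: "\<bar>?wx (Suc k) t\<bar> / 2 \<le> \<bar>?wy (Suc k) t\<bar>" "sgn (?wy (Suc k) t) = sgn (?wx (Suc k) t)"
      if "t \<in> ?J" for t
    proof -
      have "?wx (Suc k) t < 0 \<and> ?wy (Suc k) t < 0 \<or> 0 < ?wx (Suc k) t \<and> 0 < ?wy (Suc k) t"
        using w_diff[OF that] turning[OF that] by linarith
      then show "sgn (?wy (Suc k) t) = sgn (?wx (Suc k) t)" by (elim disjE) simp_all
      show "\<bar>?wx (Suc k) t\<bar> / 2 \<le> \<bar>?wy (Suc k) t\<bar>" using w_diff[OF that] by linarith
    qed
    have rest_y: "axle_speed c d y (Suc k) t = 0" if "t \<in> ?J" for t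
    proof (rule Y.rest_if_returning[OF \<open>k < n\<close> _ _ F _ _ _ _ that])
      have X_fixed: "X.axle k s = X.axle k c" "heading k (x s) = heading k (x c)" if "s \<in> ?J" for s
        using X.at_rest_below(3)[OF k(1) _ that J(1)] X.at_rest_below(2)[OF k(2) rest that J(1), of k] rest_k
        by auto
      have same_c: "Y.axle k c = X.axle k c" and same_d: "Y.axle k d = X.axle k d"
        by (simp_all add: X.axle_def Y.axle_def yc yd)
      show "Y.axle k d = Y.axle k c" "heading k (y d) = heading k (y c)"
        using X_fixed[OF J(2)] same_c same_d by (simp_all add: yc yd)
      fix s assume s: "s \<in> ?J"
      have "norm (Y.axle k s - X.axle k s)
          = norm ((position (y s) - position (x s)) + (\<Sum>j<k. heading j (y s) - heading j (x s)))"
        by (simp add: X.axle_def Y.axle_def sum_subtractf algebra_simps)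
      also have "\<dots> \<le> norm (position (y s) - position (x s)) + (\<Sum>j<k. norm (heading j (y s) - heading j (x s)))"
        by (rule order_trans[OF norm_triangle_ineq add_left_mono[OF norm_sum]])
      also have "\<dots> \<le> 2 * \<delta> + (\<Sum>j<k. 2 * \<delta>)"
        using cl[OF s] by (intro add_mono sum_mono less_imp_le)
      also have "\<dots> = 2 * (real k + 1) * \<delta>" by (simp add: algebra_simps)
      also have "\<dots> \<le> 2 * (real n + 1) * \<delta>"
        using k \<open>0 < \<delta>\<close> by (intro mult_right_mono) auto
      finally show "norm (Y.axle k s - Y.axle k c) \<le> 1 / 8"
        using X_fixed(1)[OF s] same_c \<delta>n by simp
      show "norm (heading k (y s) - heading k (y c)) \<le> 1 / 8"
        using cl(2)[OF s, of k] X_fixed(2)[OF s] \<delta> by (simp add: yc)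
      show "norm (heading (Suc k) (y s) - F) \<le> 1 / 4"
        using cl(2)[OF s, of "Suc k"] near[OF s] \<delta>
          norm_triangle_ineq[of "heading (Suc k) (y s) - heading (Suc k) (x s)" "heading (Suc k) (x s) - F"]
        by simp
      have "heading k (velocity c d x s) = 0"
        using velocity_complex(2)[OF \<open>c < d\<close> x s k(1)] rest_k[OF s] by simp
      then have "norm (heading k (velocity c d y s)) < 2 * \<delta>"
        using cl(3)[OF s, of k] by simp
      moreover have "\<bar>?wy k s\<bar> \<le> norm (cnj (heading k (y s)) * heading k (velocity c d y s))"
        unfolding turning_rate_def by (rule abs_Im_le_cmod)
      ultimately have "\<bar>?wy k s\<bar> < 2 * \<delta>"
        using norm_heading[OF space_y[OF s] k(1)] by (simp add: norm_mult)
      then show "2 * \<bar>?wy k s\<bar> < \<bar>?wy (Suc k) s\<bar>"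
        using wy(1)[OF s] m(1) m(2)[OF s] \<delta> by linarith
    qed
    define \<sigma> where "\<sigma> = sgn (?wx (Suc k) c)"
    have \<sigma>x: "sgn (?wx (Suc k) t) = \<sigma>" if "t \<in> ?J" for t
      unfolding \<sigma>_def using that J turning k by (intro continuous_on_sgn_constant[OF X.cont_w]) auto
    have pos: "0 < \<sigma> * ?wx (Suc k) t" "0 < \<sigma> * ?wy (Suc k) t" if "t \<in> ?J" for t
    proof -
      have "?wx (Suc k) t \<noteq> 0" using turning[OF that] .
      moreover have "\<bar>?wy (Suc k) t\<bar> \<noteq> 0" using wy(1)[OF that] \<open>?wx (Suc k) t \<noteq> 0\<close> by linarith
      ultimately show "0 < \<sigma> * ?wx (Suc k) t" "0 < \<sigma> * ?wy (Suc k) t"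
        using abs_sgn[of "?wx (Suc k) t"] abs_sgn[of "?wy (Suc k) t"] \<sigma>x[OF that] wy(2)[OF that]
        by (metis mult.commute zero_less_abs_iff, metis abs_0 mult.commute zero_less_abs_iff)
    qed
    have "\<sigma> \<noteq> 0" using pos(1)[OF J(1)] by auto
    define u :: "(real \<Rightarrow> coord \<Rightarrow> real) \<Rightarrow> real \<Rightarrow> real" where "u = (\<lambda>z t. \<sigma> * Im (Ln (heading (Suc k) (z t) * cnj F)))"
    have du: "(u x has_real_derivative \<sigma> * ?wx (Suc k) t) (at t within ?J)"
      "(u y has_real_derivative \<sigma> * ?wy (Suc k) t) (at t within ?J)" if t: "t \<in> ?J" for t
    proof -
      have "norm (heading (Suc k) (x t) - F) < 1" using near[OF t] by simp
      moreover have "norm (heading (Suc k) (y t) - F) < 1"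
        using cl(2)[OF t, of "Suc k"] near[OF t] \<delta>
          norm_triangle_ineq[of "heading (Suc k) (y t) - heading (Suc k) (x t)" "heading (Suc k) (x t) - F"]
        by simp
      ultimately show "(u x has_real_derivative \<sigma> * ?wx (Suc k) t) (at t within ?J)"
        "(u y has_real_derivative \<sigma> * ?wy (Suc k) t) (at t within ?J)"
        unfolding u_def using k t F by (intro DERIV_cmult X.angle_deriv Y.angle_deriv; simp)+
    qed
    have cont: "continuous_on ?J (\<lambda>t. \<sigma> * ?wx (Suc k) t)" "continuous_on ?J (\<lambda>t. \<sigma> * ?wy (Suc k) t)"
      by (intro continuous_intros X.cont_w Y.cont_w k)+
    have ends: "u x c = u y c" "u x d = u y d" by (simp_all add: u_def yc yd)
    obtain \<phi> \<phi>' where \<phi>: "\<phi> c = c" "\<phi> d = d"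
      "\<forall>t\<in>?J. (\<phi> has_real_derivative \<phi>' t) (at t within ?J) \<and> \<phi>' t > 0" "continuous_on ?J \<phi>'"
      "\<forall>t\<in>?J. \<phi> t \<in> ?J \<and> u x (\<phi> t) = u y t"
      using reparametrization_of_increasing[OF \<open>c < d\<close> du pos cont ends] by blast
    have "y t = x (\<phi> t)" if t: "t \<in> ?J" for t
    proof (rule config_eqI)
      have \<phi>t: "\<phi> t \<in> ?J" and angle: "u x (\<phi> t) = u y t" using \<phi>(5) t by auto
      show "position (y t) = position (x (\<phi> t))"
        using X.at_rest_below(1)[OF k(2) rest \<phi>t J(1)] Y.at_rest_below(1)[OF k(2) rest_y t J(1)] yc by simp
      have lead: "heading (Suc k) (y t) = heading (Suc k) (x (\<phi> t))"
        using X.heading_from_angle[OF k(2) \<phi>t F] Y.heading_from_angle[OF k(2) t F] angle \<open>\<sigma> \<noteq> 0\<close>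
        by (simp add: u_def)
      fix j
      consider "j < Suc k" | "j = Suc k" | "Suc k < j" "j \<le> n" | "n < j" by linarith
      then show "heading j (y t) = heading j (x (\<phi> t))"
      proof cases
        case 1
        then show ?thesis
          using X.at_rest_below(2)[OF k(2) rest \<phi>t J(1)] Y.at_rest_below(2)[OF k(2) rest_y t J(1)] yc by simp
      next
        case 2
        then show ?thesis using lead by simp
      next
        case 3
        have "Suc k < n" using 3 by simp
        have move_x: "axle_speed c d x (Suc (Suc k)) s \<noteq> 0" if "s \<in> ?J" for s
          using X.turning_le_speed[OF \<open>Suc k < n\<close> that] turning[OF that] by auto
        have move_y: "axle_speed c d y (Suc (Suc k)) s \<noteq> 0" if "s \<in> ?J" for s
          using Y.turning_le_speed[OF \<open>Suc k < n\<close> that] pos(2)[OF that] by auto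
        have j: "Suc k \<le> j" using 3 by simp
        obtain K where K: "\<And>s. s \<in> ?J \<Longrightarrow> heading j (x s) = K * heading (Suc k) (x s)"
          using X.rigid_body[OF \<open>Suc k < n\<close> rest move_x j 3(2)] by blast
        obtain L where L: "\<And>s. s \<in> ?J \<Longrightarrow> heading j (y s) = L * heading (Suc k) (y s)"
          using Y.rigid_body[OF \<open>Suc k < n\<close> rest_y move_y j 3(2)] by blast
        have "K = L"
          using K[OF J(1)] L[OF J(1)] X.E_nonzero[OF k(2) J(1)] yc by simp
        then show ?thesis using K[OF \<phi>t] L[OF t] lead by simp
      next
        case 4
        then show ?thesis using heading_beyond space_x[OF \<phi>t] space_y[OF t] by simp
      qed
    qed
    then show ?thesis unfolding reparametrization_def using \<phi> by blast
  qed
  then show ?thesis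
    unfolding trailer_rigid_iff[OF \<open>c < d\<close> x] using \<open>0 < \<delta>\<close> by blast
qed

lemma heading_velocity_beyond:
  assumes "trailer_curve n c d x" "t \<in> {c..d}" "n < k"
  shows "heading k (velocity c d x t) = 0"
proof -
  have "velocity c d x t \<in> trailer_distribution n (x t)" using assms by (simp add: integral_curve_def)
  then show ?thesis using assms(3) unfolding trailer_distribution_iff by auto
qed

lemma velocity_zero_if_stopped:
  assumes "c < d" and x: "trailer_curve n c d x"
    and t: "t \<in> {c..d}" and "axle_speed c d x n t = 0" "turning_rate c d x n t = 0"
  shows "velocity c d x t = (\<lambda>i. 0)"
proof (rule config_eqI)
  interpret X: trailer_motion n c d "\<lambda>t. position (x t)" "\<lambda>k t. heading k (x t)"
    "axle_speed c d x" "turning_rate c d x"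
    by (rule integral_curve_motion[OF \<open>c < d\<close> x])
  have vel: "axle_speed c d x j t = 0" "turning_rate c d x j t = 0" if "j \<le> n" for j
    using X.speed_zero_below[OF assms(4), of j] assms(4,5) that t by (cases "j = n"; force)+
  show "position (velocity c d x t) = position (\<lambda>i. 0)"
    using velocity_complex(1)[OF \<open>c < d\<close> x t] vel(1)[of 0] by (simp add: position_def complex_eq_iff)
  have "heading j (velocity c d x t) = 0" for j
  proof (cases "j \<le> n")
    case True
    then show ?thesis
      using velocity_complex(2)[OF \<open>c < d\<close> x t] vel(2)[of j] by simp
  next
    case False
    then show ?thesis using heading_velocity_beyond[OF x t] by simp
  qed
  then show "heading j (velocity c d x t) = heading j (\<lambda>i. 0)" for j
    by (simp add: heading_def complex_eq_iff)
qed

text \<open>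
  At \<open>t0\<close> let \<open>k0\<close> be the foremost axle at rest.  Its heading must turn, since the next axle moves or,
  for \<open>k0 = n\<close>, since the velocity is not zero.  So \<open>\<bar>v k0\<bar> < \<bar>w k0\<bar>\<close> near \<open>t0\<close>, and the axle stays at rest there.
\<close>

lemma locally_rigid_if_axle_1_at_rest:
  assumes "a < b" and x: "trailer_curve n a b x"
    and imm: "immersed a b x" and "1 \<le> n"
    and rest: "\<And>t. t \<in> {a..b} \<Longrightarrow> axle_speed a b x 1 t = 0"
  shows "locally_rigid (trailer_space n) (trailer_distribution n) a b x"
  unfolding locally_rigid_def
proof
  let ?v = "axle_speed a b x" and ?w = "turning_rate a b x"
  interpret X: trailer_motion n a b "\<lambda>t. position (x t)" "\<lambda>k t. heading k (x t)" ?v ?w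
    by (rule integral_curve_motion[OF \<open>a < b\<close> x])
  fix t0 assume t0: "t0 \<in> {a..b}"
  define k0 where "k0 = Max {k. k \<le> n \<and> ?v k t0 = 0}"
  have fin: "finite {k. k \<le> n \<and> ?v k t0 = 0}" by simp
  have mem: "1 \<in> {k. k \<le> n \<and> ?v k t0 = 0}" using \<open>1 \<le> n\<close> rest[OF t0] by simp
  have k0: "k0 \<le> n" "?v k0 t0 = 0" using Max_in[OF fin] mem unfolding k0_def by blast+
  have "1 \<le> k0" unfolding k0_def by (rule Max_ge[OF fin mem])
  have above: "?v k t0 \<noteq> 0" if "k0 < k" "k \<le> n" for k
  proof
    assume "?v k t0 = 0"
    then have "k \<in> {k. k \<le> n \<and> ?v k t0 = 0}" using \<open>k \<le> n\<close> by blast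
    from Max_ge[OF fin this] show False using \<open>k0 < k\<close> unfolding k0_def by linarith
  qed
  have w0: "?w k0 t0 \<noteq> 0"
  proof (cases "k0 = n")
    case True
    then show ?thesis
      using velocity_zero_if_stopped[OF \<open>a < b\<close> x t0] k0 imm t0 by (auto simp: immersed_def)
  next
    case False
    then show ?thesis
      using X.speed_pythagoras[of k0 t0] k0 t0 above[of "Suc k0"] by auto
  qed
  obtain k where k: "k0 = Suc k" "k < n" using \<open>1 \<le> k0\<close> k0 by (cases k0) auto
  have "continuous_on {a..b} (\<lambda>t. \<bar>?w k0 t\<bar> - \<bar>?v k0 t\<bar>)"
    by (intro continuous_intros X.cont_v X.cont_w k0)
  then obtain \<epsilon>1 where \<epsilon>1: "0 < \<epsilon>1" "\<And>t. t \<in> {a..b} \<Longrightarrow> \<bar>t - t0\<bar> < \<epsilon>1 \<Longrightarrow>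
      \<bar>(\<bar>?w k0 t\<bar> - \<bar>?v k0 t\<bar>) - (\<bar>?w k0 t0\<bar> - \<bar>?v k0 t0\<bar>)\<bar> < \<bar>?w k0 t0\<bar>"
    unfolding continuous_on_iff dist_real_def using t0 w0 by (meson zero_less_abs_iff)
  obtain \<epsilon>2 where \<epsilon>2: "0 < \<epsilon>2" "\<And>t. t \<in> {a..b} \<Longrightarrow> \<bar>t - t0\<bar> < \<epsilon>2 \<Longrightarrow>
      norm (heading k0 (x t) - heading k0 (x t0)) < 1 / 8"
    using X.continuous_E[OF k0(1)] t0 unfolding continuous_on_iff dist_norm real_norm_def
    by (meson zero_less_divide_1_iff zero_less_numeral)
  define \<epsilon> where "\<epsilon> = min \<epsilon>1 \<epsilon>2 / 2"
  define c where "c = max a (t0 - \<epsilon>)"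
  define d where "d = min b (t0 + \<epsilon>)"
  have "0 < \<epsilon>" "\<epsilon> < \<epsilon>1" "\<epsilon> < \<epsilon>2" using \<epsilon>1(1) \<epsilon>2(1) by (auto simp: \<epsilon>_def)
  then have cd: "a \<le> c" "c < d" "d \<le> b" and sub: "\<And>t. t \<in> {c..d} \<Longrightarrow> t \<in> {a..b} \<and> \<bar>t - t0\<bar> \<le> \<epsilon>"
    using t0 \<open>a < b\<close> by (auto simp: c_def d_def)
  interpret Z: trailer_motion n c d "\<lambda>t. position (x t)" "\<lambda>k t. heading k (x t)" ?v ?w
    by (rule X.restrict[OF cd])
  note xcd = integral_curve_subinterval[OF x cd]
  have same: "axle_speed c d x j t = ?v j t" "turning_rate c d x j t = ?w j t" if "t \<in> {c..d}" for j t
    using xcd(2)[OF that] by (simp_all add: axle_speed_def turning_rate_def)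
  have fast: "\<bar>?v k0 t\<bar> < \<bar>?w k0 t\<bar>" if "t \<in> {c..d}" for t
    using \<epsilon>1(2)[of t] sub[OF that] \<open>\<epsilon> < \<epsilon>1\<close> k0(2) by auto
  have rest0: "?v 0 t = 0" if "t \<in> {c..d}" for t
    using X.speed_zero_below[OF rest, of t 0] sub[OF that] \<open>1 \<le> n\<close> by auto
  have "?v k0 t = 0" if "t \<in> {c..d}" for t
    by (rule Z.stays_at_rest[OF k0(1) rest0 fast that])
  then have "rigid_motion n c d x"
  proof (intro rigid_if_axle_at_rest[OF cd(2) k(2) xcd(1), where F = "heading k0 (x t0)"])
    show "norm (heading k0 (x t0)) = 1" by (rule X.norm_E[OF k0(1) t0])
    show "turning_rate c d x (Suc k) t \<noteq> 0" if "t \<in> {c..d}" for t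
      using fast[OF that] same(2)[OF that] k by auto
    show "norm (heading (Suc k) (x t) - heading k0 (x t0)) \<le> 1 / 8" if "t \<in> {c..d}" for t
      using \<epsilon>2(2)[of t] sub[OF that] \<open>\<epsilon> < \<epsilon>2\<close> k by auto
  qed (use same k in auto)
  then show "\<exists>\<epsilon>>0. rigid_motion n (max a (t0 - \<epsilon>)) (min b (t0 + \<epsilon>)) x"
    using \<open>0 < \<epsilon>\<close> unfolding c_def d_def by blast
qed

section \<open>Deformation families\<close>

lemma positive_part_power_deriv:
  fixes x :: real
  shows "((\<lambda>x. max 0 x ^ Suc (Suc L)) has_real_derivative real (Suc (Suc L)) * max 0 x ^ Suc L) (at x)"
proof (cases x "0::real" rule: linorder_cases)
  case less
  have "((\<lambda>x. 0) has_real_derivative 0) (at x)" by simp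
  then have "((\<lambda>x. max 0 x ^ Suc (Suc L)) has_real_derivative 0) (at x)"
    by (rule has_field_derivative_transform_within[where d = "- x"])
       (use less in \<open>auto simp: dist_real_def max_def\<close>)
  then show ?thesis using less by (simp add: max_absorb1)
next
  case greater
  have "((\<lambda>x. x ^ Suc (Suc L)) has_real_derivative real (Suc (Suc L)) * x ^ Suc L) (at x)"
    using DERIV_pow[of "Suc (Suc L)" x] by simp
  then have "((\<lambda>x. max 0 x ^ Suc (Suc L)) has_real_derivative real (Suc (Suc L)) * x ^ Suc L) (at x)"
    by (rule has_field_derivative_transform_within[where d = x])
       (use greater in \<open>auto simp: dist_real_def max_def\<close>)
  then show ?thesis using greater by (simp add: max_absorb2)
next
  case equal
  have "((\<lambda>x. max 0 x ^ Suc L) \<longlongrightarrow> max 0 0 ^ Suc L) (at (0::real))"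
    by (intro tendsto_intros)
  then have "((\<lambda>x::real. max 0 x ^ Suc L) \<longlongrightarrow> 0) (at 0)" by simp
  moreover have "max 0 x ^ Suc L = (max 0 x ^ Suc (Suc L) - max 0 0 ^ Suc (Suc L)) / (x - 0)" if "x \<noteq> 0" for x :: real
    using that by (simp add: max_def)
  then have "\<forall>\<^sub>F x in at (0::real). max 0 x ^ Suc L = (max 0 x ^ Suc (Suc L) - max 0 0 ^ Suc (Suc L)) / (x - 0)"
    by (simp add: eventually_at_filter)
  ultimately have "((\<lambda>x::real. (max 0 x ^ Suc (Suc L) - max 0 0 ^ Suc (Suc L)) / (x - 0)) \<longlongrightarrow> 0) (at 0)"
    by (rule Lim_transform_eventually)
  then show ?thesis using equal by (simp add: has_field_derivative_iff)
qed

text \<open>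
  Time is measured by the parameter \<open>\<integral> u dt\<close>.  In a family \<open>f t e\<close> the number \<open>e\<close> is the amplitude of a
  deformation, which leaves the motion unchanged for \<open>e = 0\<close> and for times in \<open>Z\<close>.
\<close>

locale speed_interval =
  fixes p q :: real and Z :: "real set" and u :: "real \<Rightarrow> real"
  assumes p_less_q: "p < q" and Z_sub: "Z \<subseteq> {p..q}"
    and cont_u: "continuous_on {p..q} u" and u_nonzero: "\<And>t. t \<in> {p..q} \<Longrightarrow> u t \<noteq> 0"
begin

definition continuous_family :: "real \<Rightarrow> (real \<Rightarrow> real \<Rightarrow> complex) \<Rightarrow> bool" where
  "continuous_family r f \<longleftrightarrow> continuous_on ({p..q} \<times> {0..r}) (\<lambda>z. f (fst z) (snd z)) \<and>
     (\<forall>t\<in>Z. \<forall>e\<in>{0..r}. f t e = f t 0)"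

definition has_rate :: "real \<Rightarrow> (real \<Rightarrow> real \<Rightarrow> complex) \<Rightarrow> (real \<Rightarrow> real \<Rightarrow> complex) \<Rightarrow> bool" where
  "has_rate r f g \<longleftrightarrow> (\<forall>e\<in>{0..r}. \<forall>t\<in>{p..q}.
     ((\<lambda>s. f s e) has_vector_derivative of_real (u t) * g t e) (at t within {p..q}))"

text \<open>
  The family is \<open>m\<close> times continuously differentiable in the parameter \<open>\<integral> u dt\<close>, and all these derivatives
  are jointly continuous and do not depend on \<open>e\<close> at times in \<open>Z\<close>.  The latter makes a deformed piece
  fit together with the undeformed motion.
\<close>

primrec smooth :: "nat \<Rightarrow> real \<Rightarrow> (real \<Rightarrow> real \<Rightarrow> complex) \<Rightarrow> bool" where
  "smooth 0 r f \<longleftrightarrow> continuous_family r f"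
| "smooth (Suc m) r f \<longleftrightarrow> continuous_family r f \<and> (\<exists>g. smooth m r g \<and> has_rate r f g)"

lemma continuous_familyI:
  assumes "continuous_on ({p..q} \<times> {0..r}) (\<lambda>z. f (fst z) (snd z))"
    and "\<And>t e. t \<in> Z \<Longrightarrow> e \<in> {0..r} \<Longrightarrow> f t e = f t 0"
  shows "continuous_family r f"
  unfolding continuous_family_def using assms by blast

lemma continuous_family_continuous:
  "continuous_family r f \<Longrightarrow> continuous_on ({p..q} \<times> {0..r}) (\<lambda>z. f (fst z) (snd z))"
  unfolding continuous_family_def by blast

lemma continuous_family_frozen:
  "continuous_family r f \<Longrightarrow> t \<in> Z \<Longrightarrow> e \<in> {0..r} \<Longrightarrow> f t e = f t 0"
  unfolding continuous_family_def by blast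

lemma continuous_family_shrink:
  "continuous_family r f \<Longrightarrow> r' \<le> r \<Longrightarrow> continuous_family r' f"
  by (rule continuous_familyI)
     (rule continuous_on_subset[OF continuous_family_continuous], assumption, force,
      rule continuous_family_frozen, auto)

lemma continuous_family_const: "continuous_family r (\<lambda>t e. K)"
  by (rule continuous_familyI) simp_all

lemma continuous_family_add:
  assumes f: "continuous_family r f" and g: "continuous_family r g"
  shows "continuous_family r (\<lambda>t e. f t e + g t e)"
proof (rule continuous_familyI)
  show "f t e + g t e = f t 0 + g t 0" if "t \<in> Z" "e \<in> {0..r}" for t e
    using continuous_family_frozen[OF f that] continuous_family_frozen[OF g that] by simp
qed (intro continuous_on_add continuous_family_continuous f g)

lemma continuous_family_mult:
  assumes f: "continuous_family r f" and g: "continuous_family r g"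
  shows "continuous_family r (\<lambda>t e. f t e * g t e)"
proof (rule continuous_familyI)
  show "f t e * g t e = f t 0 * g t 0" if "t \<in> Z" "e \<in> {0..r}" for t e
    using continuous_family_frozen[OF f that] continuous_family_frozen[OF g that] by simp
qed (intro continuous_on_mult continuous_family_continuous f g)

lemma continuous_family_cnj:
  assumes f: "continuous_family r f"
  shows "continuous_family r (\<lambda>t e. cnj (f t e))"
proof (rule continuous_familyI)
  show "cnj (f t e) = cnj (f t 0)" if "t \<in> Z" "e \<in> {0..r}" for t e
    using continuous_family_frozen[OF f that] by simp
qed (intro continuous_on_cnj continuous_family_continuous f)

lemma continuous_family_inverse:
  assumes f: "continuous_family r f" and "\<And>t e. t \<in> {p..q} \<Longrightarrow> e \<in> {0..r} \<Longrightarrow> f t e \<noteq> 0"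
  shows "continuous_family r (\<lambda>t e. inverse (f t e))"
proof (rule continuous_familyI)
  show "inverse (f t e) = inverse (f t 0)" if "t \<in> Z" "e \<in> {0..r}" for t e
    using continuous_family_frozen[OF f that] by simp
  show "continuous_on ({p..q} \<times> {0..r}) (\<lambda>z. inverse (f (fst z) (snd z)))"
    using assms(2) by (intro continuous_on_inverse continuous_family_continuous f) auto
qed

lemma continuous_family_norm:
  assumes f: "continuous_family r f"
  shows "continuous_family r (\<lambda>t e. of_real (norm (f t e)))"
proof (rule continuous_familyI)
  show "complex_of_real (norm (f t e)) = of_real (norm (f t 0))" if "t \<in> Z" "e \<in> {0..r}" for t e
    using continuous_family_frozen[OF f that] by simp
qed (intro continuous_on_of_real continuous_on_norm continuous_family_continuous f)

lemma continuous_family_static: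
  assumes "continuous_on {p..q} f"
  shows "continuous_family r (\<lambda>t e. f t)"
proof (rule continuous_familyI)
  show "continuous_on ({p..q} \<times> {0..r}) (\<lambda>z. f (fst z))"
    by (rule continuous_on_compose2[OF assms continuous_on_fst[OF continuous_on_id]]) auto
qed simp

lemma continuous_family_amplitude_bump:
  assumes f: "continuous_family r (\<lambda>t e. of_real (f t))" and "\<And>t. t \<in> Z \<Longrightarrow> f t \<le> 0" "0 < K"
  shows "continuous_family r (\<lambda>t e. of_real (e * max 0 (f t) ^ K))"
proof (rule continuous_familyI)
  have "continuous_on ({p..q} \<times> {0..r}) (\<lambda>z. Re (of_real (f (fst z))))"
    by (rule continuous_on_Re[OF continuous_family_continuous[OF f]])
  then have "continuous_on ({p..q} \<times> {0..r}) (\<lambda>z. f (fst z))" by simp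
  then show "continuous_on ({p..q} \<times> {0..r}) (\<lambda>z. complex_of_real (snd z * max 0 (f (fst z)) ^ K))"
    by (intro continuous_on_of_real continuous_on_mult continuous_on_power continuous_on_max
        continuous_on_snd continuous_on_id continuous_on_const)
qed (use assms(2,3) in \<open>simp add: max_absorb1\<close>)

lemma smooth_continuous: "smooth m r f \<Longrightarrow> continuous_family r f"
  by (cases m) auto

lemma smooth_SucD: "smooth (Suc m) r f \<Longrightarrow> smooth m r f"
proof (induction m arbitrary: f)
  case (Suc m)
  then obtain g where "continuous_family r f" "smooth (Suc m) r g" "has_rate r f g" by auto
  then show ?case using Suc.IH[of g] by auto
qed simp

lemma smooth_mono: "smooth m' r f \<Longrightarrow> m \<le> m' \<Longrightarrow> smooth m r f"
  by (induction m' rule: nat_induct) (auto simp: le_Suc_eq dest: smooth_SucD simp del: smooth.simps)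

lemma smooth_shrink: "smooth m r f \<Longrightarrow> r' \<le> r \<Longrightarrow> smooth m r' f"
proof (induction m arbitrary: f)
  case (Suc m)
  then obtain g where "continuous_family r f" "smooth m r g" "has_rate r f g" by auto
  moreover from this have "has_rate r' f g"
    using Suc.prems unfolding has_rate_def by auto
  ultimately show ?case using Suc.IH[of g] Suc.prems continuous_family_shrink by auto
qed (simp add: continuous_family_shrink)

lemma smooth_const: "smooth m r (\<lambda>t e. K)"
proof (induction m arbitrary: K)
  case (Suc m)
  have "has_rate r (\<lambda>t e. K) (\<lambda>t e. 0)"
    by (simp add: has_rate_def)
  then show ?case using Suc[of 0] continuous_family_const by auto
qed (simp add: continuous_family_const)

lemma smooth_add: "smooth m r f \<Longrightarrow> smooth m r g \<Longrightarrow> smooth m r (\<lambda>t e. f t e + g t e)"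
proof (induction m arbitrary: f g)
  case 0
  then show ?case by (simp add: continuous_family_add)
next
  case (Suc m)
  then obtain f' g' where f': "smooth m r f'" "has_rate r f f'" and g': "smooth m r g'" "has_rate r g g'"
    by auto
  have "has_rate r (\<lambda>t e. f t e + g t e) (\<lambda>t e. f' t e + g' t e)"
    using f'(2) g'(2) unfolding has_rate_def
    by (simp add: distrib_left has_vector_derivative_add)
  moreover have "continuous_family r (\<lambda>t e. f t e + g t e)"
    by (intro continuous_family_add smooth_continuous[OF Suc.prems(1)] smooth_continuous[OF Suc.prems(2)])
  ultimately show ?case using Suc.IH[OF f'(1) g'(1)] by auto
qed

lemma smooth_mult: "smooth m r f \<Longrightarrow> smooth m r g \<Longrightarrow> smooth m r (\<lambda>t e. f t e * g t e)"
proof (induction m arbitrary: f g)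
  case 0
  then show ?case by (simp add: continuous_family_mult)
next
  case (Suc m)
  then obtain f' g' where f': "smooth m r f'" "has_rate r f f'" and g': "smooth m r g'" "has_rate r g g'"
    by auto
  have "has_rate r (\<lambda>t e. f t e * g t e) (\<lambda>t e. f t e * g' t e + f' t e * g t e)"
    unfolding has_rate_def
  proof (intro ballI)
    fix e t assume "e \<in> {0..r}" "t \<in> {p..q}"
    then have "((\<lambda>s. f s e * g s e) has_vector_derivative
      f t e * (of_real (u t) * g' t e) + (of_real (u t) * f' t e) * g t e) (at t within {p..q})"
      using f'(2) g'(2) unfolding has_rate_def by (intro has_vector_derivative_mult) auto
    then show "((\<lambda>s. f s e * g s e) has_vector_derivative
      of_real (u t) * (f t e * g' t e + f' t e * g t e)) (at t within {p..q})"
      by (simp add: algebra_simps)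
  qed
  moreover have "continuous_family r (\<lambda>t e. f t e * g t e)"
    by (intro continuous_family_mult smooth_continuous[OF Suc.prems(1)] smooth_continuous[OF Suc.prems(2)])
  moreover have "smooth m r (\<lambda>t e. f t e * g' t e + f' t e * g t e)"
    by (intro smooth_add Suc.IH smooth_SucD[OF Suc.prems(1)] smooth_SucD[OF Suc.prems(2)] f' g')
  ultimately show ?case by auto
qed

lemma smooth_sum: "(\<And>i. i \<in> I \<Longrightarrow> smooth m r (f i)) \<Longrightarrow> smooth m r (\<lambda>t e. \<Sum>i\<in>I. f i t e)"
  by (induction I rule: infinite_finite_induct) (auto intro: smooth_const smooth_add)

lemma smooth_cnj: "smooth m r f \<Longrightarrow> smooth m r (\<lambda>t e. cnj (f t e))"
proof (induction m arbitrary: f)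
  case (Suc m)
  then obtain f' where f': "smooth m r f'" "has_rate r f f'" by auto
  have "has_rate r (\<lambda>t e. cnj (f t e)) (\<lambda>t e. cnj (f' t e))"
    using f'(2) unfolding has_rate_def by (auto dest!: bspec intro: has_vector_derivative_eq_rhs[OF has_vector_derivative_cnj])
  moreover have "continuous_family r (\<lambda>t e. cnj (f t e))"
    by (intro continuous_family_cnj smooth_continuous[OF Suc.prems(1)])
  ultimately show ?case using Suc.IH[OF f'(1)] by auto
qed (simp add: continuous_family_cnj)

lemma smooth_Re: assumes "smooth m r f" shows "smooth m r (\<lambda>t e. of_real (Re (f t e)))"
proof -
  have "smooth m r (\<lambda>t e. (1 / 2) * (f t e + cnj (f t e)))"
    by (intro smooth_mult smooth_add smooth_cnj smooth_const assms)
  then show ?thesis by (simp add: complex_add_cnj)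
qed

lemma smooth_Im: assumes "smooth m r f" shows "smooth m r (\<lambda>t e. of_real (Im (f t e)))"
proof -
  have "smooth m r (\<lambda>t e. of_real (Re (- \<i> * f t e)))"
    by (intro smooth_Re smooth_mult smooth_const assms)
  then show ?thesis by simp
qed

lemma smooth_inverse:
  "smooth m r f \<Longrightarrow> (\<And>t e. t \<in> {p..q} \<Longrightarrow> e \<in> {0..r} \<Longrightarrow> f t e \<noteq> 0) \<Longrightarrow>
   smooth m r (\<lambda>t e. inverse (f t e))"
proof (induction m arbitrary: f)
  case 0
  then show ?case using continuous_family_inverse[of r f] by simp
next
  case (Suc m)
  then obtain f' where f': "smooth m r f'" "has_rate r f f'" by auto
  let ?g = "\<lambda>t e. (- 1) * f' t e * (inverse (f t e) * inverse (f t e))"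
  have "has_rate r (\<lambda>t e. inverse (f t e)) ?g"
    unfolding has_rate_def
  proof (intro ballI)
    fix e t assume te: "e \<in> {0..r}" "t \<in> {p..q}"
    have "((\<lambda>s. f s e) has_vector_derivative of_real (u t) * f' t e) (at t within {p..q})"
      using f'(2) te by (simp add: has_rate_def)
    from field_vector_diff_chain_within[OF this
        DERIV_inverse'[OF DERIV_ident, of "f t e" "(\<lambda>s. f s e) ` {p..q}"]]
    show "((\<lambda>s. inverse (f s e)) has_vector_derivative of_real (u t) * ?g t e) (at t within {p..q})"
      using Suc.prems(2)[OF te(2,1)] by (simp add: o_def algebra_simps)
  qed
  moreover have "continuous_family r (\<lambda>t e. inverse (f t e))"
    by (intro continuous_family_inverse smooth_continuous[OF Suc.prems(1)] Suc.prems(2))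
  moreover have "smooth m r ?g"
    by (intro smooth_mult smooth_const Suc.IH smooth_SucD[OF Suc.prems(1)] f' Suc.prems(2))
  ultimately show ?case by auto
qed

lemma smooth_norm:
  "smooth m r f \<Longrightarrow> (\<And>t e. t \<in> {p..q} \<Longrightarrow> e \<in> {0..r} \<Longrightarrow> f t e \<noteq> 0) \<Longrightarrow>
   smooth m r (\<lambda>t e. of_real (norm (f t e)))"
proof (induction m arbitrary: f)
  case 0
  then show ?case using continuous_family_norm[of r f] by simp
next
  case (Suc m)
  then obtain f' where f': "smooth m r f'" "has_rate r f f'" by auto
  let ?g = "\<lambda>t e. complex_of_real (Re (cnj (f t e) * f' t e)) * inverse (of_real (norm (f t e)))"
  have "has_rate r (\<lambda>t e. of_real (norm (f t e))) ?g"
    unfolding has_rate_def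
  proof (intro ballI)
    fix e t assume te: "e \<in> {0..r}" "t \<in> {p..q}"
    have nz: "f t e \<noteq> 0" using Suc.prems(2)[OF te(2,1)] .
    have "((\<lambda>s. f s e) has_derivative (\<lambda>h. h *\<^sub>R (of_real (u t) * f' t e))) (at t within {p..q})"
      using f'(2) te by (simp add: has_rate_def has_vector_derivative_def)
    from has_derivative_compose[OF this has_derivative_norm[OF nz]]
    have "((\<lambda>s. norm (f s e)) has_derivative (\<lambda>h. sgn (f t e) \<bullet> (h *\<^sub>R (of_real (u t) * f' t e)))) (at t within {p..q})"
      by (simp only: inner_commute)
    then have "((\<lambda>s. norm (f s e)) has_vector_derivative sgn (f t e) \<bullet> (of_real (u t) * f' t e)) (at t within {p..q})"
      by (simp add: has_vector_derivative_def)
    moreover have "sgn (f t e) \<bullet> (of_real (u t) * f' t e) = u t * (Re (cnj (f t e) * f' t e) * inverse (norm (f t e)))"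
      by (simp add: sgn_div_norm inner_complex_def algebra_simps)
    ultimately have "((\<lambda>s. complex_of_real (norm (f s e))) has_vector_derivative
        of_real (u t * (Re (cnj (f t e) * f' t e) * inverse (norm (f t e))))) (at t within {p..q})"
      by (intro has_vector_derivative_of_real) (simp add: has_real_derivative_iff_has_vector_derivative)
    then show "((\<lambda>s. complex_of_real (norm (f s e))) has_vector_derivative of_real (u t) * ?g t e) (at t within {p..q})"
      by (simp only: of_real_mult of_real_inverse)
  qed
  moreover have "continuous_family r (\<lambda>t e. of_real (norm (f t e)))"
    by (intro continuous_family_norm smooth_continuous[OF Suc.prems(1)])
  moreover have "smooth m r ?g"
    by (intro smooth_mult smooth_Re smooth_cnj smooth_inverse smooth_SucD[OF Suc.prems(1)] f' Suc.IH)
       (use Suc.prems(2) in auto)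
  ultimately show ?case by auto
qed

lemma smooth_sgn:
  assumes "smooth m r f" "\<And>t e. t \<in> {p..q} \<Longrightarrow> e \<in> {0..r} \<Longrightarrow> f t e \<noteq> 0"
  shows "smooth m r (\<lambda>t e. sgn (f t e))"
proof -
  have "smooth m r (\<lambda>t e. f t e * inverse (of_real (norm (f t e))))"
    using assms by (intro smooth_mult smooth_inverse smooth_norm) auto
  then show ?thesis by (simp add: sgn_eq divide_inverse)
qed

lemma smooth_static:
  assumes "continuous_on {p..q} f"
    and "\<And>t. t \<in> {p..q} \<Longrightarrow> (f has_vector_derivative of_real (u t) * g t) (at t within {p..q})"
    and "smooth m r (\<lambda>t e. g t)"
  shows "smooth (Suc m) r (\<lambda>t e. f t)"
proof -
  have "continuous_family r (\<lambda>t e. f t)" by (rule continuous_family_static[OF assms(1)])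
  moreover have "has_rate r (\<lambda>t e. f t) (\<lambda>t e. g t)" using assms(2) by (simp add: has_rate_def)
  ultimately show ?thesis using assms(3) by auto
qed

text \<open>
  The cut-off \<open>max 0 (f t) ^ K\<close> has \<open>K - 1\<close> continuous derivatives.  The factor \<open>e\<close> is included because
  it is by itself not constant at times in \<open>Z\<close>.
\<close>

lemma smooth_amplitude_bump:
  assumes "smooth m r (\<lambda>t e. of_real (f t))" "\<And>t. t \<in> Z \<Longrightarrow> f t \<le> 0" "m < K"
  shows "smooth m r (\<lambda>t e. of_real (e * max 0 (f t) ^ K))"
  using assms
proof (induction m arbitrary: K)
  case 0
  then show ?case by (simp only: smooth.simps) (rule continuous_family_amplitude_bump; simp)
next
  case (Suc m)
  obtain j where "K = Suc (Suc m + j)" using less_imp_Suc_add[OF Suc.prems(3)] by blast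
  then obtain L where K: "K = Suc (Suc L)" by simp
  obtain g where g: "smooth m r g" "has_rate r (\<lambda>t e. of_real (f t)) g"
    using Suc.prems(1) by auto
  let ?g = "\<lambda>t e. of_nat K * complex_of_real (Re (g t e)) * of_real (e * max 0 (f t) ^ Suc L)"
  have "has_rate r (\<lambda>t e. of_real (e * max 0 (f t) ^ K)) ?g"
    unfolding has_rate_def
  proof (intro ballI)
    fix e t assume te: "e \<in> {0..r}" "t \<in> {p..q}"
    have df: "(f has_real_derivative u t * Re (g t e)) (at t within {p..q})"
      using g(2) te by (auto simp: has_rate_def has_vector_derivative_complex_iff)
    have dm: "((\<lambda>x. max 0 x ^ K) has_real_derivative real K * max 0 x ^ Suc L) (at x)" for x :: real
      unfolding K by (rule positive_part_power_deriv)
    have "((\<lambda>s. e * max 0 (f s) ^ K) has_real_derivative e * (real K * max 0 (f t) ^ Suc L * (u t * Re (g t e)))) (at t within {p..q})"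
      by (intro DERIV_cmult DERIV_chain2[OF dm df])
    from has_vector_derivative_of_real[OF this]
    show "((\<lambda>s. complex_of_real (e * max 0 (f s) ^ K)) has_vector_derivative of_real (u t) * ?g t e) (at t within {p..q})"
      by (rule has_vector_derivative_eq_rhs) simp
  qed
  moreover have "smooth m r (\<lambda>t e. of_real (e * max 0 (f t) ^ Suc L))"
    using Suc.prems K by (intro Suc.IH smooth_SucD[OF Suc.prems(1)]) auto
  then have "smooth m r ?g"
    by (intro smooth_mult smooth_const smooth_Re g)
  moreover have "continuous_family r (\<lambda>t e. of_real (e * max 0 (f t) ^ K))"
    using Suc.prems K by (intro continuous_family_amplitude_bump) auto
  ultimately show ?case by auto
qed

lemma close_for_small_parameter:
  assumes "continuous_family r f" "0 < r" "0 < \<delta>"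
  obtains r' where "0 < r'" "r' \<le> r" "\<And>t e. t \<in> {p..q} \<Longrightarrow> e \<in> {0..r'} \<Longrightarrow> norm (f t e - f t 0) < \<delta>"
proof -
  have "uniformly_continuous_on ({p..q} \<times> {0..r}) (\<lambda>z. f (fst z) (snd z))"
    by (intro compact_uniformly_continuous compact_Times continuous_family_continuous assms(1)) auto
  then obtain \<rho> where \<rho>: "0 < \<rho>" "\<And>z z'. z \<in> {p..q} \<times> {0..r} \<Longrightarrow> z' \<in> {p..q} \<times> {0..r} \<Longrightarrow> dist z' z < \<rho> \<Longrightarrow>
      dist (f (fst z') (snd z')) (f (fst z) (snd z)) < \<delta>"
    using \<open>0 < \<delta>\<close> unfolding uniformly_continuous_on_def by blast
  show ?thesis
  proof (rule that[of "min r (\<rho> / 2)"])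
    fix t e assume "t \<in> {p..q}" "e \<in> {0..min r (\<rho> / 2)}"
    then show "norm (f t e - f t 0) < \<delta>"
      using \<rho>(2)[of "(t, 0)" "(t, e)"] \<rho>(1) by (simp add: dist_norm norm_prod_def dist_Pair_Pair)
  qed (use \<rho>(1) assms(2) in auto)
qed

text \<open>
  A heading is recovered from the path of its axle center as the normalized velocity, with a sign
  that tells forward from backward motion.  This costs one derivative and requires a nonzero
  velocity, which persists for small amplitudes by compactness.
\<close>

lemma next_heading:
  assumes Q: "smooth (Suc m) r Q" and "0 < r"
    and a: "continuous_on {p..q} a" "\<And>t. t \<in> {p..q} \<Longrightarrow> a t \<noteq> 0"
    and h: "\<And>t. t \<in> {p..q} \<Longrightarrow> norm (h t) = 1"
    and dQ0: "\<And>t. t \<in> {p..q} \<Longrightarrow> ((\<lambda>s. Q s 0) has_vector_derivative of_real (a t) * h t) (at t within {p..q})"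
  obtains r' F where "0 < r'" "r' \<le> r" "smooth m r' F"
    "\<And>t e. t \<in> {p..q} \<Longrightarrow> e \<in> {0..r'} \<Longrightarrow> norm (F t e) = 1"
    "\<And>t. t \<in> {p..q} \<Longrightarrow> F t 0 = h t"
    "\<And>t e. t \<in> {p..q} \<Longrightarrow> e \<in> {0..r'} \<Longrightarrow>
       \<exists>s. ((\<lambda>s. Q s e) has_vector_derivative of_real s * F t e) (at t within {p..q})"
proof -
  let ?J = "{p..q}"
  obtain W where W: "smooth m r W" "has_rate r Q W" using Q by auto
  have W0: "W t 0 = of_real (a t / u t) * h t" if "t \<in> ?J" for t
  proof -
    have "((\<lambda>s. Q s 0) has_vector_derivative of_real (u t) * W t 0) (at t within ?J)"
      using W(2) that \<open>0 < r\<close> by (simp add: has_rate_def)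
    then have "of_real (u t) * W t 0 = of_real (a t) * h t"
      using derivative_within_interval_unique[OF p_less_q that _ dQ0[OF that]] by blast
    then show ?thesis using u_nonzero[OF that] by (simp add: field_simps)
  qed
  have cont_au: "continuous_on ?J (\<lambda>t. a t / u t)"
    using u_nonzero by (intro continuous_intros a cont_u) auto
  have au: "a t / u t \<noteq> 0" if "t \<in> ?J" for t using a(2) u_nonzero that by simp
  have "\<exists>t0\<in>?J. \<forall>t\<in>?J. \<bar>a t0 / u t0\<bar> \<le> \<bar>a t / u t\<bar>"
    using p_less_q by (intro continuous_attains_inf continuous_intros cont_au) auto
  then obtain t0 where t0: "t0 \<in> ?J" "\<And>t. t \<in> ?J \<Longrightarrow> \<bar>a t0 / u t0\<bar> \<le> \<bar>a t / u t\<bar>" by blast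
  obtain r' where r': "0 < r'" "r' \<le> r"
    "\<And>t e. t \<in> ?J \<Longrightarrow> e \<in> {0..r'} \<Longrightarrow> norm (W t e - W t 0) < \<bar>a t0 / u t0\<bar>"
    using close_for_small_parameter[OF smooth_continuous[OF W(1)] \<open>0 < r\<close>] au[OF t0(1)]
    by (metis zero_less_abs_iff)
  have nz: "W t e \<noteq> 0" if "t \<in> ?J" "e \<in> {0..r'}" for t e
  proof
    assume "W t e = 0"
    then have "norm (W t 0) < \<bar>a t0 / u t0\<bar>" using r'(3)[OF that] by simp
    then show False using t0(2)[OF that(1)] h[OF that(1)] unfolding W0[OF that(1)] norm_mult norm_of_real by simp
  qed
  define \<sigma> where "\<sigma> = sgn (a p / u p)"
  have \<sigma>: "sgn (a t / u t) = \<sigma>" if "t \<in> ?J" for t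
    unfolding \<sigma>_def using that p_less_q au by (intro continuous_on_sgn_constant[OF cont_au]) auto
  have "a p / u p \<noteq> 0" using au[of p] p_less_q by simp
  then have \<sigma>2: "\<sigma> * \<sigma> = 1" "\<bar>\<sigma>\<bar> = 1" by (auto simp: \<sigma>_def sgn_if)
  define F where "F = (\<lambda>t e. of_real \<sigma> * sgn (W t e))"
  show ?thesis
  proof
    show "0 < r'" "r' \<le> r" by fact+
    show "smooth m r' F"
      unfolding F_def using nz r' by (intro smooth_mult smooth_const smooth_sgn smooth_shrink[OF W(1)]) auto
    show "norm (F t e) = 1" if "t \<in> ?J" "e \<in> {0..r'}" for t e
      using nz[OF that] \<sigma>2 by (simp add: F_def norm_mult norm_sgn)
    show "F t 0 = h t" if "t \<in> ?J" for t
    proof -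
      have "sgn (W t 0) = of_real (sgn (a t / u t)) * sgn (h t)"
        unfolding W0[OF that] by (simp only: sgn_mult sgn_of_real)
      also have "sgn (h t) = h t" using h[OF that] by (simp add: sgn_div_norm)
      finally have "F t 0 = of_real (\<sigma> * \<sigma>) * h t" by (simp only: F_def \<sigma>[OF that] of_real_mult mult.assoc)
      then show ?thesis using \<sigma>2 by simp
    qed
    show "\<exists>s. ((\<lambda>s. Q s e) has_vector_derivative of_real s * F t e) (at t within ?J)"
      if te: "t \<in> ?J" "e \<in> {0..r'}" for t e
    proof -
      have "W t e = of_real (norm (W t e)) * sgn (W t e)"
        using nz[OF te] by (simp add: sgn_div_norm scaleR_conv_of_real)
      also have "\<dots> = of_real (norm (W t e) * \<sigma>) * F t e"
        unfolding F_def using \<sigma>2 by (metis (no_types) mult.assoc mult.right_neutral of_real_1 of_real_mult)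
      finally have "of_real (u t) * W t e = of_real (u t * (norm (W t e) * \<sigma>)) * F t e"
        by (metis mult.assoc of_real_mult)
      moreover have "((\<lambda>s. Q s e) has_vector_derivative of_real (u t) * W t e) (at t within ?J)"
        using W(2) te r' by (simp add: has_rate_def)
      ultimately show ?thesis by (metis (no_types))
    qed
  qed
qed

lemma smooth_cong:
  assumes "\<And>t e. t \<in> {p..q} \<Longrightarrow> e \<in> {0..r} \<Longrightarrow> f t e = g t e" "0 \<le> r" "smooth m r f"
  shows "smooth m r g"
proof -
  have cf: "continuous_family r f" by (rule smooth_continuous[OF assms(3)])
  have "continuous_family r g"
  proof (rule continuous_familyI)
    show "continuous_on ({p..q} \<times> {0..r}) (\<lambda>z. g (fst z) (snd z))"
      by (rule continuous_on_eq[OF continuous_family_continuous[OF cf]]) (use assms(1) in auto)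
    show "g t e = g t 0" if "t \<in> Z" "e \<in> {0..r}" for t e
      using continuous_family_frozen[OF cf that] assms(1)[of t e] assms(1)[of t 0] that Z_sub \<open>0 \<le> r\<close> by auto
  qed
  moreover have "has_rate r g h" if "has_rate r f h" for h
    unfolding has_rate_def
  proof (intro ballI)
    fix e t assume te: "e \<in> {0..r}" "t \<in> {p..q}"
    show "((\<lambda>s. g s e) has_vector_derivative of_real (u t) * h t e) (at t within {p..q})"
    proof (rule has_vector_derivative_transform[OF te(2)])
      show "((\<lambda>s. f s e) has_vector_derivative of_real (u t) * h t e) (at t within {p..q})"
        using that te by (simp add: has_rate_def)
    qed (use assms(1) te in simp)
  qed
  ultimately show ?thesis using assms(3) by (cases m) auto
qed

text \<open>
  Starting from a deformation \<open>S\<close> of the path of axle \<open>k0\<close>, the headings \<open>k0, \<dots>, n\<close> are rebuilt one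
  after the other; each new heading gives the path of the next axle center.  Of the \<open>n + 2 - k0\<close>
  derivatives of \<open>S\<close>, one is left for the heading of the robot.
\<close>

lemma tower:
  assumes M: "trailer_motion n p q P E v w"
    and moving: "\<And>k t. k0 \<le> k \<Longrightarrow> k \<le> n \<Longrightarrow> t \<in> {p..q} \<Longrightarrow> v k t \<noteq> 0"
    and S: "smooth (n + 2 - k0) r S" "0 < r"
    and S0: "\<And>t. t \<in> {p..q} \<Longrightarrow> S t 0 = P t + (\<Sum>j<k0. E j t)"
    and "k0 + i \<le> Suc n"
  shows "\<exists>r' F. 0 < r' \<and> r' \<le> r \<and> (\<forall>j. k0 \<le> j \<and> j < k0 + i \<longrightarrow>
     smooth (n + 1 - j) r' (F j) \<and>
     (\<forall>t\<in>{p..q}. F j t 0 = E j t) \<and>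
     (\<forall>t\<in>{p..q}. \<forall>e\<in>{0..r'}. norm (F j t e) = 1 \<and>
        (\<exists>s. ((\<lambda>s. S s e + (\<Sum>l\<in>{k0..<j}. F l s e)) has_vector_derivative of_real s * F j t e) (at t within {p..q}))))"
  using \<open>k0 + i \<le> Suc n\<close>
proof (induction i)
  case 0
  then show ?case using S(2) by (intro exI[of _ r] exI[of _ "\<lambda>_ _ _. 0"]) auto
next
  case (Suc i)
  interpret M: trailer_motion n p q P E v w by (rule M)
  let ?k = "k0 + i" and ?J = "{p..q}"
  have k: "?k \<le> n" using Suc.prems by simp
  have "k0 + i \<le> Suc n" using Suc.prems by simp
  from Suc.IH[OF this] obtain r1 F where r1: "0 < r1" "r1 \<le> r" and F: "\<forall>j. k0 \<le> j \<and> j < ?k \<longrightarrow>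
     smooth (n + 1 - j) r1 (F j) \<and> (\<forall>t\<in>?J. F j t 0 = E j t) \<and>
     (\<forall>t\<in>?J. \<forall>e\<in>{0..r1}. norm (F j t e) = 1 \<and>
        (\<exists>s. ((\<lambda>s. S s e + (\<Sum>l\<in>{k0..<j}. F l s e)) has_vector_derivative of_real s * F j t e) (at t within ?J)))"
    by blast
  have sm: "smooth (n + 1 - j) r1 (F j)"
    and at0: "\<And>t. t \<in> ?J \<Longrightarrow> F j t 0 = E j t"
    and nrm: "\<And>t e. t \<in> ?J \<Longrightarrow> e \<in> {0..r1} \<Longrightarrow> norm (F j t e) = 1"
    and roll: "\<And>t e. t \<in> ?J \<Longrightarrow> e \<in> {0..r1} \<Longrightarrow>
      \<exists>s. ((\<lambda>s. S s e + (\<Sum>l\<in>{k0..<j}. F l s e)) has_vector_derivative of_real s * F j t e) (at t within ?J)"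
    if "k0 \<le> j" "j < ?k" for j
    using F that by blast+
  define Q where "Q = (\<lambda>t e. S t e + (\<Sum>l\<in>{k0..<?k}. F l t e))"
  have Q: "smooth (Suc (n + 1 - ?k)) r1 Q"
    unfolding Q_def
  proof (intro smooth_add smooth_sum)
    show "smooth (Suc (n + 1 - ?k)) r1 S"
      by (rule smooth_mono[OF smooth_shrink[OF S(1) r1(2)]]) (use k in simp)
    show "smooth (Suc (n + 1 - ?k)) r1 (F l)" if "l \<in> {k0..<?k}" for l
      by (rule smooth_mono[OF sm]) (use k that in auto)
  qed
  have Q0: "Q t 0 = M.axle ?k t" if "t \<in> ?J" for t
  proof -
    have "Q t 0 = P t + ((\<Sum>j<k0. E j t) + (\<Sum>l\<in>{k0..<?k}. E l t))"
      using at0 that by (simp add: Q_def S0[OF that] add.assoc)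
    also have "(\<Sum>j<k0. E j t) + (\<Sum>l\<in>{k0..<?k}. E l t) = (\<Sum>j<?k. E j t)"
      using sum.atLeastLessThan_concat[of 0 k0 ?k "\<lambda>j. E j t"] by (simp add: lessThan_atLeast0)
    finally show ?thesis by (simp add: M.axle_def)
  qed
  have dQ0: "((\<lambda>s. Q s 0) has_vector_derivative of_real (v ?k t) * E ?k t) (at t within ?J)" if "t \<in> ?J" for t
    by (rule has_vector_derivative_transform[OF that _ M.axle_deriv[OF k that]]) (rule Q0)
  obtain r2 G where r2: "0 < r2" "r2 \<le> r1" and G: "smooth (n + 1 - ?k) r2 G"
    and Gn: "\<And>t e. t \<in> ?J \<Longrightarrow> e \<in> {0..r2} \<Longrightarrow> norm (G t e) = 1"
    and G0: "\<And>t. t \<in> ?J \<Longrightarrow> G t 0 = E ?k t"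
    and Gr: "\<And>t e. t \<in> ?J \<Longrightarrow> e \<in> {0..r2} \<Longrightarrow>
       \<exists>s. ((\<lambda>s. Q s e) has_vector_derivative of_real s * G t e) (at t within ?J)"
    using next_heading[OF Q r1(1) M.cont_v[OF k] _ M.norm_E[OF k] dQ0] moving k by (metis le_add1)
  define F' where "F' = F(?k := G)"
  have F': "F' j = F j" if "j < ?k" for j using that by (simp add: F'_def)
  have F'k: "F' ?k = G" by (simp add: F'_def)
  have sum_F': "(\<Sum>l\<in>{k0..<j}. F' l s e) = (\<Sum>l\<in>{k0..<j}. F l s e)" if "j \<le> ?k" for j s e
    using that by (intro sum.cong) (auto simp: F')
  have "smooth (n + 1 - j) r2 (F' j) \<and> (\<forall>t\<in>?J. F' j t 0 = E j t) \<and>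
     (\<forall>t\<in>?J. \<forall>e\<in>{0..r2}. norm (F' j t e) = 1 \<and>
        (\<exists>s. ((\<lambda>s. S s e + (\<Sum>l\<in>{k0..<j}. F' l s e)) has_vector_derivative of_real s * F' j t e) (at t within ?J)))"
    if j: "k0 \<le> j" "j < k0 + Suc i" for j
  proof (cases "j = ?k")
    case True
    then show ?thesis using G Gn G0 Gr by (simp add: F'k sum_F' Q_def)
  next
    case False
    then have "j < ?k" using j by simp
    moreover have "e \<in> {0..r1}" if "e \<in> {0..r2}" for e using that r2 by auto
    ultimately show ?thesis
      using sm[OF j(1)] at0[OF j(1)] nrm[OF j(1)] roll[OF j(1)] smooth_shrink[OF _ r2(2)]
      by (simp add: F' sum_F')
  qed
  then show ?case using r1 r2 by (intro exI[of _ r2] exI[of _ F']) auto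
qed

text \<open>
  Measured by the arc length of the last axle, the heading \<open>k\<close> has one derivative more than the
  heading \<open>k + 1\<close>: its derivative is a rational function of the headings up to \<open>k + 1\<close>.  So the path of
  the last axle has exactly the derivatives that rebuilding the headings consumes.
\<close>

lemma smooth_motion:
  assumes M: "trailer_motion n p q P E v w" and u: "u = v 0" and "0 \<le> r"
  shows "k \<le> n \<Longrightarrow> k + m \<le> n + 1 \<Longrightarrow> smooth m r (\<lambda>t e. E k t)"
    and "smooth (n + 2) r (\<lambda>t e. P t)"
proof -
  interpret M: trailer_motion n p q P E v w by (rule M)
  let ?J = "{p..q}"
  have v: "v k t \<noteq> 0" if "k \<le> n" "t \<in> ?J" for k t
    using M.speed_nonzero_above[of 0 t k] u_nonzero[OF that(2)] that by (simp add: u)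
  have vR: "v k t = v (Suc k) t * Re (cnj (E k t) * E (Suc k) t)"
    and wR: "w k t = v (Suc k) t * Im (cnj (E k t) * E (Suc k) t)" if "k < n" "t \<in> ?J" for k t
    using arg_cong[OF M.hitch[OF that], of Re] arg_cong[OF M.hitch[OF that], of Im] by simp_all
  have ratio: "smooth m r (\<lambda>t e. of_real (v k t / u t))"
    if "k \<le> n" "\<And>l. l \<le> k \<Longrightarrow> smooth m r (\<lambda>t e. E l t)" for k m
    using that
  proof (induction k)
    case 0
    show ?case
      by (rule smooth_cong[OF _ \<open>0 \<le> r\<close> smooth_const[of m r 1]]) (simp add: u v)
  next
    case (Suc k)
    have nz: "Re (cnj (E k t) * E (Suc k) t) \<noteq> 0" if "t \<in> ?J" for t
      using vR[of k t] v[of k t] Suc.prems(1) that by auto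
    have "smooth m r (\<lambda>t e. of_real (v k t / u t) * inverse (of_real (Re (cnj (E k t) * E (Suc k) t))))"
    proof (intro smooth_mult smooth_inverse smooth_Re smooth_cnj)
      show "smooth m r (\<lambda>t e. of_real (v k t / u t))" using Suc by simp
      show "complex_of_real (Re (cnj (E k t) * E (Suc k) t)) \<noteq> 0" if "t \<in> ?J" for t
        using nz[OF that] by (simp only: of_real_eq_0_iff not_False_eq_True)
    qed (use Suc.prems in auto)
    then show ?case
    proof (rule smooth_cong[OF _ \<open>0 \<le> r\<close>, rotated])
      fix t assume t: "t \<in> ?J"
      have "v k t / u t * inverse (Re (cnj (E k t) * E (Suc k) t)) = v (Suc k) t / u t"
      proof -
        have cancel: "A / U * inverse C = B / U" if "A = B * C" "C \<noteq> 0" for A B C U :: real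
          using that by simp
        show ?thesis by (rule cancel[OF vR nz]) (use Suc.prems(1) t in auto)
      qed
      then show "complex_of_real (v k t / u t) * inverse (of_real (Re (cnj (E k t) * E (Suc k) t))) = of_real (v (Suc k) t / u t)"
        by (metis of_real_inverse of_real_mult)
    qed
  qed
  have E: "smooth m r (\<lambda>t e. E k t)" if "k \<le> n" "k + m \<le> n + 1" for k m
    using that
  proof (induction m arbitrary: k)
    case 0
    then show ?case by (simp add: continuous_family_static M.continuous_E)
  next
    case (Suc m)
    show ?case
    proof (rule smooth_static[OF M.continuous_E[OF Suc.prems(1)]])
      show "(E k has_vector_derivative of_real (u t) * (\<i> * of_real (w k t / u t) * E k t)) (at t within ?J)"
        if "t \<in> ?J" for t
        using M.E_deriv[OF Suc.prems(1) that] u_nonzero[OF that] by (simp add: field_simps)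
      show "smooth m r (\<lambda>t e. \<i> * of_real (w k t / u t) * E k t)"
      proof (cases "k = n")
        case True
        then have "m = 0" using Suc.prems by simp
        have "continuous_on ?J (\<lambda>t. \<i> * of_real (w k t / u t) * E k t)"
          using u_nonzero Suc.prems
          by (intro continuous_on_mult continuous_on_const continuous_on_of_real continuous_on_divide M.cont_w cont_u M.continuous_E) auto
        then show ?thesis using \<open>m = 0\<close> by (simp add: continuous_family_static)
      next
        case False
        then have "k < n" using Suc.prems by simp
        have "smooth m r (\<lambda>t e. of_real (Im (cnj (E k t) * E (Suc k) t)) * of_real (v (Suc k) t / u t))"
          using \<open>k < n\<close> Suc.prems
          by (intro smooth_mult smooth_Im smooth_cnj Suc.IH ratio) auto
        then have "smooth m r (\<lambda>t e. of_real (w k t / u t))"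
        proof (rule smooth_cong[OF _ \<open>0 \<le> r\<close>, rotated])
          fix t assume t: "t \<in> ?J"
          have "Im (cnj (E k t) * E (Suc k) t) * (v (Suc k) t / u t) = w k t / u t"
            unfolding wR[OF \<open>k < n\<close> t] by simp
          then show "complex_of_real (Im (cnj (E k t) * E (Suc k) t)) * of_real (v (Suc k) t / u t) = of_real (w k t / u t)"
            by (metis of_real_mult)
        qed
        then show ?thesis using Suc by (intro smooth_mult smooth_const) auto
      qed
    qed
  qed
  then show "k \<le> n \<Longrightarrow> k + m \<le> n + 1 \<Longrightarrow> smooth m r (\<lambda>t e. E k t)" by blast
  have "smooth (Suc (n + 1)) r (\<lambda>t e. P t)"
  proof (rule smooth_static)
    show "continuous_on ?J P" by (rule continuous_on_vector_derivative) (rule M.P_deriv)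
    show "(P has_vector_derivative of_real (u t) * E 0 t) (at t within ?J)" if "t \<in> ?J" for t
      using M.P_deriv[OF that] by (simp add: u)
    show "smooth (n + 1) r (\<lambda>t e. E 0 t)" by (rule E) auto
  qed
  then show "smooth (n + 2) r (\<lambda>t e. P t)" by simp
qed

end

locale bump_interval =
  fixes p p' q' q :: real and u :: "real \<Rightarrow> real"
  assumes order: "p < p'" "p' < q'" "q' < q"
    and cont: "continuous_on {p..q} u" and nonzero: "\<And>t. t \<in> {p..q} \<Longrightarrow> u t \<noteq> 0"
begin

sublocale speed_interval p q "{p..p'} \<union> {q'..q}" u
  by unfold_locales (use order cont nonzero in auto)

text \<open>
  The bump is a power of the quadratic polynomial \<open>(S - S p') (S q' - S)\<close> in the arc length \<open>S\<close>, cut off at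
  zero; being a function of the parameter, it is as smooth as the power admits.
\<close>

lemma bump:
  "\<exists>b b' b''. (\<forall>t\<in>{p..q}. 0 \<le> b t \<and>
       (b has_real_derivative u t * b' t) (at t within {p..q}) \<and>
       (b' has_real_derivative u t * b'' t) (at t within {p..q})) \<and>
     (\<forall>t\<in>{p'<..<q'}. 0 < b t) \<and>
     smooth m r (\<lambda>t e. of_real (e * b t)) \<and> smooth m r (\<lambda>t e. of_real (e * b' t))"
proof -
  let ?J = "{p..q}"
  define \<sigma> where "\<sigma> = sgn (u p)"
  have \<sigma>: "sgn (u t) = \<sigma>" if "t \<in> ?J" for t
    unfolding \<sigma>_def using that p_less_q u_nonzero by (intro continuous_on_sgn_constant[OF cont_u]) auto
  have "u p \<noteq> 0" using u_nonzero[of p] p_less_q by simp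
  then have \<sigma>2: "\<sigma> * \<sigma> = 1" by (auto simp: \<sigma>_def sgn_if)
  define S where "S = (\<lambda>t. integral {p..t} (\<lambda>s. \<bar>u s\<bar>))"
  have dS: "(S has_real_derivative \<bar>u t\<bar>) (at t within ?J)" if "t \<in> ?J" for t
    unfolding S_def by (rule integral_has_real_derivative[OF _ that]) (intro continuous_intros cont_u)
  have incS: "S s < S t" if "s \<in> ?J" "t \<in> ?J" "s < t" for s t
    by (rule increasing_on_interval[OF dS _ that]) (use u_nonzero in auto)
  have abs_u: "\<bar>u t\<bar> = u t * \<sigma>" if "t \<in> ?J" for t
    using \<sigma>[OF that] by (simp add: abs_sgn)
  have smS: "smooth j r (\<lambda>t e. of_real (S t))" for j
  proof -
    have "smooth (Suc j) r (\<lambda>t e. of_real (S t))"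
    proof (rule smooth_static[OF _ _ smooth_const[of j r "of_real \<sigma>"]])
      have "continuous_on ?J S" using dS by (rule DERIV_continuous_on)
      then show "continuous_on ?J (\<lambda>t. complex_of_real (S t))" by (rule continuous_on_of_real)
      show "((\<lambda>t. complex_of_real (S t)) has_vector_derivative of_real (u t) * of_real \<sigma>) (at t within ?J)"
        if "t \<in> ?J" for t
        using has_vector_derivative_of_real[OF dS[OF that]] by (simp add: abs_u[OF that])
    qed
    then show ?thesis by (rule smooth_SucD)
  qed
  define f where "f = (\<lambda>t. (S t - S p') * (S q' - S t))"
  define f' where "f' = (\<lambda>t. \<sigma> * (S p' + S q' - 2 * S t))"
  have df: "(f has_real_derivative u t * f' t) (at t within ?J)"
    and df': "(f' has_real_derivative u t * - 2) (at t within ?J)" if "t \<in> ?J" for t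
  proof -
    have "(f has_real_derivative (\<bar>u t\<bar> - 0) * (S q' - S t) + (0 - \<bar>u t\<bar>) * (S t - S p')) (at t within ?J)"
      unfolding f_def by (intro DERIV_mult DERIV_diff DERIV_const dS that)
    then show "(f has_real_derivative u t * f' t) (at t within ?J)"
      by (rule DERIV_cong) (simp add: abs_u[OF that] f'_def algebra_simps)
    have "(f' has_real_derivative \<sigma> * ((0 + 0) - 2 * \<bar>u t\<bar>)) (at t within ?J)"
      unfolding f'_def by (intro DERIV_cmult DERIV_diff DERIV_add DERIV_const dS that)
    moreover have "\<sigma> * ((0 + 0) - 2 * \<bar>u t\<bar>) = u t * - 2 * (\<sigma> * \<sigma>)"
      unfolding abs_u[OF that] by algebra
    ultimately show "(f' has_real_derivative u t * - 2) (at t within ?J)"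
      unfolding \<sigma>2 by (simp only: mult_1_right)
  qed
  have smf: "smooth j r (\<lambda>t e. of_real (f t))" and smf': "smooth j r (\<lambda>t e. of_real (f' t))" for j
  proof -
    have "smooth j r (\<lambda>t e. (of_real (S t) + of_real (- S p')) * (of_real (S q') + of_real (- 1) * of_real (S t)))"
      by (intro smooth_mult smooth_add smooth_const smS)
    then show "smooth j r (\<lambda>t e. of_real (f t))" by (simp add: f_def)
    have "smooth j r (\<lambda>t e. of_real \<sigma> * (of_real (S p' + S q') + of_real (- 2) * of_real (S t)))"
      by (intro smooth_mult smooth_add smooth_const smS)
    then show "smooth j r (\<lambda>t e. of_real (f' t))" by (simp add: f'_def)
  qed
  have J: "p' \<in> ?J" "q' \<in> ?J" using order by auto
  have le: "S s \<le> S t" if "s \<in> ?J" "t \<in> ?J" "s \<le> t" for s t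
    using incS[of s t] that by (cases "s = t") auto
  have f_out: "f t \<le> 0" if "t \<in> {p..p'} \<union> {q'..q}" for t
    using that
  proof
    assume "t \<in> {p..p'}"
    then have "S t \<le> S p'" "S t \<le> S q'" using J order by (auto intro!: le)
    then show ?thesis unfolding f_def by (simp add: mult_nonpos_nonneg)
  next
    assume "t \<in> {q'..q}"
    then have "S p' \<le> S t" "S q' \<le> S t" using J order by (auto intro!: le)
    then show ?thesis unfolding f_def by (simp add: mult_nonneg_nonpos)
  qed
  have f_in: "0 < f t" if "t \<in> {p'<..<q'}" for t
    using incS[OF J(1), of t] incS[OF _ J(2), of t] that order by (simp add: f_def)
  \<comment> \<open>The exponent \<open>m + 3\<close> leaves \<open>m\<close> continuous derivatives for \<open>b'\<close> as well.\<close>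
  define b where "b = (\<lambda>t. max 0 (f t) ^ Suc (Suc (Suc m)))"
  define b' where "b' = (\<lambda>t. real (Suc (Suc (Suc m))) * max 0 (f t) ^ Suc (Suc m) * f' t)"
  define b'' where "b'' = (\<lambda>t. real (Suc (Suc (Suc m))) * (real (Suc (Suc m)) * max 0 (f t) ^ Suc m * f' t) * f' t
    + real (Suc (Suc (Suc m))) * max 0 (f t) ^ Suc (Suc m) * - 2)"
  have db: "(b has_real_derivative u t * b' t) (at t within ?J)" if "t \<in> ?J" for t
    using DERIV_chain2[OF positive_part_power_deriv df[OF that], of "Suc m"]
    unfolding b_def b'_def by (rule DERIV_cong) simp
  have db': "(b' has_real_derivative u t * b'' t) (at t within ?J)" if "t \<in> ?J" for t
  proof -
    have "(b' has_real_derivative real (Suc (Suc (Suc m))) * (real (Suc (Suc m)) * max 0 (f t) ^ Suc m * (u t * f' t)) * f' t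
        + (u t * - 2) * (real (Suc (Suc (Suc m))) * max 0 (f t) ^ Suc (Suc m))) (at t within ?J)"
      unfolding b'_def
      by (intro DERIV_mult DERIV_cmult DERIV_chain2[OF positive_part_power_deriv df[OF that]] df' that)
    then show ?thesis unfolding b''_def by (rule DERIV_cong) (simp add: algebra_simps)
  qed
  have sb: "smooth m r (\<lambda>t e. of_real (e * max 0 (f t) ^ K))" if "m < K" for K
    by (rule smooth_amplitude_bump[OF smf f_out that])
  have "smooth m r (\<lambda>t e. of_real (e * b t))"
    unfolding b_def by (rule sb) simp
  moreover have "smooth m r (\<lambda>t e. of_real (e * b' t))"
  proof -
    have "smooth m r (\<lambda>t e. of_real (real (Suc (Suc (Suc m)))) * of_real (e * max 0 (f t) ^ Suc (Suc m)) * of_real (f' t))"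
      by (intro smooth_mult smooth_const sb smf') simp
    moreover have "(\<lambda>t e. complex_of_real (real (Suc (Suc (Suc m)))) * of_real (e * max 0 (f t) ^ Suc (Suc m)) * of_real (f' t))
        = (\<lambda>t e. of_real (e * b' t))"
      unfolding b'_def of_real_mult[symmetric] by (simp only: ac_simps)
    ultimately show ?thesis by simp
  qed
  moreover have "0 < b t" if "t \<in> {p'<..<q'}" for t using f_in[OF that] by (simp add: b_def)
  moreover have "0 \<le> b t" for t by (simp add: b_def)
  ultimately show ?thesis using db db' by blast
qed

lemma extend_by_zero:
  fixes D D' :: "real \<Rightarrow> complex"
  assumes D: "\<And>t. t \<in> {p..q} \<Longrightarrow> (D has_vector_derivative D' t) (at t within {p..q})"
    and cont_D': "continuous_on {p..q} D'"
    and zero: "\<And>t. t \<in> {p..p'} \<union> {q'..q} \<Longrightarrow> D t = 0 \<and> D' t = 0"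
  shows "((\<lambda>t. if t \<in> {p..q} then D t else 0) has_vector_derivative (if t \<in> {p..q} then D' t else 0)) (at t)"
    and "continuous_on UNIV (\<lambda>t. if t \<in> {p..q} then D' t else 0)"
proof -
  let ?D = "\<lambda>t. if t \<in> {p..q} then D t else 0" and ?D' = "\<lambda>t. if t \<in> {p..q} then D' t else 0"
  have out: "?D t = 0 \<and> ?D' t = 0" if "t \<in> {..<p'} \<union> {q'<..}" for t
    using that zero[of t] by auto
  show "(?D has_vector_derivative ?D' t) (at t)"
  proof (cases "t \<in> {p<..<q}")
    case True
    then have "at t within {p..q} = at t" by (intro at_within_interior) simp
    then have "(D has_vector_derivative D' t) (at t)" using D[of t] True by simp
    then have "(?D has_vector_derivative D' t) (at t)"
      by (rule has_vector_derivative_transform_within_open[OF _ open_greaterThanLessThan True]) auto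
    then show ?thesis using True by simp
  next
    case False
    then have t: "t \<in> {..<p'} \<union> {q'<..}" using order by auto
    have "((\<lambda>t. 0) has_vector_derivative 0) (at t)" by (rule has_vector_derivative_const)
    then have "(?D has_vector_derivative 0) (at t)"
      by (rule has_vector_derivative_transform_within_open[of _ _ _ "{..<p'} \<union> {q'<..}"]) (use t out in auto)
    then show ?thesis using out[OF t] by simp
  qed
  have "continuous_on ({p<..<q} \<union> ({..<p'} \<union> {q'<..})) ?D'"
  proof (rule continuous_on_open_Un)
    have "continuous_on {p<..<q} D'" by (rule continuous_on_subset[OF cont_D']) auto
    then show "continuous_on {p<..<q} ?D'" by (rule continuous_on_eq) auto
    show "continuous_on ({..<p'} \<union> {q'<..}) ?D'"
      by (rule continuous_on_eq[OF continuous_on_const[of _ 0]]) (use out in metis)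
  qed auto
  moreover have "{p<..<q} \<union> ({..<p'} \<union> {q'<..}) = UNIV" using order by auto
  ultimately show "continuous_on UNIV ?D'" by simp
qed

text \<open>
  The change of \<open>f\<close> at amplitude \<open>e\<close>, extended by zero to the whole line; being small in the
  \<open>C\<^sup>1\<close>-sense, it can be added to any motion that agrees with \<open>f\<close> at \<open>e = 0\<close>.
\<close>

definition increment ::
  "real \<Rightarrow> (real \<Rightarrow> real \<Rightarrow> complex) \<Rightarrow> real \<Rightarrow> (real \<Rightarrow> complex) \<Rightarrow> (real \<Rightarrow> complex) \<Rightarrow> bool" where
  "increment \<delta> f e D D' \<longleftrightarrow> (\<forall>t. (D has_vector_derivative D' t) (at t)) \<and>
    continuous_on UNIV D' \<and> (\<forall>t. norm (D t) < \<delta> \<and> norm (D' t) < \<delta> \<and>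
      D t = (if t \<in> {p..q} then f t e - f t 0 else 0) \<and> (t \<notin> {p..q} \<longrightarrow> D' t = 0))"

lemma small_increment:
  assumes f: "smooth 1 r f" and "0 < r" "0 < \<delta>"
  shows "\<exists>r'. 0 < r' \<and> r' \<le> r \<and> (\<forall>e\<in>{0..r'}. \<exists>D D'. increment \<delta> f e D D')"
proof -
  let ?J = "{p..q}" and ?Z = "{p..p'} \<union> {q'..q}"
  obtain g where g: "continuous_family r g" "has_rate r f g" using f by auto
  have cf: "continuous_family r f" by (rule smooth_continuous[OF f])
  have "\<exists>t0\<in>?J. \<forall>t\<in>?J. \<bar>u t\<bar> \<le> \<bar>u t0\<bar>"
    using p_less_q by (intro continuous_attains_sup continuous_intros cont_u) auto
  then obtain B where B: "\<And>t. t \<in> ?J \<Longrightarrow> \<bar>u t\<bar> \<le> B" by blast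
  have "0 \<le> B" using B[of p] p_less_q by force
  obtain r1 where r1: "0 < r1" "r1 \<le> r" "\<And>t e. t \<in> ?J \<Longrightarrow> e \<in> {0..r1} \<Longrightarrow> norm (f t e - f t 0) < \<delta>"
    using close_for_small_parameter[OF cf assms(2,3)] by blast
  have "0 < \<delta> / (B + 1)" using \<open>0 \<le> B\<close> \<open>0 < \<delta>\<close> by simp
  then obtain r2 where r2: "0 < r2" "r2 \<le> r"
    "\<And>t e. t \<in> ?J \<Longrightarrow> e \<in> {0..r2} \<Longrightarrow> norm (g t e - g t 0) < \<delta> / (B + 1)"
    using close_for_small_parameter[OF g(1) assms(2)] by blast
  have "\<exists>D D'. increment \<delta> f e D D'"
    if e: "e \<in> {0..min r1 r2}" for e
  proof -
    have er: "e \<in> {0..r}" "e \<in> {0..r1}" "e \<in> {0..r2}" "0 \<in> {0..r}" using e r1 r2 by auto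
    define D where "D = (\<lambda>t. f t e - f t 0)"
    define D' where "D' = (\<lambda>t. of_real (u t) * (g t e - g t 0))"
    have dD: "(D has_vector_derivative D' t) (at t within ?J)" if "t \<in> ?J" for t
    proof -
      have "(D has_vector_derivative of_real (u t) * g t e - of_real (u t) * g t 0) (at t within ?J)"
        unfolding D_def using g(2) er that unfolding has_rate_def
        by (intro has_vector_derivative_diff) auto
      then show ?thesis by (simp add: D'_def algebra_simps)
    qed
    have slice: "continuous_on ?J (\<lambda>t. g t s)" if "s \<in> {0..r}" for s
    proof -
      have "continuous_on ?J (\<lambda>t. g (fst (t, s)) (snd (t, s)))"
        by (rule continuous_on_compose2[OF continuous_family_continuous[OF g(1)]])
           (use that in \<open>auto intro!: continuous_intros\<close>)
      then show ?thesis by simp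
    qed
    have cD': "continuous_on ?J D'"
      unfolding D'_def by (intro continuous_on_mult continuous_on_diff continuous_on_of_real cont_u slice er)
    have zero: "D t = 0 \<and> D' t = 0" if "t \<in> ?Z" for t
      using continuous_family_frozen[OF cf that er(1)] continuous_family_frozen[OF g(1) that er(1)]
      by (simp add: D_def D'_def)
    have small: "norm (D' t) < \<delta>" if t: "t \<in> ?J" for t
    proof -
      have "norm (D' t) \<le> B * norm (g t e - g t 0)"
        unfolding D'_def norm_mult norm_of_real using B[OF t] by (intro mult_right_mono) auto
      also have "\<dots> \<le> B * (\<delta> / (B + 1))"
        using r2(3)[OF t er(3)] \<open>0 \<le> B\<close> by (intro mult_left_mono) auto
      also have "\<dots> < \<delta>" using \<open>0 \<le> B\<close> \<open>0 < \<delta>\<close> by (simp add: field_simps)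
      finally show ?thesis .
    qed
    show ?thesis
      unfolding increment_def using extend_by_zero[OF dD cD' zero] small r1(3) er \<open>0 < \<delta>\<close>
      by (intro exI[of _ "\<lambda>t. if t \<in> ?J then D t else 0"] exI[of _ "\<lambda>t. if t \<in> ?J then D' t else 0"])
         (auto simp: D_def)
  qed
  then show ?thesis using r1 r2 by (intro exI[of _ "min r1 r2"]) auto
qed

end

section \<open>All other motions can be deformed\<close>

lemma C1_closeI:
  assumes "\<And>t. t \<in> {c..d} \<Longrightarrow> norm (position (y t) - position (x t)) < \<epsilon>"
    and "\<And>k t. t \<in> {c..d} \<Longrightarrow> norm (heading k (y t) - heading k (x t)) < \<epsilon>"
    and "\<And>t. t \<in> {c..d} \<Longrightarrow> norm (position (velocity c d y t) - position (velocity c d x t)) < \<epsilon>"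
    and "\<And>k t. t \<in> {c..d} \<Longrightarrow> norm (heading k (velocity c d y t) - heading k (velocity c d x t)) < \<epsilon>"
  shows "C1_close c d \<epsilon> x y"
proof -
  have coord: "\<bar>p i - q i\<bar> < \<epsilon>"
    if "norm (position p - position q) < \<epsilon>" "\<And>k. norm (heading k p - heading k q) < \<epsilon>" for p q :: "coord \<Rightarrow> real" and i
  proof (cases i)
    case Xi1
    then show ?thesis using that(1) abs_Re_le_cmod[of "position p - position q"] by (simp add: position_def)
  next
    case Xi2
    then show ?thesis using that(1) abs_Im_le_cmod[of "position p - position q"] by (simp add: position_def)
  next
    case (Cos k)
    then show ?thesis using that(2)[of k] abs_Re_le_cmod[of "heading k p - heading k q"] by (simp add: heading_def)
  next
    case (Sin k)
    then show ?thesis using that(2)[of k] abs_Im_le_cmod[of "heading k p - heading k q"] by (simp add: heading_def)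
  qed
  show ?thesis
    unfolding C1_close_def using assms by (intro ballI allI conjI coord)
qed

context bump_interval
begin

text \<open>
  A deformation of \<open>x\<close> on \<open>{p..q}\<close> through rolling trains, glued with \<open>x\<close> outside, is an integral curve
  as close to \<open>x\<close> as desired.  If \<open>x\<close> is rigid, it is a reparametrization of \<open>x\<close>; only the consequence for
  the path of the last axle is recorded.
\<close>

lemma deformation_is_reparametrization:
  assumes "c < d" and pq: "c < p" "q < d"
    and x: "trailer_curve n c d x"
    and "0 < r" and Q: "smooth 1 r Q" "\<And>t. t \<in> {p..q} \<Longrightarrow> Q t 0 = position (x t)"
    and F: "\<And>j. j \<le> n \<Longrightarrow> smooth 1 r (F j)" "\<And>j t. j \<le> n \<Longrightarrow> t \<in> {p..q} \<Longrightarrow> F j t 0 = heading j (x t)"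
    and normF: "\<And>j t e. j \<le> n \<Longrightarrow> t \<in> {p..q} \<Longrightarrow> e \<in> {0..r} \<Longrightarrow> norm (F j t e) = 1"
    and roll: "\<And>j t e. j \<le> n \<Longrightarrow> t \<in> {p..q} \<Longrightarrow> e \<in> {0..r} \<Longrightarrow>
      \<exists>s. ((\<lambda>s. Q s e + (\<Sum>l<j. F l s e)) has_vector_derivative of_real s * F j t e) (at t within {p..q})"
    and rigid: "rigid_motion n c d x"
  shows "\<exists>e \<phi> \<phi>'. 0 < e \<and> e \<le> r \<and> \<phi> c = c \<and> \<phi> d = d \<and>
    (\<forall>t\<in>{c..d}. (\<phi> has_real_derivative \<phi>' t) (at t within {c..d}) \<and> \<phi> t \<in> {c..d} \<and>
       position (x (\<phi> t)) = (if t \<in> {p..q} then Q t e else position (x t)))"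
proof -
  let ?J = "{p..q}" and ?I = "{c..d}"
  have sub: "?J \<subseteq> ?I" using pq by auto
  interpret X: trailer_motion n c d "\<lambda>t. position (x t)" "\<lambda>k t. heading k (x t)"
    "axle_speed c d x" "turning_rate c d x"
    by (rule integral_curve_motion[OF \<open>c < d\<close> x])
  have C1: "C1_curve c d x" and space_x: "\<And>t. t \<in> ?I \<Longrightarrow> x t \<in> trailer_space n"
    using x by (auto simp: integral_curve_def)
  obtain \<epsilon> where \<epsilon>: "0 < \<epsilon>" "\<And>y. trailer_curve n c d y \<Longrightarrow>
      y c = x c \<Longrightarrow> y d = x d \<Longrightarrow> C1_close c d \<epsilon> x y \<Longrightarrow> reparametrization c d x y"
    using rigid unfolding trailer_rigid_iff[OF \<open>c < d\<close> x] by blast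
  obtain r0 where r0: "0 < r0" "r0 \<le> r" "\<forall>e\<in>{0..r0}. \<exists>D D'. increment \<epsilon> Q e D D'"
    using small_increment[OF Q(1) \<open>0 < r\<close> \<epsilon>(1)] by blast
  have "\<exists>\<rho>. 0 < \<rho> \<and> (j \<le> n \<longrightarrow> (\<forall>e\<in>{0..\<rho>}. \<exists>D D'. increment \<epsilon> (F j) e D D'))" for j
    using small_increment[OF F(1)[of j] \<open>0 < r\<close> \<epsilon>(1)] zero_less_one by (cases "j \<le> n") blast+
  then obtain \<rho> where \<rho>: "\<And>j. 0 < \<rho> j"
    "\<And>j e. j \<le> n \<Longrightarrow> e \<in> {0..\<rho> j} \<Longrightarrow> \<exists>D D'. increment \<epsilon> (F j) e D D'"
    by metis
  define e where "e = Min (insert r0 (\<rho> ` {..n}))"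
  have e: "0 < e" "e \<le> r0" "\<And>j. j \<le> n \<Longrightarrow> e \<le> \<rho> j"
    unfolding e_def using r0(1) \<rho>(1) by (auto intro: Min_le simp del: Min_insert)
  have er: "e \<in> {0..r}" using e r0 by simp
  obtain DQ DQ' where incQ: "increment \<epsilon> Q e DQ DQ'"
    using r0(3) e(1,2) by (meson atLeastAtMost_iff less_imp_le)
  have "\<exists>D D'. j \<le> n \<longrightarrow> increment \<epsilon> (F j) e D D'" for j
    using \<rho>(2)[of j e] e(1,3) by force
  then obtain D D' where incF: "\<And>j. j \<le> n \<Longrightarrow> increment \<epsilon> (F j) e (D j) (D' j)"
    by metis
  have dQ: "(DQ has_vector_derivative DQ' t) (at t)" and cQ: "continuous_on UNIV DQ'"
    and nQ: "norm (DQ t) < \<epsilon>" "norm (DQ' t) < \<epsilon>"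
    and vQ: "DQ t = (if t \<in> ?J then Q t e - Q t 0 else 0)" "t \<notin> ?J \<Longrightarrow> DQ' t = 0" for t
    using incQ unfolding increment_def by blast+
  have dF: "(D j has_vector_derivative D' j t) (at t)"
    and cF: "continuous_on UNIV (D' j)"
    and nF: "norm (D j t) < \<epsilon>" "norm (D' j t) < \<epsilon>"
    and vF: "D j t = (if t \<in> ?J then F j t e - F j t 0 else 0)"
      "t \<notin> ?J \<Longrightarrow> D' j t = 0" if "j \<le> n" for j t
    using incF[OF that] unfolding increment_def by blast+
  define H where "H = (\<lambda>k t. if k \<le> n then heading k (x t) + D k t else 0)"
  define y where "y = (\<lambda>t i. case i of Xi1 \<Rightarrow> Re (position (x t) + DQ t) | Xi2 \<Rightarrow> Im (position (x t) + DQ t)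
    | Cos k \<Rightarrow> Re (H k t) | Sin k \<Rightarrow> Im (H k t))"
  have pos_y: "position (y t) = position (x t) + DQ t" and head_y: "heading k (y t) = H k t" for k t
    by (simp_all add: y_def position_def heading_def complex_eq_iff)
  have on_J: "position (y t) = Q t e" "\<And>k. k \<le> n \<Longrightarrow> heading k (y t) = F k t e" if "t \<in> ?J" for t
    using that vQ(1)[of t] vF(1)[of _ t] Q(2)[OF that] F(2)[OF _ that] by (auto simp: pos_y head_y H_def)
  have off_J: "y t = x t" if "t \<in> ?I" "t \<notin> ?J" for t
  proof (rule config_eqI)
    show "position (y t) = position (x t)" using that vQ(1)[of t] by (auto simp: pos_y)
    show "heading k (y t) = heading k (x t)" for k
      using that vF(1)[of k t] heading_beyond[OF space_x[OF that(1)], of k]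
      by (cases "k \<le> n") (auto simp: head_y H_def)
  qed
  define Q' where "Q' = (\<lambda>t. position (velocity c d x t) + DQ' t)"
  define H' where "H' = (\<lambda>k t. heading k (velocity c d x t) + D' k t)"
  have dpos: "((\<lambda>s. position (y s)) has_vector_derivative Q' t) (at t within ?I)" if "t \<in> ?I" for t
    unfolding pos_y Q'_def
    by (intro has_vector_derivative_add C1_curve_complex_derivatives[OF C1 that] has_vector_derivative_at_within[OF dQ])
  have dhead: "((\<lambda>s. heading k (y s)) has_vector_derivative H' k t) (at t within ?I)" if "k \<le> n" "t \<in> ?I" for k t
  proof -
    have "((\<lambda>s. heading k (x s) + D k s) has_vector_derivative H' k t) (at t within ?I)"
      unfolding H'_def
      by (intro has_vector_derivative_add C1_curve_complex_derivatives[OF C1 that(2)]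
          has_vector_derivative_at_within[OF dF[OF that(1)]])
    then show ?thesis using that(1) by (simp add: head_y H_def)
  qed
  have daxle: "((\<lambda>s. position (y s) + (\<Sum>j<k. heading j (y s))) has_vector_derivative Q' t + (\<Sum>j<k. H' j t)) (at t within ?I)"
    if "k \<le> n" "t \<in> ?I" for k t
    using that by (intro has_vector_derivative_add has_vector_derivative_sum dpos dhead) auto
  have space_y: "y t \<in> trailer_space n" if t: "t \<in> ?I" for t
  proof (cases "t \<in> ?J")
    case True
    have "norm (heading k (y t)) = 1" if "k \<le> n" for k
      using on_J(2)[OF True that] normF[OF that True er] by simp
    moreover have "heading k (y t) = 0" if "n < k" for k using that by (simp add: head_y H_def)
    ultimately show ?thesis
      by (auto simp: trailer_space_def heading_def cmod_def complex_eq_iff)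
  next
    case False
    then show ?thesis using off_J[OF t] space_x[OF t] by simp
  qed
  have rolling: "\<exists>s. Q' t + (\<Sum>j<k. H' j t) = of_real s * heading k (y t)" if k: "k \<le> n" and t: "t \<in> ?I" for k t
  proof (cases "t \<in> ?J")
    case True
    obtain s where s: "((\<lambda>s. Q s e + (\<Sum>l<k. F l s e)) has_vector_derivative of_real s * F k t e) (at t within ?J)"
      using roll[OF k True er] by blast
    have "((\<lambda>s. position (y s) + (\<Sum>j<k. heading j (y s))) has_vector_derivative of_real s * F k t e) (at t within ?J)"
      by (rule has_vector_derivative_transform[OF True _ s]) (use on_J k in simp)
    moreover have "((\<lambda>s. position (y s) + (\<Sum>j<k. heading j (y s))) has_vector_derivative Q' t + (\<Sum>j<k. H' j t)) (at t within ?J)"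
      by (rule has_vector_derivative_within_subset[OF daxle[OF k t] sub])
    ultimately have "Q' t + (\<Sum>j<k. H' j t) = of_real s * F k t e"
      using derivative_within_interval_unique[OF p_less_q True] by blast
    then show ?thesis using on_J(2)[OF True k] by auto
  next
    case False
    have "((\<lambda>s. position (x s) + (\<Sum>j<k. heading j (x s))) has_vector_derivative
        position (velocity c d x t) + (\<Sum>j<k. heading j (velocity c d x t))) (at t within ?I)"
      by (intro has_vector_derivative_add has_vector_derivative_sum C1_curve_complex_derivatives[OF C1 t])
    moreover have "((\<lambda>s. position (x s) + (\<Sum>j<k. heading j (x s))) has_vector_derivative
        of_real (axle_speed c d x k t) * heading k (x t)) (at t within ?I)"
      using X.axle_deriv[OF k t] by (simp add: X.axle_def[abs_def])
    ultimately have "position (velocity c d x t) + (\<Sum>j<k. heading j (velocity c d x t))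
        = of_real (axle_speed c d x k t) * heading k (x t)"
      using derivative_within_interval_unique[OF \<open>c < d\<close> t] by blast
    moreover have "Q' t + (\<Sum>j<k. H' j t) = position (velocity c d x t) + (\<Sum>j<k. heading j (velocity c d x t))"
      using vQ(2)[OF False] vF(2)[OF _ False] k by (simp add: Q'_def H'_def)
    ultimately show ?thesis using off_J[OF t False] by metis
  qed
  have contQ': "continuous_on ?I Q'" and contH': "continuous_on ?I (H' k)" if "k \<le> n" for k
    unfolding Q'_def H'_def
    using continuous_on_subset[OF cQ] continuous_on_subset[OF cF[OF that]]
    by (auto intro!: continuous_on_add C1_curve_complex_continuous[OF C1])
  note build = integral_curveI[OF \<open>c < d\<close> space_y dpos dhead contQ'[OF le0] contH' rolling]
  have y: "trailer_curve n c d y"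
    "\<And>t. t \<in> ?I \<Longrightarrow> position (velocity c d y t) = Q' t"
    "\<And>k t. t \<in> ?I \<Longrightarrow> heading k (velocity c d y t) = (if k \<le> n then H' k t else 0)"
    by (rule build; assumption)+
  have "C1_close c d \<epsilon> x y"
  proof (rule C1_closeI)
    fix k t assume t: "t \<in> ?I"
    show "norm (position (y t) - position (x t)) < \<epsilon>" using nQ(1) by (simp add: pos_y)
    show "norm (position (velocity c d y t) - position (velocity c d x t)) < \<epsilon>"
      using nQ(2) by (simp add: y(2)[OF t] Q'_def)
    show "norm (heading k (y t) - heading k (x t)) < \<epsilon>"
      using nF(1) \<epsilon>(1) heading_beyond[OF space_x[OF t], of k] by (cases "k \<le> n") (auto simp: head_y H_def)
    show "norm (heading k (velocity c d y t) - heading k (velocity c d x t)) < \<epsilon>"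
      using nF(2) \<epsilon>(1) heading_velocity_beyond[OF x t, of k] by (cases "k \<le> n") (auto simp: y(3)[OF t] H'_def)
  qed
  moreover have "y c = x c" "y d = x d" using off_J pq \<open>c < d\<close> by auto
  ultimately have "reparametrization c d x y" using \<epsilon>(2) y(1) by blast
  then obtain \<phi> \<phi>' where \<phi>: "\<phi> c = c" "\<phi> d = d"
    "\<And>t. t \<in> ?I \<Longrightarrow> (\<phi> has_real_derivative \<phi>' t) (at t within ?I)" "\<And>t. t \<in> ?I \<Longrightarrow> 0 < \<phi>' t"
    "\<And>t. t \<in> ?I \<Longrightarrow> y t = x (\<phi> t)"
    unfolding reparametrization_def by blast
  have inc: "\<phi> s < \<phi> t" if "s \<in> ?I" "t \<in> ?I" "s < t" for s t
    by (rule increasing_on_interval[OF \<phi>(3,4) that])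
  have "\<phi> t \<in> ?I" if "t \<in> ?I" for t
    using inc[of c t] inc[of t d] that \<open>c < d\<close> \<phi>(1,2) by (cases "t = c"; cases "t = d"; auto)
  moreover have "position (x (\<phi> t)) = (if t \<in> ?J then Q t e else position (x t))" if "t \<in> ?I" for t
    using \<phi>(5)[OF that, symmetric] on_J(1)[of t] off_J[OF that] by simp
  ultimately show ?thesis
    using e(1) e(2) r0(2) \<phi>(1-3) by (intro exI[of _ e] exI[of _ \<phi>] exI[of _ \<phi>']) auto
qed

end

text \<open>
  Near a time where the last axle moves, its path is pushed in the direction \<open>f\<close> normal to it.  In
  coordinates \<open>X\<close> along \<open>f\<close> and \<open>Y\<close> across, the integral \<open>\<integral> X dY\<close> is invariant under reparametrizations,
  but the deformation adds \<open>e b\<close> to \<open>X\<close>, where \<open>b\<close> is a bump, and changes the integral by \<open>e \<integral> b dY\<close>, in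
  which \<open>dY\<close> has one sign.
\<close>

lemma not_rigid_if_last_axle_moves:
  assumes "c < d" and x: "trailer_curve n c d x"
    and t1: "t1 \<in> {c..d}" "axle_speed c d x 0 t1 \<noteq> 0"
  shows "\<not> rigid_motion n c d x"
proof
  assume rigid: "rigid_motion n c d x"
  let ?I = "{c..d}" and ?v = "axle_speed c d x" and ?w = "turning_rate c d x"
  interpret X: trailer_motion n c d "\<lambda>t. position (x t)" "\<lambda>k t. heading k (x t)" ?v ?w
    by (rule integral_curve_motion[OF \<open>c < d\<close> x])
  obtain p0 q0 where p0: "c < p0" "p0 < q0" "q0 < d" "\<And>s. s \<in> {p0..q0} \<Longrightarrow> ?v 0 s \<noteq> 0"
    using nonzero_on_inner_interval[OF \<open>c < d\<close> X.cont_v[OF le0] t1] by blast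
  define f where "f = \<i> * heading 0 (x p0)"
  define Y' where "Y' = (\<lambda>t. ?v 0 t * Im (cnj f * heading 0 (x t)))"
  have p0I: "p0 \<in> ?I" using p0 by auto
  have "norm f = 1" using X.norm_E[OF le0 p0I] by (simp add: f_def norm_mult)
  then have f1: "cnj f * f = 1" using complex_norm_square[of f] by (simp add: mult.commute)
  have cE: "continuous_on ?I (\<lambda>t. heading 0 (x t))" using X.continuous_E[of 0] by simp
  have cY': "continuous_on ?I Y'"
    unfolding Y'_def by (intro continuous_on_mult X.cont_v continuous_on_Im continuous_on_const cE) simp
  have "cnj f * heading 0 (x p0) = - \<i> * (heading 0 (x p0) * cnj (heading 0 (x p0)))"
    by (simp add: f_def)
  then have "cnj f * heading 0 (x p0) = - \<i>" using X.E_cnj[OF le0 p0I] by simp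
  then have "Y' p0 \<noteq> 0" using p0 by (simp add: Y'_def del: complex_cnj_mult times_complex.sel)
  then obtain p q where pq: "c < p" "p < q" "q < d" "\<And>s. s \<in> {p..q} \<Longrightarrow> Y' s \<noteq> 0"
    using nonzero_on_inner_interval[OF \<open>c < d\<close> cY' p0I] by blast
  \<comment> \<open>The bump lives on the middle third, so the deformation is trivial near both ends.\<close>
  define p' q' where "p' = p + (q - p) / 3" and "q' = p + 2 * (q - p) / 3"
  let ?J = "{p..q}"
  have sub: "?J \<subseteq> ?I" using pq by auto
  interpret B: bump_interval p p' q' q "?v 0"
  proof
    show "p < p'" "p' < q'" "q' < q" using pq by (simp_all add: p'_def q'_def field_simps)
    show "continuous_on ?J (?v 0)" by (rule continuous_on_subset[OF X.cont_v sub]) simp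
    show "?v 0 t \<noteq> 0" if "t \<in> ?J" for t using pq(4)[OF that] by (auto simp: Y'_def)
  qed
  have M: "trailer_motion n p q (\<lambda>t. position (x t)) (\<lambda>k t. heading k (x t)) ?v ?w"
    using pq by (intro X.restrict) auto
  obtain b where b: "\<And>t. t \<in> ?J \<Longrightarrow> 0 \<le> b t" "\<And>t. t \<in> {p'<..<q'} \<Longrightarrow> 0 < b t"
    and sb: "B.smooth (n + 2) 1 (\<lambda>t e. of_real (e * b t))"
    using B.bump[of "n + 2" 1] by blast
  define S where "S = (\<lambda>t e. position (x t) + of_real (e * b t) * f)"
  have S: "B.smooth (n + 2) 1 S"
    unfolding S_def by (intro B.smooth_add B.smooth_mult B.smooth_const sb B.smooth_motion(2)[OF M refl]) simp
  have S0: "S t 0 = position (x t) + (\<Sum>j<0. heading j (x t))" for t by (simp add: S_def)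
  have moving: "?v k t \<noteq> 0" if "k \<le> n" "t \<in> ?J" for k t
    using X.speed_nonzero_above[of 0 t k] B.nonzero[of t] that sub by auto
  obtain r F where r: "0 < r" "r \<le> 1" and F: "\<And>j. j \<le> n \<Longrightarrow> B.smooth (n + 1 - j) r (F j) \<and>
     (\<forall>t\<in>?J. F j t 0 = heading j (x t)) \<and>
     (\<forall>t\<in>?J. \<forall>e\<in>{0..r}. norm (F j t e) = 1 \<and>
        (\<exists>s. ((\<lambda>s. S s e + (\<Sum>l<j. F l s e)) has_vector_derivative of_real s * F j t e) (at t within ?J)))"
    using B.tower[OF M, of 0 1 S "Suc n"] S S0 moving by (auto simp: less_Suc_eq_le atLeast0LessThan)
  have S1: "B.smooth 1 r S"
    by (rule B.smooth_mono[OF B.smooth_shrink[OF S r(2)]]) simp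
  have F1: "B.smooth 1 r (F j)" if "j \<le> n" for j
    by (rule B.smooth_mono[of "n + 1 - j"]) (use F[OF that] that in auto)
  have F0: "F j t 0 = heading j (x t)" if "j \<le> n" "t \<in> ?J" for j t
    using F[OF that(1)] that(2) by blast
  have nF: "norm (F j t e) = 1" if "j \<le> n" "t \<in> ?J" "e \<in> {0..r}" for j t e
    using F[OF that(1)] that(2,3) by blast
  have roll: "\<exists>s. ((\<lambda>s. S s e + (\<Sum>l<j. F l s e)) has_vector_derivative of_real s * F j t e) (at t within ?J)"
    if "j \<le> n" "t \<in> ?J" "e \<in> {0..r}" for j t e
    using F[OF that(1)] that(2,3) by blast
  have S0': "S t 0 = position (x t)" for t by (simp add: S_def)
  obtain e \<phi> \<phi>' where e: "0 < e" "\<phi> c = c" "\<phi> d = d"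
    and all: "\<forall>t\<in>?I. (\<phi> has_real_derivative \<phi>' t) (at t within ?I) \<and> \<phi> t \<in> ?I \<and>
      position (x (\<phi> t)) = (if t \<in> ?J then S t e else position (x t))"
    using B.deformation_is_reparametrization[OF \<open>c < d\<close> pq(1,3) x r(1) S1 S0' F1 F0 nF roll rigid]
    by blast
  have d\<phi>: "(\<phi> has_real_derivative \<phi>' t) (at t within ?I)" and \<phi>I: "\<phi> t \<in> ?I"
    and pos: "position (x (\<phi> t)) = (if t \<in> ?J then S t e else position (x t))" if "t \<in> ?I" for t
    using all that by blast+
  define X Y where "X = (\<lambda>t. Re (cnj f * position (x t)))" and "Y = (\<lambda>t. Im (cnj f * position (x t)))"
  define \<beta> where "\<beta> = (\<lambda>t. if t \<in> ?J then e * b t else 0)"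
  have shift: "cnj f * position (x (\<phi> t)) = cnj f * position (x t) + of_real (\<beta> t)" if "t \<in> ?I" for t
  proof -
    have "cnj f * (position (x t) + of_real (e * b t) * f) = cnj f * position (x t) + of_real (e * b t) * (cnj f * f)"
      by (simp add: algebra_simps)
    then show ?thesis using pos[OF that] by (simp add: f1 S_def \<beta>_def)
  qed
  have X\<phi>: "X (\<phi> t) = X t + \<beta> t" and Y\<phi>: "Y (\<phi> t) = Y t" if "t \<in> ?I" for t
    unfolding X_def Y_def shift[OF that] by simp_all
  have dp: "((\<lambda>t. cnj f * position (x t)) has_vector_derivative cnj f * (of_real (?v 0 t) * heading 0 (x t))) (at t within ?I)"
    if "t \<in> ?I" for t
    by (intro has_vector_derivative_mult_right X.P_deriv that)
  have Im_eq: "Im (cnj f * (of_real (?v 0 t) * heading 0 (x t))) = Y' t" for t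
    by (simp add: Y'_def algebra_simps)
  have dY: "(Y has_real_derivative Y' t) (at t within ?I)" if "t \<in> ?I" for t
    using dp[OF that] unfolding has_vector_derivative_complex_iff Im_eq Y_def by blast
  have cX: "continuous_on ?I X"
  proof -
    have "continuous_on ?I (\<lambda>t. cnj f * position (x t))"
      by (rule continuous_on_vector_derivative) (rule dp)
    then show ?thesis unfolding X_def by (rule continuous_on_Re)
  qed
  define G where "G = (\<lambda>t. integral {c..t} (\<lambda>s. X s * Y' s))"
  have dG: "(G has_real_derivative X t * Y' t) (at t within ?I)" if "t \<in> ?I" for t
    unfolding G_def by (rule integral_has_real_derivative[OF _ that]) (intro continuous_on_mult cX cY')
  have chain: "((\<lambda>s. g (\<phi> s)) has_real_derivative g' * \<phi>' t) (at t within ?I)"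
    if "t \<in> ?I" "(g has_real_derivative g') (at (\<phi> t) within ?I)" for g g' t
  proof -
    have "(g has_real_derivative g') (at (\<phi> t) within \<phi> ` ?I)"
      by (rule DERIV_subset[OF that(2)]) (use \<phi>I in auto)
    from DERIV_image_chain[OF this d\<phi>[OF that(1)]] show ?thesis by (simp add: o_def)
  qed
  have Y'\<phi>: "Y' (\<phi> t) * \<phi>' t = Y' t" if t: "t \<in> ?I" for t
  proof -
    have "(Y has_real_derivative Y' (\<phi> t) * \<phi>' t) (at t within ?I)"
      by (rule has_field_derivative_transform_within[OF chain[OF t dY[OF \<phi>I[OF t]]] zero_less_one t]) (rule Y\<phi>)
    then show ?thesis
      using derivative_within_interval_unique[OF \<open>c < d\<close> t] dY[OF t]
      unfolding has_real_derivative_iff_has_vector_derivative by blast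
  qed
  define \<sigma> where "\<sigma> = sgn (Y' p)"
  have \<sigma>: "sgn (Y' t) = \<sigma>" if "t \<in> ?J" for t
    unfolding \<sigma>_def using that pq by (intro continuous_on_sgn_constant[OF continuous_on_subset[OF cY' sub]]) auto
  have sign: "0 < \<sigma> * Y' t" if "t \<in> ?J" for t
    using \<sigma>[OF that] pq(4)[OF that] abs_sgn[of "Y' t"] by (metis mult.commute zero_less_abs_iff)
  have dK: "((\<lambda>t. \<sigma> * (G (\<phi> t) - G t)) has_real_derivative \<beta> t * (\<sigma> * Y' t)) (at t within ?I)" if t: "t \<in> ?I" for t
  proof -
    have "((\<lambda>t. \<sigma> * (G (\<phi> t) - G t)) has_real_derivative \<sigma> * (X (\<phi> t) * Y' (\<phi> t) * \<phi>' t - X t * Y' t)) (at t within ?I)"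
      by (intro DERIV_cmult DERIV_diff chain dG \<phi>I t)
    moreover have "\<sigma> * (X (\<phi> t) * Y' (\<phi> t) * \<phi>' t - X t * Y' t) = \<beta> t * (\<sigma> * Y' t)"
      unfolding mult.assoc Y'\<phi>[OF t] X\<phi>[OF t] by (simp add: algebra_simps)
    ultimately show ?thesis by (simp only:)
  qed
  define t2 where "t2 = (p' + q') / 2"
  have t2: "t2 \<in> {p'<..<q'}" "t2 \<in> ?J" "t2 \<in> ?I"
    using B.order sub by (auto simp: t2_def)
  have "\<beta> t2 * (\<sigma> * Y' t2) = 0"
  proof (rule derivative_vanishes_if_nonneg[OF \<open>c < d\<close> dK _ _ t2(3)])
    show "0 \<le> \<beta> t * (\<sigma> * Y' t)" if "t \<in> ?I" for t
    proof (cases "t \<in> ?J")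
      case True
      have "0 \<le> \<beta> t" using b(1)[OF True] e(1) True by (simp add: \<beta>_def)
      then show ?thesis using sign[OF True] by (rule mult_nonneg_nonneg[OF _ less_imp_le])
    qed (auto simp: \<beta>_def)
  qed (simp_all add: e)
  moreover have "0 < \<beta> t2" using b(2)[OF t2(1)] t2 e(1) by (simp add: \<beta>_def)
  ultimately show False using mult_pos_pos[OF _ sign[OF t2(2)], of "\<beta> t2"] by linarith
qed

text \<open>
  When the last trailer pivots around its fixed axle center, its path is regarded as a degenerate front with
  normal \<open>\<i> E 0\<close>, parametrized by the angle of the heading.  Adding \<open>e b\<close> to its support function
  moves the axle center by \<open>e (b \<i> E 0 - b' E 0)\<close>, always along the unchanged heading \<open>E 0\<close>, so the
  last axle is not fixed any more.
\<close>

lemma not_rigid_if_pivoting: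
  assumes "c < d" and x: "trailer_curve n c d x"
    and rest: "\<And>t. t \<in> {c..d} \<Longrightarrow> axle_speed c d x 0 t = 0"
    and t1: "t1 \<in> {c..d}" "turning_rate c d x 0 t1 \<noteq> 0"
  shows "\<not> rigid_motion n c d x"
proof
  assume rigid: "rigid_motion n c d x"
  let ?I = "{c..d}" and ?v = "axle_speed c d x" and ?w = "turning_rate c d x"
  interpret X: trailer_motion n c d "\<lambda>t. position (x t)" "\<lambda>k t. heading k (x t)" ?v ?w
    by (rule integral_curve_motion[OF \<open>c < d\<close> x])
  obtain p q where pq: "c < p" "p < q" "q < d" "\<And>s. s \<in> {p..q} \<Longrightarrow> ?w 0 s \<noteq> 0"
    using nonzero_on_inner_interval[OF \<open>c < d\<close> X.cont_w[OF le0] t1] by blast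
  define p' q' where "p' = p + (q - p) / 3" and "q' = p + 2 * (q - p) / 3"
  let ?J = "{p..q}"
  have sub: "?J \<subseteq> ?I" using pq by auto
  interpret B: bump_interval p p' q' q "?w 0"
  proof
    show "p < p'" "p' < q'" "q' < q" using pq by (simp_all add: p'_def q'_def field_simps)
    show "continuous_on ?J (?w 0)" by (rule continuous_on_subset[OF X.cont_w sub]) simp
  qed (rule pq(4))
  have M: "trailer_motion n p q (\<lambda>t. position (x t)) (\<lambda>k t. heading k (x t)) ?v ?w"
    using pq by (intro X.restrict) auto
  interpret M: trailer_motion n p q "\<lambda>t. position (x t)" "\<lambda>k t. heading k (x t)" ?v ?w
    by (rule M)
  define P0 where "P0 = position (x c)"
  have P0: "position (x t) = P0" if "t \<in> ?I" for t
    unfolding P0_def using X.at_rest_below(1)[OF le0 rest that, of c] \<open>c < d\<close> by simp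
  let ?E = "\<lambda>t. heading 0 (x t)"
  have cE: "continuous_on ?J ?E" using M.continuous_E[of 0] by simp
  have smE: "B.smooth m 1 (\<lambda>t e. ?E t)" for m
  proof (induction m)
    case 0
    show ?case using B.continuous_family_static[OF cE] by simp
  next
    case (Suc m)
    show ?case
    proof (rule B.smooth_static[OF cE])
      show "(?E has_vector_derivative of_real (?w 0 t) * (\<i> * ?E t)) (at t within ?J)" if "t \<in> ?J" for t
        using M.E_deriv[OF le0 that] by (simp add: algebra_simps)
      show "B.smooth m 1 (\<lambda>t e. \<i> * ?E t)" by (intro B.smooth_mult B.smooth_const Suc)
    qed
  qed
  have smP: "B.smooth m 1 (\<lambda>t e. position (x t))" for m
    by (rule B.smooth_cong[OF _ _ B.smooth_const[of m 1 P0]]) (use P0 sub in auto)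
  obtain b b' b'' where b: "\<And>t. t \<in> {p'<..<q'} \<Longrightarrow> 0 < b t"
    and db: "\<And>t. t \<in> ?J \<Longrightarrow> (b has_real_derivative ?w 0 t * b' t) (at t within ?J)"
    and db': "\<And>t. t \<in> ?J \<Longrightarrow> (b' has_real_derivative ?w 0 t * b'' t) (at t within ?J)"
    and sb: "B.smooth (n + 2) 1 (\<lambda>t e. of_real (e * b t))" "B.smooth (n + 2) 1 (\<lambda>t e. of_real (e * b' t))"
    using B.bump[of "n + 2" 1] by blast
  define Q where "Q = (\<lambda>t e. position (x t) + (of_real (e * b t) * \<i> + (- 1) * of_real (e * b' t)) * ?E t)"
  have Q: "B.smooth (n + 2) 1 Q"
    unfolding Q_def by (intro B.smooth_add B.smooth_mult B.smooth_const sb smP smE)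
  define S where "S = (\<lambda>t e. Q t e + ?E t)"
  have S: "B.smooth (n + 2) 1 S"
    unfolding S_def by (intro B.smooth_add Q smE)
  have S': "B.smooth (n + 2 - 1) 1 S" by (rule B.smooth_mono[OF S]) simp
  have S0: "S t 0 = position (x t) + (\<Sum>j<1. heading j (x t))" for t by (simp add: S_def Q_def)
  have moving: "?v k t \<noteq> 0" if "1 \<le> k" "k \<le> n" "t \<in> ?J" for k t
  proof -
    have "?v 1 t \<noteq> 0" using M.turning_le_speed[of 0 t] pq(4)[of t] that by auto
    then show ?thesis using M.speed_nonzero_above[of 1 t k] that by simp
  qed
  obtain r F where r: "0 < r" "r \<le> 1" and F: "\<forall>j. 1 \<le> j \<and> j < 1 + n \<longrightarrow> B.smooth (n + 1 - j) r (F j) \<and>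
     (\<forall>t\<in>?J. F j t 0 = heading j (x t)) \<and>
     (\<forall>t\<in>?J. \<forall>e\<in>{0..r}. norm (F j t e) = 1 \<and>
        (\<exists>s. ((\<lambda>s. S s e + (\<Sum>l\<in>{1..<j}. F l s e)) has_vector_derivative of_real s * F j t e) (at t within ?J)))"
    using B.tower[OF M moving S' _ S0, of n] by auto
  define F0 where "F0 = F(0 := \<lambda>t e. ?E t)"
  have F0: "F0 0 = (\<lambda>t e. ?E t)" "\<And>j. 1 \<le> j \<Longrightarrow> F0 j = F j" by (auto simp: F0_def)
  have Q1: "B.smooth 1 r Q"
    by (rule B.smooth_mono[OF B.smooth_shrink[OF Q r(2)]]) simp
  have Q0: "Q t 0 = position (x t)" for t by (simp add: Q_def)
  have F1: "B.smooth 1 r (F0 j)" if "j \<le> n" for j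
  proof (cases "j = 0")
    case True
    then show ?thesis using B.smooth_shrink[OF smE r(2)] by (simp add: F0)
  next
    case False
    then have "B.smooth (n + 1 - j) r (F j)" using F that by simp
    then have "B.smooth 1 r (F j)" by (rule B.smooth_mono) (use that in simp)
    then show ?thesis using False by (simp add: F0)
  qed
  have F00: "F0 j t 0 = heading j (x t)" if "j \<le> n" "t \<in> ?J" for j t
    using F that by (cases "j = 0") (auto simp: F0)
  have nF: "norm (F0 j t e) = 1" if "j \<le> n" "t \<in> ?J" "e \<in> {0..r}" for j t e
    using F that M.norm_E[OF le0 that(2)] by (cases "j = 0") (auto simp: F0)
  have roll: "\<exists>s. ((\<lambda>s. Q s e + (\<Sum>l<j. F0 l s e)) has_vector_derivative of_real s * F0 j t e) (at t within ?J)"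
    if j: "j \<le> n" and t: "t \<in> ?J" and e: "e \<in> {0..r}" for j t e
  proof (cases "j = 0")
    case True
    have "(Q' has_vector_derivative (of_real 0 * ?E t +
        ((of_real (e * b t) * \<i> + (- 1) * of_real (e * b' t)) * (\<i> * of_real (?w 0 t) * ?E t)
         + (of_real (e * (?w 0 t * b' t)) * \<i> + (- 1) * of_real (e * (?w 0 t * b'' t))) * ?E t))) (at t within ?J)"
      if Q': "Q' = (\<lambda>s. Q s e)" for Q'
      unfolding Q' Q_def
    proof (intro has_vector_derivative_add has_vector_derivative_mult has_vector_derivative_mult_left
        has_vector_derivative_mult_right has_vector_derivative_of_real DERIV_cmult db db' t M.E_deriv le0)
      show "((\<lambda>s. position (x s)) has_vector_derivative of_real 0 * ?E t) (at t within ?J)"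
        using M.P_deriv[OF t] rest t sub by auto
    qed
    moreover have "of_real 0 * ?E t +
        ((of_real (e * b t) * \<i> + (- 1) * of_real (e * b' t)) * (\<i> * of_real (?w 0 t) * ?E t)
         + (of_real (e * (?w 0 t * b' t)) * \<i> + (- 1) * of_real (e * (?w 0 t * b'' t))) * ?E t)
        = of_real (- e * ?w 0 t * (b t + b'' t)) * ?E t"
      by (simp add: algebra_simps)
    ultimately have "((\<lambda>s. Q s e) has_vector_derivative of_real (- e * ?w 0 t * (b t + b'' t)) * ?E t) (at t within ?J)"
      by (simp only:)
    then have "\<exists>s. ((\<lambda>s. Q s e) has_vector_derivative of_real s * ?E t) (at t within ?J)" by blast
    then show ?thesis using True by (simp add: F0)
  next
    case False
    have "S s e + (\<Sum>l\<in>{1..<j}. F l s e) = Q s e + (\<Sum>l<j. F0 l s e)" for s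
    proof -
      have "(\<Sum>l<j. F0 l s e) = F0 0 s e + (\<Sum>l\<in>{1..<j}. F0 l s e)"
        using False by (simp add: lessThan_atLeast0 sum.atLeast_Suc_lessThan)
      also have "(\<Sum>l\<in>{1..<j}. F0 l s e) = (\<Sum>l\<in>{1..<j}. F l s e)"
        by (intro sum.cong) (auto simp: F0)
      finally show ?thesis by (simp add: S_def F0 add.assoc)
    qed
    moreover have "\<exists>s. ((\<lambda>s. S s e + (\<Sum>l\<in>{1..<j}. F l s e)) has_vector_derivative of_real s * F j t e) (at t within ?J)"
      using F False j t e by simp
    ultimately show ?thesis using False by (simp add: F0)
  qed
  define t2 where "t2 = (p' + q') / 2"
  have t2: "t2 \<in> {p'<..<q'}" "t2 \<in> ?J" "t2 \<in> ?I"
    using B.order sub by (auto simp: t2_def)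
  obtain e \<phi> \<phi>' where e: "0 < e" and all: "\<forall>t\<in>?I. (\<phi> has_real_derivative \<phi>' t) (at t within ?I) \<and> \<phi> t \<in> ?I \<and>
      position (x (\<phi> t)) = (if t \<in> ?J then Q t e else position (x t))"
    using B.deformation_is_reparametrization[OF \<open>c < d\<close> pq(1,3) x r(1) Q1 Q0 F1 F00 nF roll rigid]
    by blast
  have \<phi>: "\<phi> t2 \<in> ?I" "position (x (\<phi> t2)) = Q t2 e"
    using all t2(2,3) by auto
  have "(of_real (e * b t2) * \<i> + (- 1) * of_real (e * b' t2)) * ?E t2 = 0"
    using \<phi>(2) P0[OF \<phi>(1)] P0[OF t2(3)] by (simp add: Q_def)
  then have "of_real (e * b t2) * \<i> + (- 1) * of_real (e * b' t2) = (0 :: complex)"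
    using M.E_nonzero[OF le0 t2(2)] by simp
  then have "e * b t2 = 0" by (simp add: complex_eq_iff)
  then show False using e b[OF t2(1)] by simp
qed

lemma not_rigid_if_axle_1_moves:
  assumes "c < d" and x: "trailer_curve n c d x"
    and imm: "immersed c d x" and t: "t \<in> {c..d}" and moves: "n = 0 \<or> axle_speed c d x 1 t \<noteq> 0"
  shows "\<not> rigid_motion n c d x"
proof (cases "\<exists>s\<in>{c..d}. axle_speed c d x 0 s \<noteq> 0")
  case True
  then show ?thesis using not_rigid_if_last_axle_moves[OF \<open>c < d\<close> x] by blast
next
  case False
  interpret X: trailer_motion n c d "\<lambda>t. position (x t)" "\<lambda>k t. heading k (x t)"
    "axle_speed c d x" "turning_rate c d x"
    by (rule integral_curve_motion[OF \<open>c < d\<close> x])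
  have "turning_rate c d x 0 t \<noteq> 0"
  proof (cases "n = 0")
    case True
    then show ?thesis
      using velocity_zero_if_stopped[OF \<open>c < d\<close> x t] False t imm by (auto simp: immersed_def)
  next
    case n: False
    then show ?thesis using X.speed_pythagoras[of 0 t] moves False t by auto
  qed
  then show ?thesis using not_rigid_if_pivoting[OF \<open>c < d\<close> x _ t] False by blast
qed

lemma axle_fixed_iff:
  assumes "a < b" and x: "trailer_curve n a b x" and k: "k \<le> n"
  shows "(\<lambda>t. axle_center k (x t)) constant_on {a..b} \<longleftrightarrow> (\<forall>t\<in>{a..b}. axle_speed a b x k t = 0)"
proof -
  interpret X: trailer_motion n a b "\<lambda>t. position (x t)" "\<lambda>k t. heading k (x t)"
    "axle_speed a b x" "turning_rate a b x"
    by (rule integral_curve_motion[OF \<open>a < b\<close> x])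
  have center: "axle_center k (x t) = (Re (X.axle k t), Im (X.axle k t))" for t
    by (simp add: axle_center_complex X.axle_def)
  have same: "axle_center k (x s) = axle_center k (x t) \<longleftrightarrow> X.axle k s = X.axle k t" for s t
    by (simp add: center complex_eq_iff)
  show ?thesis
  proof
    assume "(\<lambda>t. axle_center k (x t)) constant_on {a..b}"
    then have const: "X.axle k s = X.axle k a" if "s \<in> {a..b}" for s
      using that \<open>a < b\<close> unfolding constant_on_def by (metis same atLeastAtMost_iff less_imp_le order_refl)
    show "\<forall>t\<in>{a..b}. axle_speed a b x k t = 0"
    proof
      fix t assume t: "t \<in> {a..b}"
      have "(X.axle k has_vector_derivative 0) (at t within {a..b})"
        by (rule has_vector_derivative_transform[OF t _ has_vector_derivative_const[of "X.axle k a"]]) (rule const)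
      then have "of_real (axle_speed a b x k t) * heading k (x t) = 0"
        using derivative_within_interval_unique[OF \<open>a < b\<close> t X.axle_deriv[OF k t]] by blast
      then show "axle_speed a b x k t = 0" using X.E_nonzero[OF k t] by simp
    qed
  next
    assume rest: "\<forall>t\<in>{a..b}. axle_speed a b x k t = 0"
    have "axle_center k (x t) = axle_center k (x a)" if "t \<in> {a..b}" for t
      unfolding same using X.at_rest_below(3)[OF k _ that, of a] rest \<open>a < b\<close> by simp
    then show "(\<lambda>t. axle_center k (x t)) constant_on {a..b}" unfolding constant_on_def by blast
  qed
qed

theorem corollary6p10:
  fixes n :: nat and a b :: real and x :: "real \<Rightarrow> coord \<Rightarrow> real"
  assumes "a < b"
    and "integral_curve (trailer_space n) (trailer_distribution n) a b x"
    and "immersed a b x"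
  shows "locally_rigid (trailer_space n) (trailer_distribution n) a b x \<longleftrightarrow>
         2 \<le> card {k. k \<le> n \<and> (\<lambda>t. axle_center k (x t)) constant_on {a..b}}"
proof -
  let ?K = "{k. k \<le> n \<and> (\<lambda>t. axle_center k (x t)) constant_on {a..b}}"
  interpret X: trailer_motion n a b "\<lambda>t. position (x t)" "\<lambda>k t. heading k (x t)"
    "axle_speed a b x" "turning_rate a b x"
    by (rule integral_curve_motion[OF assms(1,2)])
  have K: "k \<in> ?K \<longleftrightarrow> k \<le> n \<and> (\<forall>t\<in>{a..b}. axle_speed a b x k t = 0)" for k
    using axle_fixed_iff[OF assms(1,2)] by blast
  have below: "j \<in> ?K" if "k \<in> ?K" "j < k" for j k
    using that X.speed_zero_below unfolding K by (meson less_imp_le order.trans)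
  have fin: "finite ?K" by simp
  have card: "2 \<le> card ?K \<longleftrightarrow> 1 \<in> ?K"
  proof
    assume "2 \<le> card ?K"
    then have "\<not> ?K \<subseteq> {0}" using card_mono[of "{0}" ?K] by auto
    then obtain k where "k \<in> ?K" "k \<noteq> 0" by blast
    then show "1 \<in> ?K" using below[of k 1] by (cases "k = 1") auto
  next
    assume "1 \<in> ?K"
    then have "{0, 1} \<subseteq> ?K" using below[of 1 0] by auto
    from card_mono[OF fin this] show "2 \<le> card ?K" by simp
  qed
  show ?thesis
    unfolding card
  proof
    assume "1 \<in> ?K"
    then show "locally_rigid (trailer_space n) (trailer_distribution n) a b x"
      using locally_rigid_if_axle_1_at_rest[OF assms] unfolding K by blast
  next
    assume loc: "locally_rigid (trailer_space n) (trailer_distribution n) a b x"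
    show "1 \<in> ?K"
    proof (rule ccontr)
      assume "1 \<notin> ?K"
      then obtain t where t: "t \<in> {a..b}" "n = 0 \<or> axle_speed a b x 1 t \<noteq> 0"
        unfolding K using assms(1) by (metis One_nat_def Suc_leI atLeastAtMost_iff less_imp_le neq0_conv order_refl)
      from loc t(1) obtain \<epsilon> where "0 < \<epsilon>"
        and rigid: "rigid_motion n (max a (t - \<epsilon>)) (min b (t + \<epsilon>)) x"
        unfolding locally_rigid_def by blast
      define c d where "c = max a (t - \<epsilon>)" and "d = min b (t + \<epsilon>)"
      have cd: "a \<le> c" "c < d" "d \<le> b" "t \<in> {c..d}"
        using t(1) \<open>0 < \<epsilon>\<close> assms(1) by (auto simp: c_def d_def)
      note sub = integral_curve_subinterval[OF assms(2) cd(1-3)]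
      have "immersed c d x"
        using assms(3) sub(2) cd by (auto simp: immersed_def)
      moreover have "axle_speed c d x 1 t = axle_speed a b x 1 t"
        using sub(2)[OF cd(4)] by (simp add: axle_speed_def)
      ultimately have "\<not> rigid_motion n c d x"
        using not_rigid_if_axle_1_moves[OF cd(2) sub(1) _ cd(4)] t(2) by simp
      then show False using rigid by (simp add: c_def d_def)
    qed
  qed
qed

end
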